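(* Let $M_2$ be a closed connected smooth manifold, $u_2\in H^1(M_2,\mathbb{R})$ a nonzero class, $\tilde M_2\to M_2$ an integration cover of $u_2$, and $\varphi:M_1\to M_2$ a smooth map from a closed connected smooth manifold $M_1$. Let $\varphi^*(\tilde M_2)\to M_1$ be the pulled-back covering. Then each connected component $\varphi^*(\tilde M_2)_0$ of $\varphi^*(\tilde M_2)$ is an integration cover for $\varphi^*(u_2)$. Whenever $\varphi^*(u_2)\ne0$, the group $\pi_1(\varphi^*(\tilde M_2)_0,\varphi^*u_2)$ does not depend (up to isomorphism) on the choice of the connected component, and $\varphi$ induces a group morphism $$\pi_1(\varphi^*(\tilde M_2)_0,\varphi^*u_2)\xrightarrow{\ \varphi_*\ }\pi_1(\tilde M_2,u_2).$$
   Context: Integration cover of $u\in H^1(M,\mathbb{R})$: a connected regular covering $p:\tilde M\to M$ with $p^*u=0$. Definition of the Novikov fundamental group $\pi_1(\tilde M,u)$ for $u\neq0$: for a closed $1$-form $\alpha\in u$ choose $f_\alpha:\tilde M\to\mathbb{R}$ with $df_\alpha=p^*\alpha$. For $h\in\mathbb{R}$ let $\lfloor\tilde M\rfloor_h=\tilde M/\{f_\alpha\le h\}$ (sublevel collapsed to a base point $\star_h$) and $\lfloor\pi_1(f_\alpha)\rfloor_h=\pi_1(\lfloor\tilde M\rfloor_h,\star_h)$; for $h<h'$ the projection induces $\lfloor\pi_1(f_\alpha)\rfloor_h\to\lfloor\pi_1(f_\alpha)\rfloor_{h'}$. Set $\pi_1(f_\alpha)=\varprojlim_{h\to-\infty}\lfloor\pi_1(f_\alpha)\rfloor_h$.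 For two choices $f_\alpha,f_\beta$ with $|f_\alpha-f_\beta|\le K$, inclusions $\{f_\alpha\le h-K\}\subset\{f_\beta\le h\}\subset\{f_\alpha\le h+K\}$ induce a canonical isomorphism $\pi_1(f_\alpha)\cong\pi_1(f_\beta)$; $\pi_1(\tilde M,u)$ is the resulting common group. Induced morphism: the natural map $\tilde\varphi:\varphi^*(\tilde M_2)_0\to\tilde M_2$ covers $\varphi$; if $f_2$ is a primitive on $\tilde M_2$ of (the lift of) a closed form in $u_2$, then $\tilde\varphi$ maps $\{f_2\circ\tilde\varphi\le h\}$ into $\{f_2\le h\}$, and "induced by $\varphi$" means the limit of the homomorphisms induced on the fundamental groups of the quotients by these sublevels. *)

theory Defs
  imports "HOL-Analysis.Analysis" "HOL-Algebra.Product_Groups"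
begin

section \<open>Smooth manifolds\<close>

primrec Ck_on :: "nat \<Rightarrow> 'e::real_normed_vector set \<Rightarrow> ('e \<Rightarrow> 'f::real_normed_vector) \<Rightarrow> bool" where
  "Ck_on 0 S f \<longleftrightarrow> continuous_on S f"
| "Ck_on (Suc k) S f \<longleftrightarrow>
     (\<forall>x\<in>S. f differentiable (at x)) \<and> (\<forall>v. Ck_on k S (\<lambda>x. frechet_derivative f (at x) v))"

text \<open>Meant for open \<open>S\<close> in a finite-dimensional space.\<close>

definition smooth_on :: "'e::real_normed_vector set \<Rightarrow> ('e \<Rightarrow> 'f::real_normed_vector) \<Rightarrow> bool" where
  "smooth_on S f \<longleftrightarrow> (\<forall>k. Ck_on k S f)"

type_synonym ('a, 'e) chart = "'a set \<times> ('a \<Rightarrow> 'e)"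

definition chart_inv :: "('a, 'e) chart \<Rightarrow> 'e \<Rightarrow> 'a" where
  "chart_inv c = inv_into (fst c) (snd c)"

definition smooth_atlas :: "'a topology \<Rightarrow> ('a, 'e::real_inner) chart set \<Rightarrow> bool" where
  "smooth_atlas X A \<longleftrightarrow>
     (\<Union>c\<in>A. fst c) = topspace X \<and>
     (\<forall>c\<in>A. openin X (fst c) \<and> open (snd c ` fst c) \<and>
        homeomorphic_map (subtopology X (fst c)) (top_of_set (snd c ` fst c)) (snd c)) \<and>
     (\<forall>c\<in>A. \<forall>d\<in>A. smooth_on (snd c ` (fst c \<inter> fst d)) (snd d \<circ> chart_inv c))"

record ('a, 'e) manifold =
  mtop :: "'a topology"
  atlas :: "('a, 'e) chart set"

text \<open>The model space is a finite-dimensional inner product space. The class \<open>euclidean_space\<close>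
  is not used because it excludes dimension \<open>0\<close>. The atlas need not be maximal.\<close>

definition smooth_manifold :: "('a, 'e::real_inner) manifold \<Rightarrow> bool" where
  "smooth_manifold M \<longleftrightarrow>
     (\<exists>B::'e set. finite B \<and> span B = UNIV) \<and>
     Hausdorff_space (mtop M) \<and> second_countable (mtop M) \<and> smooth_atlas (mtop M) (atlas M)"

definition closed_connected_manifold :: "('a, 'e::real_inner) manifold \<Rightarrow> bool" where
  "closed_connected_manifold M \<longleftrightarrow>
     smooth_manifold M \<and> compact_space (mtop M) \<and> connected_space (mtop M) \<and> topspace (mtop M) \<noteq> {}"

definition smooth_map ::
  "('a, 'd::real_inner) manifold \<Rightarrow> ('b, 'e::real_inner) manifold \<Rightarrow> ('a \<Rightarrow> 'b) \<Rightarrow> bool" where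
  "smooth_map M N \<phi> \<longleftrightarrow>
     continuous_map (mtop M) (mtop N) \<phi> \<and>
     (\<forall>c\<in>atlas M. \<forall>d\<in>atlas N.
        smooth_on (snd c ` (fst c \<inter> \<phi> -` fst d)) (snd d \<circ> \<phi> \<circ> chart_inv c))"

definition smooth_fun :: "('a, 'e::real_inner) manifold \<Rightarrow> ('a \<Rightarrow> real) \<Rightarrow> bool" where
  "smooth_fun M f \<longleftrightarrow> (\<forall>c\<in>atlas M. smooth_on (snd c ` fst c) (f \<circ> chart_inv c))"


section \<open>Closed 1-forms and first de Rham cohomology\<close>

text \<open>\<open>\<omega> c x v\<close> is the value of the form \<open>\<omega>\<close> at the point \<open>x\<close> on the tangent vector whose coordinate
  vector in the chart \<open>c\<close> is \<open>v\<close>. Only the values with \<open>c\<close> in the atlas and \<open>x\<close> in the domain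
  of \<open>c\<close> are meaningful.\<close>

type_synonym ('a, 'e) form1 = "('a, 'e) chart \<Rightarrow> 'a \<Rightarrow> 'e \<Rightarrow> real"

definition one_form :: "('a, 'e::real_inner) manifold \<Rightarrow> ('a, 'e) form1 \<Rightarrow> bool" where
  "one_form M \<omega> \<longleftrightarrow>
     (\<forall>c\<in>atlas M. (\<forall>x\<in>fst c. linear (\<omega> c x)) \<and>
        (\<forall>v. smooth_on (snd c ` fst c) (\<lambda>y. \<omega> c (chart_inv c y) v))) \<and>
     (\<forall>c\<in>atlas M. \<forall>d\<in>atlas M. \<forall>x\<in>fst c \<inter> fst d. \<forall>v.
        \<omega> c x v = \<omega> d x (frechet_derivative (snd d \<circ> chart_inv c) (at (snd c x)) v))"

definition closed_form :: "('a, 'e::real_inner) manifold \<Rightarrow> ('a, 'e) form1 \<Rightarrow> bool" where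
  "closed_form M \<omega> \<longleftrightarrow> one_form M \<omega> \<and>
     (\<forall>c\<in>atlas M. \<forall>y\<in>snd c ` fst c. \<forall>v w.
        frechet_derivative (\<lambda>z. \<omega> c (chart_inv c z) w) (at y) v =
        frechet_derivative (\<lambda>z. \<omega> c (chart_inv c z) v) (at y) w)"

definition differential :: "('a \<Rightarrow> real) \<Rightarrow> ('a, 'e::real_inner) form1" where
  "differential f c x v = frechet_derivative (f \<circ> chart_inv c) (at (snd c x)) v"

definition primitive :: "('a, 'e::real_inner) manifold \<Rightarrow> ('a, 'e) form1 \<Rightarrow> ('a \<Rightarrow> real) \<Rightarrow> bool" where
  "primitive M \<omega> f \<longleftrightarrow> smooth_fun M f \<and>
     (\<forall>c\<in>atlas M. \<forall>x\<in>fst c. \<forall>v. differential f c x v = \<omega> c x v)"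

definition cohomology_rel :: "('a, 'e::real_inner) manifold \<Rightarrow> (('a, 'e) form1 \<times> ('a, 'e) form1) set" where
  "cohomology_rel M =
     {(\<alpha>, \<beta>). closed_form M \<alpha> \<and> closed_form M \<beta> \<and>
        (\<exists>k. primitive M (\<lambda>c x v. \<beta> c x v - \<alpha> c x v) k)}"

definition de_Rham_H1 :: "('a, 'e::real_inner) manifold \<Rightarrow> ('a, 'e) form1 set set" where
  "de_Rham_H1 M = {\<omega>. closed_form M \<omega>} // cohomology_rel M"

definition zero_H1 :: "('a, 'e::real_inner) manifold \<Rightarrow> ('a, 'e) form1 set" where
  "zero_H1 M = cohomology_rel M `` {\<lambda>c x v. 0}"

text \<open>For a smooth \<open>\<phi>\<close> into \<open>N\<close> and a form \<open>\<omega>\<close> on \<open>N\<close>, the value below does not depend on the chosen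
  chart \<open>d\<close> around \<open>\<phi> x\<close>.\<close>

definition pullback_form ::
  "('b, 'e::real_inner) manifold \<Rightarrow> ('a \<Rightarrow> 'b) \<Rightarrow> ('b, 'e) form1 \<Rightarrow> ('a, 'd::real_inner) form1" where
  "pullback_form N \<phi> \<omega> c x v =
     (let d = (SOME d. d \<in> atlas N \<and> \<phi> x \<in> fst d)
      in \<omega> d (\<phi> x) (frechet_derivative (snd d \<circ> \<phi> \<circ> chart_inv c) (at (snd c x)) v))"

definition pullback_class ::
  "('a, 'd::real_inner) manifold \<Rightarrow> ('b, 'e::real_inner) manifold \<Rightarrow> ('a \<Rightarrow> 'b) \<Rightarrow>
   ('b, 'e) form1 set \<Rightarrow> ('a, 'd) form1 set" where
  "pullback_class M N \<phi> u = cohomology_rel M `` (pullback_form N \<phi> ` u)"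


section \<open>Coverings\<close>

text \<open>The type-class-free version of \<^const>\<open>covering_space\<close>.\<close>

definition covering_map :: "'c topology \<Rightarrow> 'a topology \<Rightarrow> ('c \<Rightarrow> 'a) \<Rightarrow> bool" where
  "covering_map X Y p \<longleftrightarrow>
     continuous_map X Y p \<and> p ` topspace X = topspace Y \<and>
     (\<forall>y\<in>topspace Y. \<exists>U. y \<in> U \<and> openin Y U \<and>
        (\<exists>\<V>. \<Union>\<V> = {x \<in> topspace X. p x \<in> U} \<and> (\<forall>V\<in>\<V>. openin X V) \<and> pairwise disjnt \<V> \<and>
           (\<forall>V\<in>\<V>. homeomorphic_map (subtopology X V) (subtopology Y U) p)))"

definition deck_transformation :: "'c topology \<Rightarrow> ('c \<Rightarrow> 'a) \<Rightarrow> ('c \<Rightarrow> 'c) \<Rightarrow> bool" where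
  "deck_transformation X p T \<longleftrightarrow> homeomorphic_map X X T \<and> (\<forall>x\<in>topspace X. p (T x) = p x)"

definition regular_covering :: "'c topology \<Rightarrow> 'a topology \<Rightarrow> ('c \<Rightarrow> 'a) \<Rightarrow> bool" where
  "regular_covering X Y p \<longleftrightarrow> covering_map X Y p \<and>
     (\<forall>x\<in>topspace X. \<forall>x'\<in>topspace X. p x = p x' \<longrightarrow> (\<exists>T. deck_transformation X p T \<and> T x = x'))"

text \<open>The total space of a covering of \<open>M\<close>, with the smooth structure making \<open>p\<close> a local
  diffeomorphism.\<close>

definition cover_manifold ::
  "('a, 'e::real_inner) manifold \<Rightarrow> 'c topology \<Rightarrow> ('c \<Rightarrow> 'a) \<Rightarrow> ('c, 'e) manifold" where
  "cover_manifold M X p =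
     \<lparr>mtop = X,
      atlas = {(V, \<psi> \<circ> p) |V U \<psi>. openin X V \<and> (U, \<psi>) \<in> atlas M \<and> inj_on p V \<and> p ` V \<subseteq> U}\<rparr>"

definition integration_cover ::
  "('a, 'e::real_inner) manifold \<Rightarrow> ('a, 'e) form1 set \<Rightarrow> 'c topology \<Rightarrow> ('c \<Rightarrow> 'a) \<Rightarrow> bool" where
  "integration_cover M u X p \<longleftrightarrow>
     connected_space X \<and> regular_covering X (mtop M) p \<and>
     pullback_class (cover_manifold M X p) M p u = zero_H1 (cover_manifold M X p)"

text \<open>The pulled-back covering has projection \<^const>\<open>fst\<close>, and \<^const>\<open>snd\<close> is the natural map to the
  given covering.\<close>

definition pullback_cover ::
  "'a topology \<Rightarrow> ('a \<Rightarrow> 'b) \<Rightarrow> 'c topology \<Rightarrow> ('c \<Rightarrow> 'b) \<Rightarrow> ('a \<times> 'c) topology" where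
  "pullback_cover X \<phi> Y p = subtopology (prod_topology X Y) {(x, y). \<phi> x = p y}"


section \<open>Fundamental groups and collapsed spaces\<close>

definition based_loops :: "'a topology \<Rightarrow> 'a \<Rightarrow> (real \<Rightarrow> 'a) set" where
  "based_loops X a = {g. pathin X g \<and> g 0 = a \<and> g 1 = a}"

definition loop_homotopy_rel :: "'a topology \<Rightarrow> 'a \<Rightarrow> ((real \<Rightarrow> 'a) \<times> (real \<Rightarrow> 'a)) set" where
  "loop_homotopy_rel X a =
     {(g, g'). homotopic_with (\<lambda>r. r 0 = a \<and> r 1 = a) (top_of_set {0..1}) X g g'}"

text \<open>As \<^const>\<open>joinpaths\<close>, without its type class constraint.\<close>

definition loop_join :: "(real \<Rightarrow> 'a) \<Rightarrow> (real \<Rightarrow> 'a) \<Rightarrow> real \<Rightarrow> 'a" where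
  "loop_join g g' = (\<lambda>t. if t \<le> 1/2 then g (2 * t) else g' (2 * t - 1))"

definition pi1 :: "'a topology \<Rightarrow> 'a \<Rightarrow> (real \<Rightarrow> 'a) set monoid" where
  "pi1 X a =
     \<lparr>carrier = based_loops X a // loop_homotopy_rel X a,
      monoid.mult = (\<lambda>A B. loop_homotopy_rel X a `` {loop_join g g' |g g'. g \<in> A \<and> g' \<in> B}),
      one = loop_homotopy_rel X a `` {\<lambda>t. a}\<rparr>"

definition pi1_map :: "'b topology \<Rightarrow> 'b \<Rightarrow> ('a \<Rightarrow> 'b) \<Rightarrow> (real \<Rightarrow> 'a) set \<Rightarrow> (real \<Rightarrow> 'b) set" where
  "pi1_map Y b F A = loop_homotopy_rel Y b `` ((\<lambda>g. F \<circ> g) ` A)"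

text \<open>The quotient \<open>X / A\<close>, with \<^const>\<open>None\<close> as the point to which \<open>A\<close> is collapsed. For empty \<open>A\<close>
  this adds an isolated base point.\<close>

definition collapse :: "'a set \<Rightarrow> 'a \<Rightarrow> 'a option" where
  "collapse A x = (if x \<in> A then None else Some x)"

definition collapse_space :: "'a topology \<Rightarrow> 'a set \<Rightarrow> 'a option topology" where
  "collapse_space X A =
     topology (\<lambda>U. U \<subseteq> insert None (collapse A ` topspace X) \<and>
                   openin X {x \<in> topspace X. collapse A x \<in> U})"

text \<open>The map \<open>X / A \<rightarrow> Y / B\<close> induced by \<open>F : X \<rightarrow> Y\<close> with \<open>F(A) \<subseteq> B\<close>.\<close>

definition collapse_map :: "'b set \<Rightarrow> ('a \<Rightarrow> 'b) \<Rightarrow> 'a option \<Rightarrow> 'b option" where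
  "collapse_map B F z = (case z of None \<Rightarrow> None | Some x \<Rightarrow> collapse B (F x))"


section \<open>The Novikov fundamental group\<close>

definition sublevel :: "'c topology \<Rightarrow> ('c \<Rightarrow> real) \<Rightarrow> real \<Rightarrow> 'c set" where
  "sublevel X f h = {x \<in> topspace X. f x \<le> h}"

abbreviation level_space :: "'c topology \<Rightarrow> ('c \<Rightarrow> real) \<Rightarrow> real \<Rightarrow> 'c option topology" where
  "level_space X f h \<equiv> collapse_space X (sublevel X f h)"

abbreviation level_pi1 ::
  "'c topology \<Rightarrow> ('c \<Rightarrow> real) \<Rightarrow> real \<Rightarrow> (real \<Rightarrow> 'c option) set monoid" where
  "level_pi1 X f h \<equiv> pi1 (level_space X f h) None"

abbreviation level_map :: "'c topology \<Rightarrow> ('c \<Rightarrow> real) \<Rightarrow> real \<Rightarrow> ('b \<Rightarrow> 'c) \<Rightarrow>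
    (real \<Rightarrow> 'b option) set \<Rightarrow> (real \<Rightarrow> 'c option) set" where
  "level_map Y f h F \<equiv> pi1_map (level_space Y f h) None (collapse_map (sublevel Y f h) F)"

definition pi1_limit ::
  "'c topology \<Rightarrow> ('c \<Rightarrow> real) \<Rightarrow> (real \<Rightarrow> (real \<Rightarrow> 'c option) set) monoid" where
  "pi1_limit X f =
     (product_group UNIV (level_pi1 X f))
       \<lparr>carrier := {x \<in> (\<Pi>\<^sub>E h\<in>UNIV. carrier (level_pi1 X f h)).
                      \<forall>h h'. h < h' \<longrightarrow> level_map X f h' id (x h) = x h'}\<rparr>"

text \<open>The isomorphism \<open>\<pi>\<^sub>1(f) \<cong> \<pi>\<^sub>1(g)\<close> for \<open>\<bar>f - g\<bar> \<le> K\<close>.\<close>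

definition shift_map :: "'c topology \<Rightarrow> ('c \<Rightarrow> real) \<Rightarrow> real \<Rightarrow>
    (real \<Rightarrow> (real \<Rightarrow> 'c option) set) \<Rightarrow> real \<Rightarrow> (real \<Rightarrow> 'c option) set" where
  "shift_map X g K x = (\<lambda>h. level_map X g h id (x (h - K)))"

definition primitives :: "('a, 'e::real_inner) manifold \<Rightarrow> ('a, 'e) form1 set \<Rightarrow>
    'c topology \<Rightarrow> ('c \<Rightarrow> 'a) \<Rightarrow> ('c \<Rightarrow> real) set" where
  "primitives M u X p =
     {f. \<exists>\<alpha>\<in>u. primitive (cover_manifold M X p) (pullback_form M p \<alpha>) f}"

text \<open>The common group of the \<open>\<pi>\<^sub>1(f)\<close>, realised as the limit of the system of canonical
  isomorphisms: an element is a family of elements of the \<open>\<pi>\<^sub>1(f)\<close>, one for each primitive \<open>f\<close>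
  of a form in \<open>u\<close>, which correspond to each other under these isomorphisms. Any two primitives
  are at bounded distance if \<open>M\<close> is compact and the covering connected, so that the projection
  to each \<open>\<pi>\<^sub>1(f)\<close> is an isomorphism.\<close>

definition novikov_group :: "('a, 'e::real_inner) manifold \<Rightarrow> ('a, 'e) form1 set \<Rightarrow>
    'c topology \<Rightarrow> ('c \<Rightarrow> 'a) \<Rightarrow> (('c \<Rightarrow> real) \<Rightarrow> real \<Rightarrow> (real \<Rightarrow> 'c option) set) monoid" where
  "novikov_group M u X p =
     (product_group (primitives M u X p) (pi1_limit X))
       \<lparr>carrier := {x \<in> (\<Pi>\<^sub>E f\<in>primitives M u X p. carrier (pi1_limit X f)).
          \<forall>f\<in>primitives M u X p. \<forall>g\<in>primitives M u X p. \<forall>K.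
            (\<forall>y\<in>topspace X. \<bar>f y - g y\<bar> \<le> K) \<longrightarrow> shift_map X g K (x f) = x g}\<rparr>"

text \<open>The map induced by \<open>F : X \<rightarrow> Y\<close>, where \<open>Y\<close> is a covering of \<open>M\<close>: on the component of a
  primitive \<open>f\<close> on \<open>Y\<close> it is the limit of the maps induced by \<open>F\<close> on the quotients by the
  sublevels of \<open>f \<circ> F\<close> and of \<open>f\<close>.\<close>

definition novikov_map :: "('b, 'e::real_inner) manifold \<Rightarrow> ('b, 'e) form1 set \<Rightarrow>
    'c topology \<Rightarrow> ('c \<Rightarrow> 'b) \<Rightarrow> ('d \<Rightarrow> 'c) \<Rightarrow>
    (('d \<Rightarrow> real) \<Rightarrow> real \<Rightarrow> (real \<Rightarrow> 'd option) set) \<Rightarrow>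
    (('c \<Rightarrow> real) \<Rightarrow> real \<Rightarrow> (real \<Rightarrow> 'c option) set)" where
  "novikov_map M u Y p F x = (\<lambda>f\<in>primitives M u Y p. \<lambda>h. level_map Y f h F (x (f \<circ> F) h))"

end

theory Submission
  imports Defs
begin

text \<open>The pulled-back covering is a covering of \<open>M\<^sub>1\<close>, and since \<open>M\<^sub>1\<close> is connected and locally
  connected, so is each of its components \<open>C\<close>. A deck transformation \<open>T\<close> of the given covering acts
  on the pulled-back covering as \<open>id \<times> T\<close>; these maps permute the components, act transitively on
  every fibre, and hence make \<open>C\<close> regular and identify any two components over \<open>M\<^sub>1\<close>. If \<open>f\<close> is a
  primitive of the lift of \<open>\<alpha> \<in> u\<^sub>2\<close>, then \<open>f \<circ> snd\<close> is a primitive on \<open>C\<close> of the lift of \<open>\<phi>\<^sup>*\<alpha>\<close>, because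
  both lifts are pullbacks along the diagonal of the pullback square; so \<open>\<phi>\<^sup>*u\<^sub>2\<close> vanishes on \<open>C\<close>. Every
  continuous map that pulls primitives back to primitives acts on the Novikov groups, functorially;
  this applies to \<open>snd\<close> and to the homeomorphisms between components.\<close>

section \<open>Calculus of the predicate \<open>Ck_on\<close>\<close>

text \<open>The model spaces are finite-dimensional inner product spaces, dimension 0 included, and
  \<open>Ck_on\<close> differentiates only in fixed directions. A pullback evaluates a form on a
  direction that varies with the point, so vectors are expanded in a finite frame; this yields the
  chain rule in every order and the coefficients of a pulled-back form. Membership in
  \<open>cohomology_rel\<close> includes closedness, so even placing
  \<open>\<phi>\<^sup>*\<alpha>\<close> in its own class requires that pullbacks preserve
  closedness, and there the symmetry of second derivatives enters. On the topological side, a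
  component of the fibre product might a priori miss part of the base or split a sheet; small
  connected neighbourhoods exclude both. The Novikov group is a family indexed by all primitives. A
  map acts on it once it pulls primitives back to primitives, and every compatibility then reduces
  to the fact that all maps between the quotients are induced by one map of points, only the
  sublevels changing.\<close>

lemma frechet_derivative_cong_open:
  assumes "open S" "x \<in> S" "\<And>y. y \<in> S \<Longrightarrow> f y = g y"
  shows "frechet_derivative f (at x) = frechet_derivative g (at x)"
proof -
  have "(f has_derivative D) (at x) \<longleftrightarrow> (g has_derivative D) (at x)" for D
    using has_derivative_transform_within_open[of f D x UNIV S g]
      has_derivative_transform_within_open[of g D x UNIV S f] assms by auto
  then show ?thesis
    by (simp add: frechet_derivative_def)
qed

lemma differentiable_cong_open:
  assumes "open S" "x \<in> S" "\<And>y. y \<in> S \<Longrightarrow> f y = g y" "f differentiable (at x)"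
  shows "g differentiable (at x)"
  using assms has_derivative_transform_within_open[of f _ x UNIV S g]
  unfolding differentiable_def by metis

lemma has_frechet_derivative_at:
  "f differentiable (at x) \<Longrightarrow> (f has_derivative frechet_derivative f (at x)) (at x)"
  by (simp add: frechet_derivative_works[symmetric])

lemma Ck_on_cong:
  assumes "open S" "\<And>x. x \<in> S \<Longrightarrow> f x = g x" "Ck_on k S f"
  shows "Ck_on k S g"
  using assms
proof (induction k arbitrary: f g)
  case 0
  then show ?case by (simp cong: continuous_on_cong)
next
  case (Suc k)
  have "g differentiable (at x)" if "x \<in> S" for x
    using Suc.prems that differentiable_cong_open[of S x f g] by auto
  moreover have "Ck_on k S (\<lambda>x. frechet_derivative g (at x) v)" for v
  proof (rule Suc.IH)
    show "frechet_derivative f (at x) v = frechet_derivative g (at x) v" if "x \<in> S" for x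
      using frechet_derivative_cong_open[of S x f g] Suc.prems that by auto
  qed (use Suc.prems in auto)
  ultimately show ?case by auto
qed

lemma Ck_on_subset: "Ck_on k S f \<Longrightarrow> T \<subseteq> S \<Longrightarrow> Ck_on k T f"
  by (induction k arbitrary: f) (auto intro: continuous_on_subset)

text \<open>\<open>Ck_on\<close> takes derivatives \<open>at x\<close>, not within \<open>S\<close>,
  so the conditions at a point do not see which open neighbourhood is used. Smoothness of a
  pulled-back form can thus be checked on one target chart at a time.\<close>

lemma Ck_on_local:
  assumes "\<And>x. x \<in> S \<Longrightarrow> \<exists>T. open T \<and> x \<in> T \<and> T \<subseteq> S \<and> Ck_on k T f"
  shows "Ck_on k S f"
  using assms
proof (induction k arbitrary: f)
  case 0
  have "isCont f x" if "x \<in> S" for x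
    using 0[OF that] by (auto simp: continuous_on_eq_continuous_at)
  then show ?case by (simp add: continuous_at_imp_continuous_on)
next
  case (Suc k)
  then have "Ck_on k S (\<lambda>x. frechet_derivative f (at x) v)" for v
    by (intro Suc.IH) (metis Ck_on.simps(2))
  moreover have "f differentiable (at x)" if "x \<in> S" for x
    using Suc.prems[OF that] by auto
  ultimately show ?case by auto
qed

text \<open>The starting case is that differentiability implies continuity. The lowering serves the
  product and chain rules, whose derivatives still contain undifferentiated factors.\<close>

lemma Ck_on_SucD: "Ck_on (Suc k) S f \<Longrightarrow> Ck_on k S f"
proof (induction k arbitrary: f)
  case 0
  then show ?case
    by (auto intro!: continuous_at_imp_continuous_on differentiable_imp_continuous_within)
next
  case (Suc k)
  then show ?case by (metis Ck_on.simps(2))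
qed

lemma Ck_on_const: "Ck_on k S (\<lambda>x. c)"
  by (induction k arbitrary: c) (auto simp: frechet_derivative_const)

lemma Ck_on_bounded_linear:
  assumes "bounded_linear L" "open S" "Ck_on k S f"
  shows "Ck_on k S (\<lambda>x. L (f x))"
  using assms(3)
proof (induction k arbitrary: f)
  case 0
  then show ?case using assms(1) by (auto intro: bounded_linear.continuous_on)
next
  case (Suc k)
  have d: "((\<lambda>x. L (f x)) has_derivative (\<lambda>v. L (frechet_derivative f (at x) v))) (at x)"
    if "x \<in> S" for x
    using Suc.prems that by (intro bounded_linear.has_derivative[OF assms(1)] has_frechet_derivative_at) auto
  have "frechet_derivative (\<lambda>x. L (f x)) (at x) v = L (frechet_derivative f (at x) v)" if "x \<in> S" for x v
    by (simp add: frechet_derivative_at[OF d[OF that], symmetric])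
  moreover have "Ck_on k S (\<lambda>x. L (frechet_derivative f (at x) v))" for v
    using Suc by auto
  ultimately have "Ck_on k S (\<lambda>x. frechet_derivative (\<lambda>x. L (f x)) (at x) v)" for v
    by (metis (no_types, lifting) Ck_on_cong assms(2))
  with d show ?case by (auto simp: differentiable_def)
qed

lemma Ck_on_add:
  assumes "open S" "Ck_on k S f" "Ck_on k S g"
  shows "Ck_on k S (\<lambda>x. f x + g x)"
  using assms(2,3)
proof (induction k arbitrary: f g)
  case 0
  then show ?case by (auto intro: continuous_intros)
next
  case (Suc k)
  have d: "((\<lambda>x. f x + g x) has_derivative (\<lambda>v. frechet_derivative f (at x) v + frechet_derivative g (at x) v)) (at x)"
    if "x \<in> S" for x
    using Suc.prems that by (intro has_derivative_add has_frechet_derivative_at) auto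
  have "frechet_derivative (\<lambda>x. f x + g x) (at x) v = frechet_derivative f (at x) v + frechet_derivative g (at x) v"
    if "x \<in> S" for x v
    by (simp add: frechet_derivative_at[OF d[OF that], symmetric])
  moreover have "Ck_on k S (\<lambda>x. frechet_derivative f (at x) v + frechet_derivative g (at x) v)" for v
    using Suc by auto
  ultimately have "Ck_on k S (\<lambda>x. frechet_derivative (\<lambda>x. f x + g x) (at x) v)" for v
    by (metis (no_types, lifting) Ck_on_cong assms(1))
  with d show ?case by (auto simp: differentiable_def)
qed

lemma Ck_on_sum:
  assumes "open S" "\<And>i. i \<in> I \<Longrightarrow> Ck_on k S (f i)"
  shows "Ck_on k S (\<lambda>x. \<Sum>i\<in>I. f i x)"
  using assms(2)
  by (induction I rule: infinite_finite_induct) (auto intro!: Ck_on_const Ck_on_add assms(1))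

lemma Ck_on_scaleR:
  fixes c :: "'a::real_normed_vector \<Rightarrow> real"
  assumes "open S" "Ck_on k S c" "Ck_on k S g"
  shows "Ck_on k S (\<lambda>x. c x *\<^sub>R g x)"
  using assms(2,3)
proof (induction k arbitrary: c g)
  case 0
  then show ?case by (auto intro: continuous_intros)
next
  case (Suc k)
  let ?D = "\<lambda>x v. c x *\<^sub>R frechet_derivative g (at x) v + frechet_derivative c (at x) v *\<^sub>R g x"
  have d: "((\<lambda>x. c x *\<^sub>R g x) has_derivative ?D x) (at x)"
    if "x \<in> S" for x
    using Suc.prems that by (intro has_derivative_scaleR has_frechet_derivative_at) auto
  have "frechet_derivative (\<lambda>x. c x *\<^sub>R g x) (at x) v = ?D x v"
    if "x \<in> S" for x v
    by (simp add: frechet_derivative_at[OF d[OF that], symmetric])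
  moreover have "Ck_on k S (\<lambda>x. ?D x v)" for v
    using Suc.prems Suc.prems[THEN Ck_on_SucD] by (intro Ck_on_add assms(1) Suc.IH) simp_all
  ultimately have "Ck_on k S (\<lambda>x. frechet_derivative (\<lambda>x. c x *\<^sub>R g x) (at x) v)" for v
    by (metis (no_types, lifting) Ck_on_cong assms(1))
  with d show ?case by (auto simp: differentiable_def)
qed

section \<open>Finite frames and the chain rule of order \<open>k\<close>\<close>

text \<open>The reproducing identity of an orthonormal basis (a Parseval frame), taken as the
  definition because a basis is used below only to expand a vector under a linear map. In dimension
  0 the empty set qualifies.\<close>

definition frame :: "'e::real_inner set \<Rightarrow> bool" where
  "frame B \<longleftrightarrow> finite B \<and> (\<forall>w. (\<Sum>b\<in>B. (w \<bullet> b) *\<^sub>R b) = w)"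

lemma frame_linear:
  assumes "frame B" "linear L"
  shows "L w = (\<Sum>b\<in>B. (w \<bullet> b) *\<^sub>R L b)"
proof -
  have "L w = L (\<Sum>b\<in>B. (w \<bullet> b) *\<^sub>R b)" using assms(1) by (simp add: frame_def)
  then show ?thesis using assms(2) by (simp add: linear_sum linear_cmul)
qed

text \<open>Gram--Schmidt; the class \<open>euclidean_space\<close> is not available for the model spaces.\<close>

lemma frame_exists:
  fixes B :: "'e::real_inner set"
  assumes "finite B" "span B = UNIV"
  obtains E :: "'e set" where "frame E"
proof -
  \<comment> \<open>The claim is relative to \<open>span B\<close>, so that the induction can
    enlarge the space by one vector at a time.\<close>
  have "\<exists>E. finite E \<and> E \<subseteq> span B \<and> (\<forall>w\<in>span B. (\<Sum>b\<in>E. (w \<bullet> b) *\<^sub>R b) = w)"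
    using assms(1)
  proof (induction B)
    case empty
    then show ?case by (intro exI[of _ "{}"]) auto
  next
    case (insert a B)
    then obtain E where E: "finite E" "E \<subseteq> span B" and Ew: "\<And>w. w \<in> span B \<Longrightarrow> (\<Sum>b\<in>E. (w \<bullet> b) *\<^sub>R b) = w"
      by blast
    \<comment> \<open>The orthogonal projection of \<open>a\<close> onto \<open>span B\<close>. The
      residual \<open>a - p\<close>, normalised by \<open>sgn\<close>, is the vector to be added
      unless it is zero.\<close>
    define p where "p = (\<Sum>b\<in>E. (a \<bullet> b) *\<^sub>R b)"
    have p: "p \<in> span B" unfolding p_def using E by (intro span_sum span_mul) auto
    have orth: "w \<bullet> (a - p) = 0" if "w \<in> span B" for w
    proof -
      have "w \<bullet> p = (\<Sum>b\<in>E. (w \<bullet> b) *\<^sub>R b) \<bullet> a"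
        unfolding p_def by (simp add: inner_sum_right inner_sum_left inner_commute mult.commute)
      then show ?thesis using Ew[OF that] by (simp add: inner_diff_right)
    qed
    have BI: "span B \<subseteq> span (insert a B)" by (rule span_mono) auto
    define F where "F = (if a = p then E else insert (sgn (a - p)) E)"
    have F: "finite F" "F \<subseteq> span (insert a B)"
    proof -
      have "sgn (a - p) \<in> span (insert a B)"
        using BI p by (auto simp: sgn_div_norm intro!: span_mul span_diff intro: span_base)
      then show "finite F" "F \<subseteq> span (insert a B)"
        unfolding F_def using E BI by auto
    qed
    \<comment> \<open>Since \<open>sgn 0 = 0\<close>, the formula also covers the case in which
      nothing was added. Otherwise \<open>sgn (a - p)\<close> must be new to \<open>E\<close>, as
      inserting an old element would add no summand; orthogonality to \<open>span B\<close> ensures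
      this.\<close>
    have key: "(\<Sum>b\<in>F. (w \<bullet> b) *\<^sub>R b) = (\<Sum>b\<in>E. (w \<bullet> b) *\<^sub>R b) + (w \<bullet> sgn (a - p)) *\<^sub>R sgn (a - p)" for w
    proof (cases "a = p")
      case False
      have "sgn (a - p) \<notin> E"
      proof
        assume "sgn (a - p) \<in> E"
        then have "sgn (a - p) \<bullet> (a - p) = 0" using E orth by auto
        then show False using False by (simp add: sgn_div_norm)
      qed
      then show ?thesis using False E by (simp add: F_def add.commute)
    qed (simp add: F_def)
    \<comment> \<open>The vectors reproduced by the expansion form a subspace, so it suffices to
      test \<open>a\<close> and the elements of \<open>B\<close>.\<close>
    have "(\<Sum>b\<in>F. (w \<bullet> b) *\<^sub>R b) = w" if "w \<in> span (insert a B)" for w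
      using that
    proof (induction rule: span_induct)
      case base
      show ?case
      proof (rule subspaceI)
        fix c :: real and w assume "w \<in> {w. (\<Sum>b\<in>F. (w \<bullet> b) *\<^sub>R b) = w}"
        then have "c *\<^sub>R (\<Sum>b\<in>F. (w \<bullet> b) *\<^sub>R b) = c *\<^sub>R w" by simp
        then show "c *\<^sub>R w \<in> {w. (\<Sum>b\<in>F. (w \<bullet> b) *\<^sub>R b) = w}"
          by (simp add: scaleR_sum_right)
      qed (simp_all add: inner_add_left scaleR_left_distrib sum.distrib)
    next
      case (step x)
      then consider "x = a" | "x \<in> span B" by (auto intro: span_base)
      then show ?case
      proof cases
        case 1
        have "a \<bullet> sgn (a - p) = norm (a - p)"
        proof -
          have "a \<bullet> (a - p) = (a - p) \<bullet> (a - p)"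
            using orth[OF p] by (simp add: inner_diff_left)
          then show ?thesis
            by (cases "a = p") (simp_all add: sgn_div_norm power2_norm_eq_inner[symmetric] power2_eq_square)
        qed
        then have "(a \<bullet> sgn (a - p)) *\<^sub>R sgn (a - p) = a - p"
          by (cases "a = p") (simp_all add: sgn_div_norm)
        then show ?thesis unfolding key 1 by (simp add: p_def[symmetric])
      next
        case 2
        then have "x \<bullet> sgn (a - p) = 0" using orth by (simp add: sgn_div_norm)
        then show ?thesis unfolding key using Ew[OF 2] by simp
      qed
    qed
    with F show ?case by blast
  qed
  then show ?thesis using that assms(2) unfolding frame_def by auto
qed

lemma frechet_derivative_comp_at:
  assumes "f differentiable (at x)" "g differentiable (at (f x))"
  shows "frechet_derivative (g \<circ> f) (at x) v = frechet_derivative g (at (f x)) (frechet_derivative f (at x) v)"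
  using frechet_derivative_compose[OF assms] by simp

text \<open>The derivative of \<open>g \<circ> f\<close> along \<open>v\<close> is that of
  \<open>g\<close> in the direction \<open>frechet_derivative f (at x) v\<close>, which moves with
  \<open>x\<close>, whereas \<open>Ck_on\<close> controls fixed directions only. Expanding this
  direction in the frame gives a finite sum of products whose factors are components of the
  derivative of \<open>f\<close> and fixed-direction derivatives of \<open>g\<close> composed with
  \<open>f\<close>; the induction hypothesis applies to the latter.\<close>

lemma Ck_on_compose:
  fixes f :: "'d::real_normed_vector \<Rightarrow> 'e::real_inner" and g :: "'e \<Rightarrow> 'f::real_normed_vector"
  assumes B: "frame (B::'e set)" and "open S" "open T" "f ` S \<subseteq> T" "Ck_on k S f" "Ck_on k T g"
  shows "Ck_on k S (g \<circ> f)"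
  using assms(5,6)
proof (induction k arbitrary: g)
  case 0
  then show ?case using assms(4) continuous_on_compose[of S f g] continuous_on_subset[of T g "f ` S"]
    by simp
next
  case (Suc k)
  have df: "f differentiable (at x)" and dg: "g differentiable (at (f x))" if "x \<in> S" for x
    using Suc.prems that assms(4) by auto
  let ?D = "\<lambda>v x. \<Sum>b\<in>B. (frechet_derivative f (at x) v \<bullet> b) *\<^sub>R ((\<lambda>y. frechet_derivative g (at y) b) \<circ> f) x"
  have "?D v x = frechet_derivative (g \<circ> f) (at x) v" if "x \<in> S" for x v
    unfolding frechet_derivative_comp_at[OF df[OF that] dg[OF that]] comp_apply
    by (rule frame_linear[OF B linear_frechet_derivative[OF dg[OF that]], symmetric])
  moreover have "Ck_on k S (?D v)" for v
  proof (intro Ck_on_sum Ck_on_scaleR assms(2))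
    show "Ck_on k S (\<lambda>x. frechet_derivative f (at x) v \<bullet> b)" for b
      using Suc.prems by (intro Ck_on_bounded_linear[OF bounded_linear_inner_left assms(2)]) auto
    show "Ck_on k S ((\<lambda>y. frechet_derivative g (at y) b) \<circ> f)" for b
      using Suc.prems Suc.prems(1)[THEN Ck_on_SucD] by (intro Suc.IH) simp_all
  qed
  ultimately have "Ck_on k S (\<lambda>x. frechet_derivative (g \<circ> f) (at x) v)" for v
    by (rule Ck_on_cong[OF assms(2)])
  moreover have "(g \<circ> f) differentiable (at x)" if "x \<in> S" for x
    using df dg that by (auto intro: differentiable_chain_at)
  ultimately show ?case unfolding Ck_on.simps by blast
qed

section \<open>Symmetry of second derivatives\<close>

text \<open>The mean value theorem along \<open>v\<close> turns the second difference into
  \<open>t\<close> times a difference of two values of \<open>G\<close>, the derivative of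
  \<open>f\<close> along \<open>v\<close>. Differentiability of \<open>G\<close> at \<open>x\<close>
  alone evaluates this difference: the terms \<open>G x\<close> and \<open>L (s *\<^sub>R v)\<close>
  cancel, and \<open>t * L w\<close> remains.\<close>

lemma second_difference_limit:
  fixes f :: "'d::real_normed_vector \<Rightarrow> real"
  assumes S: "open S" "x \<in> S" "\<And>y. y \<in> S \<Longrightarrow> f differentiable (at y)"
    and d: "(\<lambda>y. frechet_derivative f (at y) v) differentiable (at x)"
  shows "((\<lambda>t. (f (x + t *\<^sub>R v + t *\<^sub>R w) - f (x + t *\<^sub>R v) - f (x + t *\<^sub>R w) + f x) / t\<^sup>2)
    \<longlongrightarrow> frechet_derivative (\<lambda>y. frechet_derivative f (at y) v) (at x) w) (at_right 0)"
proof -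
  define G where "G = (\<lambda>y. frechet_derivative f (at y) v)"
  define L where "L = frechet_derivative G (at x)"
  define N where "N = norm v + norm w"
  define \<Delta> where "\<Delta> = (\<lambda>t. f (x + t *\<^sub>R v + t *\<^sub>R w) - f (x + t *\<^sub>R v) - f (x + t *\<^sub>R w) + f x)"
  have GL: "(G has_derivative L) (at x)"
    using d unfolding G_def L_def by (simp add: frechet_derivative_works[symmetric])
  then have lin: "bounded_linear L" by (rule has_derivative_bounded_linear)
  have "((\<lambda>t. \<Delta> t / t\<^sup>2) \<longlongrightarrow> L w) (at_right 0)"
  proof (rule tendstoI)
    fix e :: real assume e: "e > 0"
    \<comment> \<open>Two values of \<open>G\<close> are estimated, each with error
      \<open>\<epsilon> * (t * N)\<close>, so \<open>2 * \<epsilon> * N < e\<close> is needed. The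
      added 1 keeps the denominator positive when \<open>v\<close> and \<open>w\<close>
      vanish.\<close>
    define \<epsilon> where "\<epsilon> = e / (2 * N + 1)"
    have N: "N \<ge> 0" by (simp add: N_def)
    have \<epsilon>: "\<epsilon> > 0" using e N by (auto simp: \<epsilon>_def intro!: divide_pos_pos)
    have \<epsilon>e: "2 * \<epsilon> * N < e"
    proof -
      have "\<epsilon> * (2 * N + 1) = e" using N by (simp add: \<epsilon>_def)
      then show ?thesis using \<epsilon> by (simp add: algebra_simps)
    qed
    obtain r where r: "r > 0" "\<And>y. norm (y - x) < r \<Longrightarrow> norm (G y - G x - L (y - x)) \<le> \<epsilon> * norm (y - x)"
      using GL \<epsilon> unfolding has_derivative_at_alt by blast
    obtain q where q: "q > 0" "ball x q \<subseteq> S" using S open_contains_ball by blast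
    \<comment> \<open>For \<open>t < \<delta>\<close> every point of the parallelogram spanned by
      \<open>t *\<^sub>R v\<close> and \<open>t *\<^sub>R w\<close> at \<open>x\<close> is within
      \<open>t * N < min r q\<close> of \<open>x\<close>: the radius \<open>r\<close> serves the
      estimate for \<open>G\<close>, the radius \<open>q\<close> membership in
      \<open>S\<close>.\<close>
    define \<delta> where "\<delta> = min r q / (N + 1)"
    have \<delta>: "\<delta> > 0" using r q N by (auto simp: \<delta>_def)
    have "dist (\<Delta> t / t\<^sup>2) (L w) < e" if t: "0 < t" "t < \<delta>" for t
    proof -
      have tN: "t * N < min r q"
      proof -
        have "t * N \<le> t * (N + 1)" using t by simp
        also have "\<dots> < \<delta> * (N + 1)" using t N by simp
        also have "\<dots> = min r q" using N by (simp add: \<delta>_def)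
        finally show ?thesis .
      qed
      have small: "norm (s *\<^sub>R v + u *\<^sub>R w) \<le> t * N" if "0 \<le> s" "s \<le> t" "0 \<le> u" "u \<le> t" for s u
      proof -
        have "norm (s *\<^sub>R v + u *\<^sub>R w) \<le> s * norm v + u * norm w"
          using norm_triangle_ineq[of "s *\<^sub>R v" "u *\<^sub>R w"] that by simp
        also have "\<dots> \<le> t * norm v + t * norm w"
          using that by (intro add_mono mult_right_mono) auto
        finally show ?thesis by (simp add: N_def algebra_simps)
      qed
      have inS: "x + s *\<^sub>R v + u *\<^sub>R w \<in> S" if "0 \<le> s" "s \<le> t" "0 \<le> u" "u \<le> t" for s u
        using small[OF that] tN q(2) by (auto simp: dist_norm subset_iff add.assoc norm_minus_commute)
      have est: "\<bar>G (x + s *\<^sub>R v + u *\<^sub>R w) - G x - L (s *\<^sub>R v + u *\<^sub>R w)\<bar> \<le> \<epsilon> * (t * N)"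
        if "0 \<le> s" "s \<le> t" "0 \<le> u" "u \<le> t" for s u
      proof -
        have "\<bar>G (x + s *\<^sub>R v + u *\<^sub>R w) - G x - L (s *\<^sub>R v + u *\<^sub>R w)\<bar> \<le> \<epsilon> * norm (s *\<^sub>R v + u *\<^sub>R w)"
          using r(2)[of "x + s *\<^sub>R v + u *\<^sub>R w"] small[OF that] tN by (simp add: add.assoc)
        also have "\<dots> \<le> \<epsilon> * (t * N)" using small[OF that] \<epsilon> by simp
        finally show ?thesis .
      qed
      have der: "((\<lambda>s. f (x + s *\<^sub>R v + u *\<^sub>R w)) has_real_derivative G (x + s *\<^sub>R v + u *\<^sub>R w)) (at s)"
        if "0 \<le> s" "s \<le> t" "0 \<le> u" "u \<le> t" for s u
      proof -
        have a: "((\<lambda>s. x + s *\<^sub>R v + u *\<^sub>R w) has_derivative (\<lambda>h. h *\<^sub>R v)) (at s)"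
          by (auto intro!: derivative_eq_intros)
        have b: "(f has_derivative frechet_derivative f (at (x + s *\<^sub>R v + u *\<^sub>R w))) (at (x + s *\<^sub>R v + u *\<^sub>R w))"
          using S(3)[OF inS[OF that]] by (simp add: frechet_derivative_works[symmetric])
        have "((\<lambda>s. f (x + s *\<^sub>R v + u *\<^sub>R w)) has_derivative
          (\<lambda>h. frechet_derivative f (at (x + s *\<^sub>R v + u *\<^sub>R w)) (h *\<^sub>R v))) (at s)"
          using has_derivative_compose[OF a b] .
        moreover have "frechet_derivative f (at (x + s *\<^sub>R v + u *\<^sub>R w)) (h *\<^sub>R v) = G (x + s *\<^sub>R v + u *\<^sub>R w) * h" for h
          using linear_cmul[OF linear_frechet_derivative[OF S(3)[OF inS[OF that]]]]
          by (simp add: G_def)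
        ultimately show ?thesis by (simp add: has_field_derivative_def)
      qed
      \<comment> \<open>The second difference is \<open>\<phi> t - \<phi> 0\<close>. The term
        \<open>0 *\<^sub>R w\<close> is kept so that \<open>der\<close> and \<open>est\<close> apply
        with \<open>u = 0\<close>.\<close>
      define \<phi> where "\<phi> = (\<lambda>s. f (x + s *\<^sub>R v + t *\<^sub>R w) - f (x + s *\<^sub>R v + 0 *\<^sub>R w))"
      have "\<And>s. \<lbrakk>0 \<le> s; s \<le> t\<rbrakk> \<Longrightarrow> (\<phi> has_real_derivative (G (x + s *\<^sub>R v + t *\<^sub>R w) - G (x + s *\<^sub>R v + 0 *\<^sub>R w))) (at s)"
        unfolding \<phi>_def using t by (intro DERIV_diff der) auto
      from MVT2[OF t(1) this] obtain s where s: "0 < s" "s < t"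
        and eq: "\<phi> t - \<phi> 0 = t * (G (x + s *\<^sub>R v + t *\<^sub>R w) - G (x + s *\<^sub>R v + 0 *\<^sub>R w))" by auto
      let ?K = "G (x + s *\<^sub>R v + t *\<^sub>R w) - G (x + s *\<^sub>R v + 0 *\<^sub>R w)"
      have "\<Delta> t = t * ?K" using eq by (simp add: \<Delta>_def \<phi>_def algebra_simps)
      then have "\<Delta> t / t\<^sup>2 - L w = (?K - t * L w) / t"
        using t by (simp add: diff_divide_distrib power2_eq_square del: scaleR_zero_left)
      moreover have "L (s *\<^sub>R v + t *\<^sub>R w) = L (s *\<^sub>R v + 0 *\<^sub>R w) + t * L w"
        using lin by (simp add: bounded_linear.linear linear_add linear_cmul)
      then have "\<bar>?K - t * L w\<bar> \<le> 2 * \<epsilon> * (t * N)"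
        using est[of s t] est[of s 0] s t by auto
      then have "\<bar>?K - t * L w\<bar> / t \<le> 2 * \<epsilon> * N"
        using t by (simp add: field_simps)
      ultimately have "\<bar>\<Delta> t / t\<^sup>2 - L w\<bar> \<le> 2 * \<epsilon> * N"
        using t by (simp only: abs_divide abs_of_pos)
      with \<epsilon>e show ?thesis by (simp add: dist_real_def)
    qed
    then show "\<forall>\<^sub>F t in at_right 0. dist (\<Delta> t / t\<^sup>2) (L w) < e"
      using \<delta> unfolding eventually_at_right_field by auto
  qed
  then show ?thesis unfolding \<Delta>_def L_def G_def .
qed

text \<open>The second difference quotient is symmetric in \<open>v\<close> and \<open>w\<close>, so
  the two mixed derivatives are limits of the same function.\<close>

lemma second_derivative_symmetric_real:
  fixes f :: "'d::real_normed_vector \<Rightarrow> real"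
  assumes "open S" "x \<in> S" "\<And>y. y \<in> S \<Longrightarrow> f differentiable (at y)"
    and "\<And>v. (\<lambda>y. frechet_derivative f (at y) v) differentiable (at x)"
  shows "frechet_derivative (\<lambda>y. frechet_derivative f (at y) v) (at x) w =
    frechet_derivative (\<lambda>y. frechet_derivative f (at y) w) (at x) v"
proof (rule tendsto_unique)
  show "((\<lambda>t. (f (x + t *\<^sub>R v + t *\<^sub>R w) - f (x + t *\<^sub>R v) - f (x + t *\<^sub>R w) + f x) / t\<^sup>2)
    \<longlongrightarrow> frechet_derivative (\<lambda>y. frechet_derivative f (at y) v) (at x) w) (at_right 0)"
    using assms by (rule second_difference_limit)
  have "((\<lambda>t. (f (x + t *\<^sub>R w + t *\<^sub>R v) - f (x + t *\<^sub>R w) - f (x + t *\<^sub>R v) + f x) / t\<^sup>2)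
    \<longlongrightarrow> frechet_derivative (\<lambda>y. frechet_derivative f (at y) w) (at x) v) (at_right 0)"
    using assms by (rule second_difference_limit)
  then show "((\<lambda>t. (f (x + t *\<^sub>R v + t *\<^sub>R w) - f (x + t *\<^sub>R v) - f (x + t *\<^sub>R w) + f x) / t\<^sup>2)
    \<longlongrightarrow> frechet_derivative (\<lambda>y. frechet_derivative f (at y) w) (at x) v) (at_right 0)"
    by (simp add: algebra_simps)
qed simp

lemma second_derivative_symmetric:
  fixes f :: "'d::real_normed_vector \<Rightarrow> 'e::real_inner"
  assumes S: "open S" "x \<in> S" "Ck_on 2 S f"
  shows "frechet_derivative (\<lambda>y. frechet_derivative f (at y) v \<bullet> b) (at x) w =
    frechet_derivative (\<lambda>y. frechet_derivative f (at y) w \<bullet> b) (at x) v"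
proof -
  let ?f = "\<lambda>x. f x \<bullet> b"
  have "Ck_on 2 S ?f"
    by (rule Ck_on_bounded_linear[OF bounded_linear_inner_left S(1,3)])
  then have C: "\<And>y. y \<in> S \<Longrightarrow> ?f differentiable (at y)"
    "\<And>y v. y \<in> S \<Longrightarrow> (\<lambda>y. frechet_derivative ?f (at y) v) differentiable (at y)"
    by (auto simp: numeral_2_eq_2)
  have d: "(?f has_derivative (\<lambda>v. frechet_derivative f (at y) v \<bullet> b)) (at y)" if "y \<in> S" for y
    using that S(3) by (intro bounded_linear.has_derivative[OF bounded_linear_inner_left]
      has_frechet_derivative_at) (auto simp: numeral_2_eq_2)
  have "frechet_derivative ?f (at y) v = frechet_derivative f (at y) v \<bullet> b" if "y \<in> S" for y v
    by (simp add: frechet_derivative_at[OF d[OF that], symmetric])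
  then have "frechet_derivative (\<lambda>y. frechet_derivative ?f (at y) v) (at x) = 
    frechet_derivative (\<lambda>y. frechet_derivative f (at y) v \<bullet> b) (at x)" for v
    using S by (intro frechet_derivative_cong_open[of S]) auto
  then show ?thesis
    using second_derivative_symmetric_real[OF S(1,2) C(1) C(2)[OF S(2)], of v w] by simp
qed

section \<open>Pullback of forms and primitives\<close>

text \<open>The part of \<open>smooth_manifold\<close> that lifts chart by chart through a local
  homeomorphism, so that base manifolds and total spaces of coverings can be treated alike.\<close>

definition smooth_structure :: "('a, 'e::real_inner) manifold \<Rightarrow> bool" where
  "smooth_structure M \<longleftrightarrow> (\<exists>B::'e set. finite B \<and> span B = UNIV) \<and> smooth_atlas (mtop M) (atlas M)"

lemma smooth_manifold_imp_smooth_structure: "smooth_manifold M \<Longrightarrow> smooth_structure M"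
  by (simp add: smooth_manifold_def smooth_structure_def)

lemma smooth_on_cong:
  "open S \<Longrightarrow> (\<And>x. x \<in> S \<Longrightarrow> f x = g x) \<Longrightarrow> smooth_on S f \<Longrightarrow> smooth_on S g"
  unfolding smooth_on_def by (intro allI, rule Ck_on_cong[of S f g]) auto

lemma smooth_on_subset: "smooth_on S f \<Longrightarrow> T \<subseteq> S \<Longrightarrow> smooth_on T f"
  unfolding smooth_on_def by (metis Ck_on_subset)

lemma smooth_on_local:
  assumes "\<And>x. x \<in> S \<Longrightarrow> \<exists>T. open T \<and> x \<in> T \<and> T \<subseteq> S \<and> smooth_on T f"
  shows "smooth_on S f"
  unfolding smooth_on_def
proof
  show "Ck_on k S f" for k
    by (rule Ck_on_local) (meson assms smooth_on_def)
qed

lemma smooth_on_differentiable: "smooth_on S f \<Longrightarrow> x \<in> S \<Longrightarrow> f differentiable (at x)"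
  unfolding smooth_on_def by (metis Ck_on.simps(2))

lemma smooth_on_frechet_derivative:
  "smooth_on S f \<Longrightarrow> smooth_on S (\<lambda>x. frechet_derivative f (at x) v)"
  unfolding smooth_on_def by (metis Ck_on.simps(2))

lemma smooth_on_compose:
  fixes f :: "'d::real_normed_vector \<Rightarrow> 'e::real_inner"
  assumes "frame (B::'e set)" "open S" "open T" "f ` S \<subseteq> T" "smooth_on S f" "smooth_on T g"
  shows "smooth_on S (g \<circ> f)"
  using assms(5,6) unfolding smooth_on_def
  by (intro allI Ck_on_compose[OF assms(1-4)]) blast+

lemma smooth_on_const: "smooth_on S (\<lambda>x. c)"
  by (simp add: smooth_on_def Ck_on_const)

lemma smooth_on_add: "open S \<Longrightarrow> smooth_on S f \<Longrightarrow> smooth_on S g \<Longrightarrow> smooth_on S (\<lambda>x. f x + g x)"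
  by (simp add: smooth_on_def Ck_on_add)

lemma smooth_on_minus:
  assumes "open S" "smooth_on S f" shows "smooth_on S (\<lambda>x. - f x)"
  using assms unfolding smooth_on_def
  by (intro allI Ck_on_bounded_linear[OF bounded_linear_minus[OF bounded_linear_ident]]) auto

section \<open>Charts and coordinate representatives\<close>

context
  fixes M :: "('a, 'e::real_inner) manifold"
  assumes M: "smooth_structure M"
begin

lemma chart_openin: "c \<in> atlas M \<Longrightarrow> openin (mtop M) (fst c)"
  and chart_open_image: "c \<in> atlas M \<Longrightarrow> open (snd c ` fst c)"
  and chart_homeo: "c \<in> atlas M \<Longrightarrow>
    homeomorphic_map (subtopology (mtop M) (fst c)) (top_of_set (snd c ` fst c)) (snd c)"
  using M unfolding smooth_structure_def smooth_atlas_def by blast+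

lemma chart_subset: "c \<in> atlas M \<Longrightarrow> fst c \<subseteq> topspace (mtop M)"
  by (simp add: chart_openin openin_subset)

lemma chart_at:
  assumes "x \<in> topspace (mtop M)" obtains c where "c \<in> atlas M" "x \<in> fst c"
  using M assms unfolding smooth_structure_def smooth_atlas_def by blast

lemma chart_inj: "c \<in> atlas M \<Longrightarrow> inj_on (snd c) (fst c)"
  using homeomorphic_imp_injective_map[OF chart_homeo] chart_subset
  by (simp add: topspace_subtopology Int_absorb1)

lemma chart_inv_chart: "c \<in> atlas M \<Longrightarrow> x \<in> fst c \<Longrightarrow> chart_inv c (snd c x) = x"
  by (simp add: chart_inv_def chart_inj)

lemma open_chart_image:
  assumes c: "c \<in> atlas M" and W: "openin (mtop M) W" and "W \<subseteq> fst c"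
  shows "open (snd c ` W)"
proof -
  have "openin (subtopology (mtop M) (fst c)) W"
    using W assms(3) by (metis openin_subtopology_Int2 Int_absorb1)
  then have "openin (top_of_set (snd c ` fst c)) (snd c ` W)"
    using homeomorphic_imp_open_map[OF chart_homeo[OF c]] by (simp add: open_map_def)
  then show ?thesis
    using chart_open_image[OF c] openin_open_trans by blast
qed

lemma transition_smooth:
  "c \<in> atlas M \<Longrightarrow> d \<in> atlas M \<Longrightarrow> smooth_on (snd c ` (fst c \<inter> fst d)) (snd d \<circ> chart_inv c)"
  using M unfolding smooth_structure_def smooth_atlas_def by blast

lemma frame_of_model: obtains B :: "'e set" where "frame B"
  using M frame_exists unfolding smooth_structure_def by metis

text \<open>It makes a change of charts a special case of a coordinate representative, so that
  transformation laws follow from the chain rule with one of the two maps equal to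
  \<open>id\<close>.\<close>

lemma smooth_map_id: "smooth_map M M id"
proof -
  have "id -` fst d = fst d" for d :: "('a,'e) chart" by auto
  then show ?thesis
    unfolding smooth_map_def using transition_smooth by (simp add: comp_def)
qed

end

lemma smooth_map_rep:
  assumes "smooth_structure M" "smooth_map M N F" "c \<in> atlas M" "d \<in> atlas N"
    and N: "smooth_structure N"
  shows "open (snd c ` (fst c \<inter> F -` fst d))"
    and "smooth_on (snd c ` (fst c \<inter> F -` fst d)) (snd d \<circ> F \<circ> chart_inv c)"
proof -
  have "openin (mtop M) {x \<in> topspace (mtop M). F x \<in> fst d}"
    using assms(2) chart_openin[OF N assms(4)] unfolding smooth_map_def
    by (auto intro: openin_continuous_map_preimage)
  then have "openin (mtop M) (fst c \<inter> {x \<in> topspace (mtop M). F x \<in> fst d})"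
    using chart_openin[OF assms(1,3)] by blast
  moreover have "fst c \<inter> {x \<in> topspace (mtop M). F x \<in> fst d} = fst c \<inter> F -` fst d"
    using chart_subset[OF assms(1,3)] by auto
  ultimately have "openin (mtop M) (fst c \<inter> F -` fst d)" by simp
  then show "open (snd c ` (fst c \<inter> F -` fst d))"
    using open_chart_image[OF assms(1,3)] by blast
  show "smooth_on (snd c ` (fst c \<inter> F -` fst d)) (snd d \<circ> F \<circ> chart_inv c)"
    using assms unfolding smooth_map_def by blast
qed

lemma smooth_map_in_topspace:
  "smooth_structure M \<Longrightarrow> smooth_map M N F \<Longrightarrow> c \<in> atlas M \<Longrightarrow> x \<in> fst c \<Longrightarrow> F x \<in> topspace (mtop N)"
  using chart_subset[of M c] unfolding smooth_map_def continuous_map_def by blast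

text \<open>Near \<open>snd c x\<close> the representative of \<open>G \<circ> F\<close> factors
  through the chart \<open>d\<close>, because \<open>chart_inv d\<close> undoes \<open>snd d\<close>
  on \<open>fst d\<close>. Chart independence and functoriality of pullbacks are both read off from
  this factorisation.\<close>

lemma chart_rep_chain:
  assumes M: "smooth_structure M" and N: "smooth_structure N" and L: "smooth_structure L"
    and F: "smooth_map M N F" and G: "smooth_map N L G"
    and c: "c \<in> atlas M" "x \<in> fst c" and d: "d \<in> atlas N" "F x \<in> fst d"
    and e: "e \<in> atlas L" "G (F x) \<in> fst e"
  shows "frechet_derivative (snd e \<circ> (G \<circ> F) \<circ> chart_inv c) (at (snd c x)) v =
    frechet_derivative (snd e \<circ> G \<circ> chart_inv d) (at (snd d (F x)))
      (frechet_derivative (snd d \<circ> F \<circ> chart_inv c) (at (snd c x)) v)"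
proof -
  let ?S = "snd c ` (fst c \<inter> F -` fst d)"
  have xS: "snd c x \<in> ?S" using c d by auto
  have "frechet_derivative (snd e \<circ> (G \<circ> F) \<circ> chart_inv c) (at (snd c x)) =
    frechet_derivative ((snd e \<circ> G \<circ> chart_inv d) \<circ> (snd d \<circ> F \<circ> chart_inv c)) (at (snd c x))"
    by (rule frechet_derivative_cong_open[OF smooth_map_rep(1)[OF M F c(1) d(1) N] xS])
      (auto simp: chart_inv_chart[OF M c(1)] chart_inv_chart[OF N d(1)])
  moreover have "(snd d \<circ> F \<circ> chart_inv c) differentiable (at (snd c x))"
    using smooth_map_rep(2)[OF M F c(1) d(1) N] xS by (rule smooth_on_differentiable)
  moreover have "(snd e \<circ> G \<circ> chart_inv d) differentiable (at ((snd d \<circ> F \<circ> chart_inv c) (snd c x)))"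
    using smooth_map_rep(2)[OF N G d(1) e(1) L] d e
    by (auto intro!: smooth_on_differentiable simp: chart_inv_chart[OF M c])
  ultimately show ?thesis
    using frechet_derivative_comp_at[of "snd d \<circ> F \<circ> chart_inv c" "snd c x" "snd e \<circ> G \<circ> chart_inv d" v]
    by (simp add: chart_inv_chart[OF M c])
qed

section \<open>Pullback of closed 1-forms\<close>

text \<open>The chart picked by \<open>SOME\<close> is traded for \<open>d\<close> by the
  transformation law of \<open>\<omega>\<close>; the resulting change of charts is absorbed by the
  chain rule for \<open>id \<circ> F\<close>.\<close>

lemma pullback_form_eq:
  assumes M: "smooth_structure M" and N: "smooth_structure N" and F: "smooth_map M N F"
    and \<omega>: "one_form N \<omega>"
    and c: "c \<in> atlas M" "x \<in> fst c" and d: "d \<in> atlas N" "F x \<in> fst d"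
  shows "pullback_form N F \<omega> c x v =
    \<omega> d (F x) (frechet_derivative (snd d \<circ> F \<circ> chart_inv c) (at (snd c x)) v)"
proof -
  define d0 where "d0 = (SOME d. d \<in> atlas N \<and> F x \<in> fst d)"
  have d0: "d0 \<in> atlas N" "F x \<in> fst d0"
    using someI[of "\<lambda>d. d \<in> atlas N \<and> F x \<in> fst d", OF conjI[OF d]] by (auto simp: d0_def)
  let ?w = "frechet_derivative (snd d0 \<circ> F \<circ> chart_inv c) (at (snd c x)) v"
  have "pullback_form N F \<omega> c x v = \<omega> d0 (F x) ?w"
    by (simp add: pullback_form_def d0_def[symmetric] Let_def)
  also have "\<dots> = \<omega> d (F x) (frechet_derivative (snd d \<circ> chart_inv d0) (at (snd d0 (F x))) ?w)"
    using \<omega> d d0 unfolding one_form_def by blast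
  also have "frechet_derivative (snd d \<circ> chart_inv d0) (at (snd d0 (F x))) ?w =
    frechet_derivative (snd d \<circ> F \<circ> chart_inv c) (at (snd c x)) v"
    using chart_rep_chain[OF M N N F smooth_map_id[OF N] c d0 d(1), of v] d by simp
  finally show ?thesis .
qed

lemma one_form_linear: "one_form N \<omega> \<Longrightarrow> d \<in> atlas N \<Longrightarrow> y \<in> fst d \<Longrightarrow> linear (\<omega> d y)"
  and one_form_smooth: "one_form N \<omega> \<Longrightarrow> d \<in> atlas N \<Longrightarrow>
    smooth_on (snd d ` fst d) (\<lambda>y. \<omega> d (chart_inv d y) v)"
  unfolding one_form_def by blast+

text \<open>Only the coefficients of \<open>\<omega>\<close> in fixed directions are known to be
  smooth. The frame expresses the coefficient of the pullback through these, composed with the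
  representative of \<open>F\<close>.\<close>

lemma pullback_form_coord:
  fixes N :: "('b, 'e::real_inner) manifold"
  assumes M: "smooth_structure M" and N: "smooth_structure N" and F: "smooth_map M N F"
    and \<omega>: "one_form N \<omega>" and B: "frame (B :: 'e set)"
    and c: "c \<in> atlas M" and d: "d \<in> atlas N" and z: "z \<in> snd c ` (fst c \<inter> F -` fst d)"
  shows "pullback_form N F \<omega> c (chart_inv c z) v =
    (\<Sum>b\<in>B. (frechet_derivative (snd d \<circ> F \<circ> chart_inv c) (at z) v \<bullet> b) *\<^sub>R
      ((\<lambda>y. \<omega> d (chart_inv d y) b) \<circ> (snd d \<circ> F \<circ> chart_inv c)) z)"
proof -
  obtain x where x: "z = snd c x" "x \<in> fst c" "F x \<in> fst d" using z by auto
  show ?thesis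
    unfolding x(1) chart_inv_chart[OF M c x(2)] pullback_form_eq[OF M N F \<omega> c x(2) d x(3)] comp_apply
      chart_inv_chart[OF N d x(3)]
    by (rule frame_linear[OF B one_form_linear[OF \<omega> d x(3)]])
qed

lemma pullback_coord_smooth:
  fixes N :: "('b, 'e::real_inner) manifold"
  assumes M: "smooth_structure M" and N: "smooth_structure N" and F: "smooth_map M N F"
    and B: "frame (B :: 'e set)"
    and c: "c \<in> atlas M" and d: "d \<in> atlas N" and g: "smooth_on (snd d ` fst d) g"
  shows "smooth_on (snd c ` (fst c \<inter> F -` fst d)) (g \<circ> (snd d \<circ> F \<circ> chart_inv c))"
  using smooth_map_rep[OF M F c d N] chart_open_image[OF N d] g
  by (intro smooth_on_compose[OF B, where T = "snd d ` fst d"]) (auto simp: chart_inv_chart[OF M c])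

lemma chart_target_cover:
  assumes M: "smooth_structure M" and N: "smooth_structure N" and F: "smooth_map M N F"
    and c: "c \<in> atlas M" and y: "y \<in> snd c ` fst c"
  obtains d where "d \<in> atlas N" "y \<in> snd c ` (fst c \<inter> F -` fst d)"
proof -
  obtain x where x: "y = snd c x" "x \<in> fst c" using y by auto
  obtain d where "d \<in> atlas N" "F x \<in> fst d"
    using chart_at[OF N smooth_map_in_topspace[OF M F c x(2)]] .
  with x that show ?thesis by blast
qed

text \<open>Every condition is checked where the image lies in a single target chart. There the
  coefficients are the explicit sums of \<open>pullback_form_coord\<close>, and the transformation
  law is the chain rule for \<open>F \<circ> id\<close>.\<close>

lemma one_form_pullback:
  fixes M :: "('a, 'd::real_inner) manifold" and N :: "('b, 'e::real_inner) manifold"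
  assumes M: "smooth_structure M" and N: "smooth_structure N" and F: "smooth_map M N F"
    and \<omega>: "one_form N \<omega>"
  shows "one_form M (pullback_form N F \<omega> :: ('a, 'd) form1)"
proof -
  obtain B :: "'e set" where B: "frame B" using frame_of_model[OF N] .
  have "linear (pullback_form N F \<omega> c x :: 'd \<Rightarrow> real)" if c: "c \<in> atlas M" "x \<in> fst c" for c x
  proof -
    obtain d where d: "d \<in> atlas N" "F x \<in> fst d"
      using chart_at[OF N smooth_map_in_topspace[OF M F c]] .
    have "linear (frechet_derivative (snd d \<circ> F \<circ> chart_inv c) (at (snd c x)))"
      using smooth_map_rep(2)[OF M F c(1) d(1) N] c d
      by (intro linear_frechet_derivative) (auto intro!: smooth_on_differentiable)
    then have "linear (\<omega> d (F x) \<circ> frechet_derivative (snd d \<circ> F \<circ> chart_inv c) (at (snd c x)))"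
      using one_form_linear[OF \<omega> d] by (rule linear_compose)
    moreover have "pullback_form N F \<omega> c x = \<omega> d (F x) \<circ> frechet_derivative (snd d \<circ> F \<circ> chart_inv c) (at (snd c x))"
      using pullback_form_eq[OF M N F \<omega> c d] by (simp add: fun_eq_iff)
    ultimately show ?thesis by simp
  qed
  moreover have "smooth_on (snd c ` fst c) (\<lambda>y. pullback_form N F \<omega> c (chart_inv c y) v)"
    if c: "c \<in> atlas M" for c :: "('a, 'd) chart" and v
  proof (rule smooth_on_local)
    fix y assume "y \<in> snd c ` fst c"
    then obtain d where d: "d \<in> atlas N" and y: "y \<in> snd c ` (fst c \<inter> F -` fst d)"
      using chart_target_cover[OF M N F c] by blast
    let ?S = "snd c ` (fst c \<inter> F -` fst d)" and ?\<Phi> = "snd d \<circ> F \<circ> chart_inv c"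
    have oS: "open ?S" and sS: "smooth_on ?S ?\<Phi>" using smooth_map_rep[OF M F c d N] .
    have "smooth_on ?S (\<lambda>z. \<Sum>b\<in>B. (frechet_derivative ?\<Phi> (at z) v \<bullet> b) *\<^sub>R
      ((\<lambda>y. \<omega> d (chart_inv d y) b) \<circ> ?\<Phi>) z)"
      unfolding smooth_on_def
    proof (intro allI Ck_on_sum Ck_on_scaleR oS)
      fix k b
      show "Ck_on k ?S (\<lambda>z. frechet_derivative ?\<Phi> (at z) v \<bullet> b)"
        using smooth_on_frechet_derivative[OF sS, of v] unfolding smooth_on_def
        by (intro Ck_on_bounded_linear[OF bounded_linear_inner_left oS]) auto
      show "Ck_on k ?S ((\<lambda>y. \<omega> d (chart_inv d y) b) \<circ> ?\<Phi>)"
        using pullback_coord_smooth[OF M N F B c d one_form_smooth[OF \<omega> d]]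
        unfolding smooth_on_def by blast
    qed
    then have "smooth_on ?S (\<lambda>y. pullback_form N F \<omega> c (chart_inv c y) v)"
      by (rule smooth_on_cong[OF oS, rotated]) (rule pullback_form_coord[OF M N F \<omega> B c d, symmetric])
    then show "\<exists>T. open T \<and> y \<in> T \<and> T \<subseteq> snd c ` fst c \<and>
      smooth_on T (\<lambda>y. pullback_form N F \<omega> c (chart_inv c y) v)"
      using oS y by blast
  qed
  moreover have "pullback_form N F \<omega> c x v =
      pullback_form N F \<omega> c' x (frechet_derivative (snd c' \<circ> chart_inv c) (at (snd c x)) v)"
    if c: "c \<in> atlas M" "x \<in> fst c" and c': "c' \<in> atlas M" "x \<in> fst c'" for c c' x v
  proof -
    obtain d where d: "d \<in> atlas N" "F x \<in> fst d"
      using chart_at[OF N smooth_map_in_topspace[OF M F c]] .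
    show ?thesis
      using chart_rep_chain[OF M M N smooth_map_id[OF M] F c c'(1) _ d(1), of v] c' d
      by (simp add: pullback_form_eq[OF M N F \<omega> c d] pullback_form_eq[OF M N F \<omega> c' d])
  qed
  ultimately show ?thesis
    unfolding one_form_def by blast
qed

text \<open>Both sides are the value at \<open>X\<close> and \<open>Y\<close> of the bilinear form
  with entries \<open>A b b'\<close>. Closedness of a form supplies the symmetry of these entries
  when \<open>A b\<close> is the derivative of its coefficient along \<open>b\<close>.\<close>

lemma frame_bilinear_swap:
  assumes "frame B" "\<And>b. linear (A b)" "\<And>b b'. A b b' = A b' b"
  shows "(\<Sum>b\<in>B. (Y \<bullet> b) * (A b X :: real)) = (\<Sum>b\<in>B. (X \<bullet> b) * A b Y)"
proof -
  have "(\<Sum>b\<in>B. (Y \<bullet> b) * A b X) = (\<Sum>b\<in>B. \<Sum>b'\<in>B. (Y \<bullet> b) * ((X \<bullet> b') * A b b'))"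
    by (subst frame_linear[OF assms(1,2)]) (simp add: sum_distrib_left)
  also have "\<dots> = (\<Sum>b'\<in>B. \<Sum>b\<in>B. (Y \<bullet> b) * ((X \<bullet> b') * A b b'))"
    by (rule sum.swap)
  also have "\<dots> = (\<Sum>b'\<in>B. \<Sum>b\<in>B. (X \<bullet> b') * ((Y \<bullet> b) * A b' b))"
    by (intro sum.cong refl) (simp add: assms(3)[of _ ] mult.left_commute)
  also have "\<dots> = (\<Sum>b\<in>B. (X \<bullet> b) * A b Y)"
    by (subst (2) frame_linear[OF assms(1,2)]) (simp add: sum_distrib_left)
  finally show ?thesis .
qed

text \<open>In coordinates \<open>d(\<Phi>\<^sup>*\<omega>) = \<Phi>\<^sup>*d\<omega>\<close>: the terms with second derivatives of \<open>\<Phi>\<close> cancel by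
  symmetry, the others are swapped by closedness of \<open>\<omega>\<close>.\<close>

lemma closed_form_pullback:
  fixes M :: "('a, 'd::real_inner) manifold" and N :: "('b, 'e::real_inner) manifold"
  assumes M: "smooth_structure M" and N: "smooth_structure N" and F: "smooth_map M N F"
    and \<omega>c: "closed_form N \<omega>"
  shows "closed_form M (pullback_form N F \<omega> :: ('a, 'd) form1)"
proof -
  obtain B :: "'e set" where B: "frame B" using frame_of_model[OF N] .
  have \<omega>: "one_form N \<omega>" using \<omega>c by (simp add: closed_form_def)
  have "frechet_derivative (\<lambda>z. pullback_form N F \<omega> c (chart_inv c z) w) (at y) v =
        frechet_derivative (\<lambda>z. pullback_form N F \<omega> c (chart_inv c z) v) (at y) w"
    if c: "c \<in> atlas M" and y: "y \<in> snd c ` fst c" for c y v w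
  proof -
    obtain d where d: "d \<in> atlas N" and y: "y \<in> snd c ` (fst c \<inter> F -` fst d)"
      using chart_target_cover[OF M N F c y] by blast
    define S \<Phi> where "S = snd c ` (fst c \<inter> F -` fst d)" and "\<Phi> = snd d \<circ> F \<circ> chart_inv c"
    define a where "a = (\<lambda>b z. \<omega> d (chart_inv d z) b)"
    let ?D = "\<lambda>v. frechet_derivative \<Phi> (at y) v"
    have oS: "open S" and sS: "smooth_on S \<Phi>" and yS: "y \<in> S"
      using smooth_map_rep[OF M F c d N] y by (auto simp: S_def \<Phi>_def)
    have \<Phi>y: "\<Phi> y \<in> snd d ` fst d"
      using y by (auto simp: \<Phi>_def chart_inv_chart[OF M c])
    have da: "a b differentiable (at (\<Phi> y))" for b
      unfolding a_def using smooth_on_differentiable[OF one_form_smooth[OF \<omega> d] \<Phi>y] .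
    have d\<Phi>: "\<Phi> differentiable (at y)" using smooth_on_differentiable[OF sS yS] .
    \<comment> \<open>Product rule: the first sum differentiates the coefficients of
      \<open>\<omega>\<close>, the second the derivative of \<open>\<Phi>\<close>. Each of the two
      sums is symmetric in \<open>v\<close> and \<open>w\<close> by itself.\<close>
    have der: "frechet_derivative (\<lambda>z. pullback_form N F \<omega> c (chart_inv c z) w) (at y) v =
      (\<Sum>b\<in>B. (?D w \<bullet> b) * frechet_derivative (a b) (at (\<Phi> y)) (?D v)) +
      (\<Sum>b\<in>B. frechet_derivative (\<lambda>z. frechet_derivative \<Phi> (at z) w \<bullet> b) (at y) v * a b (\<Phi> y))" for v w
    proof -
      have 1: "frechet_derivative (\<lambda>z. pullback_form N F \<omega> c (chart_inv c z) w) (at y) =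
        frechet_derivative (\<lambda>z. \<Sum>b\<in>B. (frechet_derivative \<Phi> (at z) w \<bullet> b) *\<^sub>R (a b \<circ> \<Phi>) z) (at y)"
        by (rule frechet_derivative_cong_open[OF oS yS])
          (unfold a_def \<Phi>_def S_def, rule pullback_form_coord[OF M N F \<omega> B c d])
      have 2: "((\<lambda>z. frechet_derivative \<Phi> (at z) w \<bullet> b) has_derivative
        frechet_derivative (\<lambda>z. frechet_derivative \<Phi> (at z) w \<bullet> b) (at y)) (at y)" for b
      proof (rule has_frechet_derivative_at)
        have "(\<lambda>z. frechet_derivative \<Phi> (at z) w) differentiable (at y)"
          using smooth_on_frechet_derivative[OF sS] yS by (rule smooth_on_differentiable)
        then show "(\<lambda>z. frechet_derivative \<Phi> (at z) w \<bullet> b) differentiable (at y)"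
          unfolding differentiable_def
          using bounded_linear.has_derivative[OF bounded_linear_inner_left] by blast
      qed
      have 3: "((a b \<circ> \<Phi>) has_derivative (\<lambda>v. frechet_derivative (a b) (at (\<Phi> y)) (?D v))) (at y)" for b
        using diff_chain_at[OF has_frechet_derivative_at[OF d\<Phi>] has_frechet_derivative_at[OF da]]
        by (simp add: comp_def)
      have 4: "((\<lambda>z. \<Sum>b\<in>B. (frechet_derivative \<Phi> (at z) w \<bullet> b) *\<^sub>R (a b \<circ> \<Phi>) z) has_derivative
        (\<lambda>v. \<Sum>b\<in>B. (?D w \<bullet> b) *\<^sub>R frechet_derivative (a b) (at (\<Phi> y)) (?D v) +
          frechet_derivative (\<lambda>z. frechet_derivative \<Phi> (at z) w \<bullet> b) (at y) v *\<^sub>R (a b \<circ> \<Phi>) y)) (at y)"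
        by (intro has_derivative_sum has_derivative_scaleR 2 3)
      show ?thesis
        unfolding 1 frechet_derivative_at[OF 4, symmetric] by (simp add: sum.distrib)
    qed
    have "frechet_derivative (\<lambda>z. frechet_derivative \<Phi> (at z) w \<bullet> b) (at y) v =
      frechet_derivative (\<lambda>z. frechet_derivative \<Phi> (at z) v \<bullet> b) (at y) w" for b
      using sS by (intro second_derivative_symmetric[OF oS yS]) (simp add: smooth_on_def)
    moreover have "(\<Sum>b\<in>B. (?D w \<bullet> b) * frechet_derivative (a b) (at (\<Phi> y)) (?D v)) =
      (\<Sum>b\<in>B. (?D v \<bullet> b) * frechet_derivative (a b) (at (\<Phi> y)) (?D w))"
    proof (rule frame_bilinear_swap[OF B])
      show "linear (frechet_derivative (a b) (at (\<Phi> y)))" for b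
        using da by (rule linear_frechet_derivative)
      show "frechet_derivative (a b) (at (\<Phi> y)) b' = frechet_derivative (a b') (at (\<Phi> y)) b" for b b'
        using \<omega>c d \<Phi>y unfolding closed_form_def a_def by blast
    qed
    ultimately show ?thesis unfolding der by simp
  qed
  then show ?thesis
    using one_form_pullback[OF M N F \<omega>] unfolding closed_form_def by blast
qed

section \<open>Naturality and linearity of primitives\<close>

text \<open>The identity \<open>d(f \<circ> F) = F\<^sup>*df\<close>, read in charts: the
  representative of \<open>f \<circ> F\<close> factors through a target chart, and the ordinary
  chain rule applies.\<close>

lemma primitive_pullback:
  fixes M :: "('a, 'd::real_inner) manifold" and N :: "('b, 'e::real_inner) manifold"
  assumes M: "smooth_structure M" and N: "smooth_structure N" and F: "smooth_map M N F"
    and \<omega>: "one_form N \<omega>" and f: "primitive N \<omega> f"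
  shows "primitive M (pullback_form N F \<omega> :: ('a, 'd) form1) (f \<circ> F)"
  unfolding primitive_def smooth_fun_def
proof (intro conjI ballI allI)
  obtain B :: "'e set" where B: "frame B" using frame_of_model[OF N] .
  have f': "smooth_on (snd d ` fst d) (f \<circ> chart_inv d)" if "d \<in> atlas N" for d
    using f that by (auto simp: primitive_def smooth_fun_def)
  have eq: "((f \<circ> chart_inv d) \<circ> (snd d \<circ> F \<circ> chart_inv c)) z = ((f \<circ> F) \<circ> chart_inv c) z"
    if "d \<in> atlas N" "c \<in> atlas M" "z \<in> snd c ` (fst c \<inter> F -` fst d)" for c d z
    using that by (auto simp: chart_inv_chart[OF M that(2)] chart_inv_chart[OF N that(1)])
  show "smooth_on (snd c ` fst c) (f \<circ> F \<circ> chart_inv c)" if c: "c \<in> atlas M" for c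
  proof (rule smooth_on_local)
    fix y assume "y \<in> snd c ` fst c"
    then obtain d where d: "d \<in> atlas N" and y: "y \<in> snd c ` (fst c \<inter> F -` fst d)"
      using chart_target_cover[OF M N F c] by blast
    let ?S = "snd c ` (fst c \<inter> F -` fst d)"
    have oS: "open ?S" using smooth_map_rep[OF M F c d N] by blast
    have "smooth_on ?S ((f \<circ> F) \<circ> chart_inv c)"
      using pullback_coord_smooth[OF M N F B c d f'[OF d]] eq[OF d c] smooth_on_cong[OF oS] by blast
    then show "\<exists>T. open T \<and> y \<in> T \<and> T \<subseteq> snd c ` fst c \<and> smooth_on T (f \<circ> F \<circ> chart_inv c)"
      using oS y by blast
  qed
  show "differential (f \<circ> F) c x v = pullback_form N F \<omega> c x v" if c: "c \<in> atlas M" "x \<in> fst c" for c x v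
  proof -
    obtain d where d: "d \<in> atlas N" "F x \<in> fst d"
      using chart_at[OF N smooth_map_in_topspace[OF M F c]] .
    let ?S = "snd c ` (fst c \<inter> F -` fst d)" and ?\<Phi> = "snd d \<circ> F \<circ> chart_inv c"
    have oS: "open ?S" and xS: "snd c x \<in> ?S" using smooth_map_rep[OF M F c(1) d(1) N] c d by auto
    have "frechet_derivative (f \<circ> F \<circ> chart_inv c) (at (snd c x)) =
      frechet_derivative ((f \<circ> chart_inv d) \<circ> ?\<Phi>) (at (snd c x))"
      using eq[OF d(1) c(1)] by (intro frechet_derivative_cong_open[OF oS xS]) auto
    moreover have "?\<Phi> differentiable (at (snd c x))"
      using smooth_map_rep(2)[OF M F c(1) d(1) N] xS by (rule smooth_on_differentiable)
    moreover have \<Phi>x: "?\<Phi> (snd c x) = snd d (F x)"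
      by (simp add: chart_inv_chart[OF M c])
    moreover have "(f \<circ> chart_inv d) differentiable (at (snd d (F x)))"
      using f'[OF d(1)] d by (auto intro: smooth_on_differentiable)
    ultimately have "frechet_derivative (f \<circ> F \<circ> chart_inv c) (at (snd c x)) v =
      differential f d (F x) (frechet_derivative ?\<Phi> (at (snd c x)) v)"
      using frechet_derivative_comp_at[of ?\<Phi> "snd c x" "f \<circ> chart_inv d" v]
      by (simp add: differential_def)
    then show ?thesis
      using f d by (simp add: pullback_form_eq[OF M N F \<omega> c d] differential_def primitive_def)
  qed
qed

lemma pullback_form_compose:
  assumes M: "smooth_structure M" and N: "smooth_structure N" and L: "smooth_structure L"
    and F: "smooth_map M N F" and G: "smooth_map N L G" and \<omega>: "one_form L \<omega>"
    and c: "c \<in> atlas M" "x \<in> fst c"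
  shows "pullback_form N F (pullback_form L G \<omega>) c x v = pullback_form L (G \<circ> F) \<omega> c x v"
proof -
  obtain d where d: "d \<in> atlas N" "F x \<in> fst d"
    using chart_at[OF N smooth_map_in_topspace[OF M F c]] .
  \<comment> \<open>This is the very chart that \<open>pullback_form\<close> picks for
    \<open>G \<circ> F\<close> at \<open>x\<close>, so the right-hand side unfolds to it by
    definition.\<close>
  define e where "e = (SOME e. e \<in> atlas L \<and> G (F x) \<in> fst e)"
  obtain e' where e': "e' \<in> atlas L" "G (F x) \<in> fst e'"
    using chart_at[OF L smooth_map_in_topspace[OF N G d]] .
  have e: "e \<in> atlas L" "G (F x) \<in> fst e"
    using someI[of "\<lambda>e. e \<in> atlas L \<and> G (F x) \<in> fst e", OF conjI[OF e']] by (auto simp: e_def)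
  show ?thesis
    unfolding pullback_form_eq[OF M N F one_form_pullback[OF N L G \<omega>] c d]
      pullback_form_eq[OF N L G \<omega> d e] chart_rep_chain[OF M N L F G c d e, symmetric]
    by (simp add: pullback_form_def[of L "G \<circ> F"] e_def Let_def)
qed

text \<open>Maps of spaces are total functions pinned down only on \<open>topspace\<close>. The
  derivative ignores the remaining values because chart images are open.\<close>

lemma pullback_form_cong:
  fixes M :: "('a, 'd::real_inner) manifold" and N :: "('b, 'e::real_inner) manifold"
  assumes M: "smooth_structure M" and FG: "\<And>x. x \<in> topspace (mtop M) \<Longrightarrow> F x = G x"
    and c: "c \<in> atlas M" "x \<in> fst c"
  shows "pullback_form N F \<omega> c x v = pullback_form N G \<omega> c x v"
proof -
  have "F x = G x" using chart_subset[OF M c(1)] c FG by blast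
  moreover have "frechet_derivative (snd d \<circ> F \<circ> chart_inv c) (at (snd c x)) =
    frechet_derivative (snd d \<circ> G \<circ> chart_inv c) (at (snd c x))" for d :: "('b, 'e) chart"
    using chart_subset[OF M c(1)] c
    by (intro frechet_derivative_cong_open[OF chart_open_image[OF M c(1)]])
      (auto simp: chart_inv_chart[OF M c(1)] FG subset_iff)
  ultimately show ?thesis by (simp add: pullback_form_def Let_def)
qed

lemma primitive_cong:
  assumes "\<And>c x v. c \<in> atlas M \<Longrightarrow> x \<in> fst c \<Longrightarrow> \<omega> c x v = \<omega>' c x v" "primitive M \<omega> f"
  shows "primitive M \<omega>' f"
  using assms by (simp add: primitive_def)

lemma primitive_add:
  assumes M: "smooth_structure M" and f: "primitive M \<omega> f" and g: "primitive M \<omega>' g"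
  shows "primitive M (\<lambda>c x v. \<omega> c x v + \<omega>' c x v) (\<lambda>x. f x + g x)"
  unfolding primitive_def smooth_fun_def
proof (intro conjI ballI allI)
  fix c assume c: "c \<in> atlas M"
  have sf: "smooth_on (snd c ` fst c) (f \<circ> chart_inv c)" and sg: "smooth_on (snd c ` fst c) (g \<circ> chart_inv c)"
    using f g c by (auto simp: primitive_def smooth_fun_def)
  show "smooth_on (snd c ` fst c) ((\<lambda>x. f x + g x) \<circ> chart_inv c)"
    using smooth_on_add[OF chart_open_image[OF M c] sf sg] by (simp add: comp_def)
  fix x v assume x: "x \<in> fst c"
  have "((\<lambda>y. (f \<circ> chart_inv c) y + (g \<circ> chart_inv c) y) has_derivative
    (\<lambda>v. differential f c x v + differential g c x v)) (at (snd c x))"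
    unfolding differential_def using sf sg x
    by (intro has_derivative_add has_frechet_derivative_at smooth_on_differentiable[OF sf]
        smooth_on_differentiable[OF sg]) blast+
  from frechet_derivative_at[OF this, THEN fun_cong, of v, symmetric]
  show "differential (\<lambda>x. f x + g x) c x v = \<omega> c x v + \<omega>' c x v"
    using f g c x by (simp add: differential_def primitive_def comp_def)
qed

lemma primitive_minus:
  assumes M: "smooth_structure M" and f: "primitive M \<omega> f"
  shows "primitive M (\<lambda>c x v. - \<omega> c x v) (\<lambda>x. - f x)"
  unfolding primitive_def smooth_fun_def
proof (intro conjI ballI allI)
  fix c assume c: "c \<in> atlas M"
  have sf: "smooth_on (snd c ` fst c) (f \<circ> chart_inv c)"
    using f c by (auto simp: primitive_def smooth_fun_def)
  show "smooth_on (snd c ` fst c) ((\<lambda>x. - f x) \<circ> chart_inv c)"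
    using smooth_on_minus[OF chart_open_image[OF M c] sf] by (simp add: comp_def)
  fix x v assume x: "x \<in> fst c"
  have "((\<lambda>y. - (f \<circ> chart_inv c) y) has_derivative (\<lambda>v. - differential f c x v)) (at (snd c x))"
    unfolding differential_def using sf x
    by (intro has_derivative_minus has_frechet_derivative_at smooth_on_differentiable[OF sf]) blast
  from frechet_derivative_at[OF this, THEN fun_cong, of v, symmetric]
  show "differential (\<lambda>x. - f x) c x v = - \<omega> c x v"
    using f c x by (simp add: differential_def primitive_def comp_def)
qed

lemma primitive_zero: "primitive M (\<lambda>c x v. 0) (\<lambda>x. 0)"
  by (simp add: primitive_def smooth_fun_def differential_def comp_def smooth_on_const frechet_derivative_const)

lemma closed_form_zero: "closed_form M (\<lambda>c x v. 0)"
  by (simp add: closed_form_def one_form_def smooth_on_const frechet_derivative_const linear_zero)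

lemma cohomology_rel_refl: "closed_form M \<alpha> \<Longrightarrow> (\<alpha>, \<alpha>) \<in> cohomology_rel M"
  using primitive_zero[of M] by (auto simp: cohomology_rel_def)

section \<open>Coverings and their smooth structures\<close>

lemma covering_map_evenly_covered:
  assumes "covering_map X Y p" "y \<in> topspace Y"
  obtains U \<V> where "y \<in> U" "openin Y U" "\<Union>\<V> = {x \<in> topspace X. p x \<in> U}"
    "\<And>V. V \<in> \<V> \<Longrightarrow> openin X V" "pairwise disjnt \<V>"
    "\<And>V. V \<in> \<V> \<Longrightarrow> homeomorphic_map (subtopology X V) (subtopology Y U) p"
  using assms(1)[unfolded covering_map_def, THEN conjunct2, THEN conjunct2, THEN bspec, OF assms(2)]
proof (elim exE conjE)
  fix U \<V>
  assume "y \<in> U" "openin Y U" "\<Union>\<V> = {x \<in> topspace X. p x \<in> U}" "\<forall>V\<in>\<V>. openin X V" "pairwise disjnt \<V>"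
    "\<forall>V\<in>\<V>. homeomorphic_map (subtopology X V) (subtopology Y U) p"
  then show thesis by (intro that[of U \<V>]) simp_all
qed

section \<open>The pulled-back covering\<close>

lemma topspace_pullback_cover:
  "topspace (pullback_cover X \<phi> Y p) = {(x, y). x \<in> topspace X \<and> y \<in> topspace Y \<and> \<phi> x = p y}"
  unfolding pullback_cover_def by auto

lemma continuous_map_pullback_cover_fst: "continuous_map (pullback_cover X \<phi> Y p) X fst"
  and continuous_map_pullback_cover_snd: "continuous_map (pullback_cover X \<phi> Y p) Y snd"
  unfolding pullback_cover_def
  by (auto intro: continuous_map_from_subtopology continuous_map_fst continuous_map_snd)

lemma continuous_map_into_pullback_cover:
  assumes "continuous_map Z X f" "continuous_map Z Y g" "\<And>z. z \<in> topspace Z \<Longrightarrow> \<phi> (f z) = p (g z)"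
  shows "continuous_map Z (pullback_cover X \<phi> Y p) (\<lambda>z. (f z, g z))"
  unfolding pullback_cover_def continuous_map_in_subtopology
  using assms by (auto intro: continuous_map_pairedI)

text \<open>Over the preimage \<open>W\<close> of an evenly covered \<open>U\<close>, the sheets are
  the fibre products of \<open>W\<close> with the sheets \<open>V\<close> of \<open>p\<close>. If
  \<open>s\<close> inverts \<open>p\<close> on \<open>V\<close>, then
  \<open>w \<mapsto> (w, s (\<phi> w))\<close> inverts \<open>fst\<close> on the corresponding
  sheet.\<close>

lemma covering_map_pullback:
  assumes p: "covering_map Y B p" and \<phi>: "continuous_map X B \<phi>"
  shows "covering_map (pullback_cover X \<phi> Y p) X fst"
  unfolding covering_map_def
proof (intro conjI ballI)
  let ?P = "pullback_cover X \<phi> Y p"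
  show "continuous_map ?P X fst" by (rule continuous_map_pullback_cover_fst)
  have "p ` topspace Y = topspace B" using p by (simp add: covering_map_def)
  then have "\<phi> x \<in> p ` topspace Y" if "x \<in> topspace X" for x
    using that \<phi> by (simp add: continuous_map_def Pi_iff)
  then have "\<exists>y\<in>topspace Y. \<phi> x = p y" if "x \<in> topspace X" for x
    using that by blast
  then show "fst ` topspace ?P = topspace X"
    by (force simp: topspace_pullback_cover image_iff)
  fix x assume x: "x \<in> topspace X"
  then have \<phi>x: "\<phi> x \<in> topspace B" using \<phi> by (auto simp: continuous_map_def)
  obtain U \<V> where U: "\<phi> x \<in> U" "openin B U" and \<V>: "\<Union>\<V> = {y \<in> topspace Y. p y \<in> U}"
    "\<And>V. V \<in> \<V> \<Longrightarrow> openin Y V" "pairwise disjnt \<V>"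
    "\<And>V. V \<in> \<V> \<Longrightarrow> homeomorphic_map (subtopology Y V) (subtopology B U) p"
    using that by (rule covering_map_evenly_covered[OF p \<phi>x])
  define W where "W = {x \<in> topspace X. \<phi> x \<in> U}"
  define S where "S V = {z \<in> topspace ?P. fst z \<in> W \<and> snd z \<in> V}" for V
  have W: "openin X W" unfolding W_def using openin_continuous_map_preimage[OF \<phi> U(2)] .
  have Wt: "W \<subseteq> topspace X" by (auto simp: W_def)
  have hom: "homeomorphic_map (subtopology ?P (S V)) (subtopology X W) fst" if V: "V \<in> \<V>" for V
  proof -
    obtain s where s: "homeomorphic_maps (subtopology Y V) (subtopology B U) p s"
      using \<V>(4)[OF V] by (auto simp: homeomorphic_map_maps)
    have VY: "V \<subseteq> topspace Y" using \<V>(2)[OF V] by (rule openin_subset)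
    have UB: "U \<subseteq> topspace B" using U by (simp add: openin_subset)
    have s1: "continuous_map (subtopology B U) (subtopology Y V) s"
      and s2: "\<And>y. y \<in> V \<Longrightarrow> s (p y) = y" and s3: "\<And>b. b \<in> U \<Longrightarrow> p (s b) = b"
      using s VY UB by (auto simp: homeomorphic_maps_def)
    have s4: "s b \<in> V" if "b \<in> U" for b
      using s1 that UB by (auto simp: continuous_map_def)
    have \<phi>W: "continuous_map (subtopology X W) (subtopology B U) \<phi>"
      using \<phi> by (auto simp: continuous_map_in_subtopology W_def intro: continuous_map_from_subtopology)
    have s\<phi>: "continuous_map (subtopology X W) Y (\<lambda>w. s (\<phi> w))"
      using continuous_map_compose[OF \<phi>W s1] by (simp add: comp_def continuous_map_in_subtopology)
    have "continuous_map (subtopology X W) ?P (\<lambda>w. (w, s (\<phi> w)))"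
      using s\<phi> by (intro continuous_map_into_pullback_cover)
        (auto simp: s3 W_def intro: continuous_map_from_subtopology[OF continuous_map_id, unfolded id_def])
    moreover have "(w, s (\<phi> w)) \<in> S V" if "w \<in> W" for w
      using that VY s3 s4 by (auto simp: S_def W_def topspace_pullback_cover)
    ultimately have g: "continuous_map (subtopology X W) (subtopology ?P (S V)) (\<lambda>w. (w, s (\<phi> w)))"
      by (auto simp: continuous_map_in_subtopology)
    have f: "continuous_map (subtopology ?P (S V)) (subtopology X W) fst"
      by (auto simp: continuous_map_in_subtopology S_def
          intro: continuous_map_from_subtopology continuous_map_pullback_cover_fst)
    have "s (\<phi> (fst z)) = snd z" if "z \<in> S V" for z
      using that s2 by (auto simp: S_def topspace_pullback_cover)
    then have "homeomorphic_maps (subtopology ?P (S V)) (subtopology X W) fst (\<lambda>w. (w, s (\<phi> w)))"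
      using f g by (auto simp: homeomorphic_maps_def prod_eq_iff)
    then show ?thesis by (rule homeomorphic_maps_imp_map)
  qed
  have "\<Union>(S ` \<V>) = {z \<in> topspace ?P. fst z \<in> W}"
  proof -
    have "snd z \<in> \<Union>\<V>" if "z \<in> topspace ?P" "fst z \<in> W" for z
      using that by (auto simp: \<V>(1) W_def topspace_pullback_cover)
    then show ?thesis by (auto simp: S_def)
  qed
  moreover have "openin ?P (S V)" if "V \<in> \<V>" for V
  proof -
    have eq: "S V = {z \<in> topspace ?P. fst z \<in> W} \<inter> {z \<in> topspace ?P. snd z \<in> V}" by (auto simp: S_def)
    show ?thesis
      unfolding eq
      by (intro openin_Int openin_continuous_map_preimage[OF continuous_map_pullback_cover_fst W]
        openin_continuous_map_preimage[OF continuous_map_pullback_cover_snd \<V>(2)[OF that]])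
  qed
  moreover have "pairwise disjnt (S ` \<V>)"
    using \<V>(3) by (fastforce simp: pairwise_def disjnt_def S_def)
  ultimately show "\<exists>W. x \<in> W \<and> openin X W \<and> (\<exists>\<S>. \<Union>\<S> = {z \<in> topspace ?P. fst z \<in> W} \<and>
      (\<forall>V\<in>\<S>. openin ?P V) \<and> pairwise disjnt \<S> \<and>
      (\<forall>V\<in>\<S>. homeomorphic_map (subtopology ?P V) (subtopology X W) fst))"
    using x U W hom by (intro exI[of _ W] conjI exI[of _ "S ` \<V>"]) (auto simp: W_def)
qed

section \<open>Components of a covering over a locally connected base\<close>

text \<open>Sheets are homeomorphic to the set they cover. Shrinking that set to a connected one
  therefore makes every sheet connected, so that no sheet is split between components.\<close>

lemma evenly_covered_connected:
  assumes q: "covering_map P X q" and x: "x \<in> topspace X"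
    and lc: "\<And>W x. openin X W \<Longrightarrow> x \<in> W \<Longrightarrow> \<exists>V. openin X V \<and> x \<in> V \<and> V \<subseteq> W \<and> connectedin X V"
  obtains V \<S> where "x \<in> V" "openin X V" "\<Union>\<S> = {z \<in> topspace P. q z \<in> V}" "\<And>S. S \<in> \<S> \<Longrightarrow> openin P S"
    "pairwise disjnt \<S>" "\<And>S. S \<in> \<S> \<Longrightarrow> homeomorphic_map (subtopology P S) (subtopology X V) q"
    "\<And>S. S \<in> \<S> \<Longrightarrow> connectedin P S"
proof -
  obtain U \<V> where U: "x \<in> U" "openin X U" and \<V>: "\<Union>\<V> = {y \<in> topspace P. q y \<in> U}"
    "\<And>V. V \<in> \<V> \<Longrightarrow> openin P V" "pairwise disjnt \<V>"
    "\<And>V. V \<in> \<V> \<Longrightarrow> homeomorphic_map (subtopology P V) (subtopology X U) q"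
    using that by (rule covering_map_evenly_covered[OF q x])
  obtain V where V: "openin X V" "x \<in> V" "V \<subseteq> U" "connectedin X V" using lc[OF U(2,1)] by blast
  define S where "S T = {z \<in> T. q z \<in> V}" for T
  have qc: "continuous_map P X q" using q by (simp add: covering_map_def)
  have VX: "V \<subseteq> topspace X" using V by (simp add: openin_subset)
  have hom: "homeomorphic_map (subtopology P (S T)) (subtopology X V) q" if T: "T \<in> \<V>" for T
  proof -
    have TP: "T \<subseteq> topspace P" using \<V>(2)[OF T] by (rule openin_subset)
    have "q ` T = U"
      using homeomorphic_imp_surjective_map[OF \<V>(4)[OF T]] TP U(2) by (simp add: Int_absorb1 openin_subset)
    then have "q ` S T = V" using V by (auto simp: S_def)
    have "homeomorphic_map (subtopology (subtopology P T) (S T)) (subtopology (subtopology X U) V) q"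
    proof (intro homeomorphic_map_subtopologies[OF \<V>(4)[OF T]])
      have "topspace (subtopology P T) \<inter> S T = S T" "topspace (subtopology X U) \<inter> V = V"
        using TP VX V by (auto simp: S_def)
      then show "q ` (topspace (subtopology P T) \<inter> S T) = topspace (subtopology X U) \<inter> V"
        using \<open>q ` S T = V\<close> by (simp only:)
    qed
    moreover have "T \<inter> S T = S T" by (auto simp: S_def)
    ultimately show ?thesis using V by (simp add: subtopology_subtopology Int_absorb1)
  qed
  have sub: "openin P (S T)" if "T \<in> \<V>" for T
  proof -
    have "S T = T \<inter> {z \<in> topspace P. q z \<in> V}"
      using openin_subset[OF \<V>(2)[OF that]] by (auto simp: S_def)
    then show ?thesis using \<V>(2)[OF that] openin_continuous_map_preimage[OF qc V(1)] by auto
  qed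
  have con: "connectedin P (S T)" if "T \<in> \<V>" for T
  proof -
    have "connected_space (subtopology X V)" using V by (simp add: connectedin_def)
    then have "connected_space (subtopology P (S T))"
      using homeomorphic_map_imp_homeomorphic_space[OF hom[OF that]] homeomorphic_connected_space by blast
    then show ?thesis using openin_subset[OF sub[OF that]] by (simp add: connectedin_def)
  qed
  have "z \<in> \<Union>(S ` \<V>) \<longleftrightarrow> z \<in> topspace P \<and> q z \<in> V" for z
  proof
    assume "z \<in> \<Union>(S ` \<V>)"
    then show "z \<in> topspace P \<and> q z \<in> V"
      using openin_subset[OF \<V>(2)] by (auto simp: S_def)
  next
    assume z: "z \<in> topspace P \<and> q z \<in> V"
    then have "z \<in> \<Union>\<V>" using V(3) by (auto simp: \<V>(1))
    then show "z \<in> \<Union>(S ` \<V>)" using z by (auto simp: S_def)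
  qed
  then have "\<Union>(S ` \<V>) = {z \<in> topspace P. q z \<in> V}" by auto
  moreover have "pairwise disjnt (S ` \<V>)"
    using \<V>(3) by (fastforce simp: pairwise_def disjnt_def S_def)
  ultimately show ?thesis
    using V sub con hom by (intro that[of V "S ` \<V>"]) auto
qed

text \<open>A connected sheet lies in \<open>C\<close> or misses it, so the sheets inside
  \<open>C\<close> evenly cover. For the same reason a small \<open>V\<close> lies in
  \<open>q\<close> C\<open>or misses it; hence the nonempty set\<close>q \<open>C\<close> is open
  and closed, and equals the connected base.\<close>

lemma covering_map_component:
  assumes q: "covering_map P X q" and X: "connected_space X"
    and lc: "\<And>W x. openin X W \<Longrightarrow> x \<in> W \<Longrightarrow> \<exists>V. openin X V \<and> x \<in> V \<and> V \<subseteq> W \<and> connectedin X V"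
    and C: "C \<in> connected_components_of P"
  shows "covering_map (subtopology P C) X q"
proof -
  have CP: "C \<subseteq> topspace P" using connected_components_of_subset[OF C] .
  have qc: "continuous_map P X q" using q by (simp add: covering_map_def)
  have dich: "S \<subseteq> C" if "connectedin P S" "z \<in> S" "z \<in> C" for S z
    using connected_components_of_maximal[OF C that(1)] that by (auto simp: disjnt_def)
  \<comment> \<open>The family of sheets may still be empty here; that each fibre meets
    \<open>C\<close> comes from the open-and-closed argument further down.\<close>
  have even: "\<exists>V. x \<in> V \<and> openin X V \<and> (\<exists>\<T>. \<Union>\<T> = {z \<in> C. q z \<in> V} \<and> (\<forall>S\<in>\<T>. openin (subtopology P C) S) \<and>
      pairwise disjnt \<T> \<and> (\<forall>S\<in>\<T>. homeomorphic_map (subtopology (subtopology P C) S) (subtopology X V) q))"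
    if x: "x \<in> topspace X" for x
  proof -
    obtain V \<S> where V: "x \<in> V" "openin X V" and \<S>: "\<Union>\<S> = {z \<in> topspace P. q z \<in> V}" "\<And>S. S \<in> \<S> \<Longrightarrow> openin P S"
      "pairwise disjnt \<S>" "\<And>S. S \<in> \<S> \<Longrightarrow> homeomorphic_map (subtopology P S) (subtopology X V) q"
      "\<And>S. S \<in> \<S> \<Longrightarrow> connectedin P S"
      using evenly_covered_connected[OF q x lc] by blast
    have "\<Union>{S \<in> \<S>. S \<subseteq> C} = {z \<in> C. q z \<in> V}"
    proof (intro equalityI subsetI)
      fix z assume z: "z \<in> {z \<in> C. q z \<in> V}"
      then have "z \<in> \<Union>\<S>" using CP by (auto simp: \<S>(1))
      then show "z \<in> \<Union>{S \<in> \<S>. S \<subseteq> C}" using z dich[OF \<S>(5)] by blast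
    next
      fix z assume "z \<in> \<Union>{S \<in> \<S>. S \<subseteq> C}"
      then have "z \<in> C" "z \<in> \<Union>\<S>" by auto
      then show "z \<in> {z \<in> C. q z \<in> V}" by (simp add: \<S>(1))
    qed
    moreover have "openin (subtopology P C) S" if "S \<in> \<S>" "S \<subseteq> C" for S
      using \<S>(2)[OF that(1)] that by (auto simp: openin_subtopology intro!: exI[of _ S])
    moreover have "pairwise disjnt {S \<in> \<S>. S \<subseteq> C}" using \<S>(3) by (auto simp: pairwise_def)
    moreover have "homeomorphic_map (subtopology (subtopology P C) S) (subtopology X V) q" if "S \<in> \<S>" "S \<subseteq> C" for S
      using \<S>(4)[OF that(1)] that by (simp add: subtopology_subtopology Int_absorb1)
    ultimately show ?thesis using V by (intro exI[of _ V] conjI exI[of _ "{S \<in> \<S>. S \<subseteq> C}"]) simp_all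
  qed
  have all: "\<exists>V. x \<in> V \<and> openin X V \<and> (V \<subseteq> q ` C \<or> V \<inter> q ` C = {})" if x: "x \<in> topspace X" for x
  proof -
    obtain V \<T> where V: "x \<in> V" "openin X V" and \<T>: "\<Union>\<T> = {z \<in> C. q z \<in> V}"
      "\<forall>S\<in>\<T>. homeomorphic_map (subtopology (subtopology P C) S) (subtopology X V) q"
      using even[OF x] by (elim exE conjE) (rule that)
    have "V \<subseteq> q ` C" if z: "z \<in> C" "q z \<in> V" for z
    proof -
      obtain S where S: "S \<in> \<T>" "z \<in> S" using \<T>(1) z by blast
      have "q ` topspace (subtopology (subtopology P C) S) = topspace (subtopology X V)"
        using \<T>(2)[rule_format, OF S(1)] by (rule homeomorphic_imp_surjective_map)
      then show ?thesis using openin_subset[OF V(2)] by auto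
    qed
    then show ?thesis using V by blast
  qed
  have qC: "q ` C \<subseteq> topspace X" using qc CP by (auto simp: continuous_map_def)
  have "openin X (q ` C)"
  proof (subst openin_subopen, intro ballI)
    fix x assume x: "x \<in> q ` C"
    then obtain V where V: "x \<in> V" "openin X V" "V \<subseteq> q ` C \<or> V \<inter> q ` C = {}"
      using all[of x] qC by blast
    with x have "V \<subseteq> q ` C" by blast
    with V show "\<exists>T. openin X T \<and> x \<in> T \<and> T \<subseteq> q ` C" by blast
  qed
  moreover have "openin X (topspace X - q ` C)"
  proof (subst openin_subopen, intro ballI)
    fix x assume x: "x \<in> topspace X - q ` C"
    then obtain V where V: "x \<in> V" "openin X V" "V \<subseteq> q ` C \<or> V \<inter> q ` C = {}"
      using all[of x] by blast
    with x have "V \<inter> q ` C = {}" by blast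
    with V show "\<exists>T. openin X T \<and> x \<in> T \<and> T \<subseteq> topspace X - q ` C"
      using openin_subset by (intro exI[of _ V]) blast
  qed
  then have "closedin X (q ` C)" using qC by (simp add: closedin_def)
  ultimately have "q ` C = topspace X"
    using X nonempty_connected_components_of[OF C] unfolding connected_space_clopen_in by blast
  moreover have "topspace (subtopology P C) = C" using CP by (simp add: Int_absorb1)
  ultimately show ?thesis
    unfolding covering_map_def using even continuous_map_from_subtopology[OF qc, of C]
    by simp
qed

section \<open>Deck transformations and regularity\<close>

lemma deck_transformation_pullback:
  assumes T: "deck_transformation Y p T"
  shows "deck_transformation (pullback_cover X \<phi> Y p) fst (\<lambda>z. (fst z, T (snd z)))"
proof -
  let ?P = "pullback_cover X \<phi> Y p"
  obtain T' where T': "homeomorphic_maps Y Y T T'"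
    using T by (auto simp: deck_transformation_def homeomorphic_map_maps)
  have pT: "p (T y) = p y" if "y \<in> topspace Y" for y using T that by (simp add: deck_transformation_def)
  have Tt: "T y \<in> topspace Y" "T' y \<in> topspace Y" "T' (T y) = y" "T (T' y) = y" if "y \<in> topspace Y" for y
    using T' that by (auto simp: homeomorphic_maps_def continuous_map_def)
  have pT': "p (T' y) = p y" if "y \<in> topspace Y" for y using pT[OF Tt(2)[OF that]] Tt(4)[OF that] by simp
  have cT: "continuous_map Y Y T" "continuous_map Y Y T'" using T' by (auto simp: homeomorphic_maps_def)
  have c: "continuous_map ?P ?P (\<lambda>z. (fst z, S (snd z)))"
    if "continuous_map Y Y S" "\<And>y. y \<in> topspace Y \<Longrightarrow> p (S y) = p y" for S
    using that continuous_map_compose[OF continuous_map_pullback_cover_snd that(1)]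
    by (intro continuous_map_into_pullback_cover continuous_map_pullback_cover_fst)
      (auto simp: comp_def topspace_pullback_cover)
  have "homeomorphic_maps ?P ?P (\<lambda>z. (fst z, T (snd z))) (\<lambda>z. (fst z, T' (snd z)))"
    unfolding homeomorphic_maps_def using c cT pT pT' Tt by (auto simp: topspace_pullback_cover)
  then show ?thesis
    unfolding deck_transformation_def by (auto dest: homeomorphic_maps_imp_map)
qed

text \<open>A homeomorphism permutes the components, and distinct components are disjoint, so a
  single point decides which component is the image of \<open>C\<close>.\<close>

lemma homeomorphic_map_components:
  assumes h: "homeomorphic_map P P h" and C: "C \<in> connected_components_of P" "C' \<in> connected_components_of P"
    and z: "z \<in> C" "h z \<in> C'"
  shows "homeomorphic_map (subtopology P C) (subtopology P C') h"
proof -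
  have CP: "C \<subseteq> topspace P" "C' \<subseteq> topspace P" using connected_components_of_subset C by auto
  have "h ` C \<in> connected_components_of P"
    using homeomorphic_map_connected_components_of[OF h] C by auto
  moreover have "\<not> disjnt (h ` C) C'" using z by (auto simp: disjnt_def)
  ultimately have "h ` C = C'"
    using pairwise_disjoint_connected_components_of[of P] C unfolding pairwise_def by blast
  then show ?thesis
    using CP by (intro homeomorphic_map_subtopologies[OF h]) (simp add: Int_absorb1)
qed

text \<open>The second coordinates of \<open>z\<close> and \<open>z'\<close> lie in one fibre of
  \<open>p\<close>, where regularity provides the deck transformation. The case
  \<open>C = C'\<close> gives deck transformations of a component, the general case a comparison of
  two components.\<close>

lemma pullback_component_homeo:
  fixes X :: "'a topology" and Y :: "'c topology"
  assumes p: "regular_covering Y B p"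
    and C: "C \<in> connected_components_of (pullback_cover X \<phi> Y p)" "C' \<in> connected_components_of (pullback_cover X \<phi> Y p)"
    and z: "z \<in> C" "z' \<in> C'" "fst z = fst z'"
  obtains h where "homeomorphic_map (subtopology (pullback_cover X \<phi> Y p) C) (subtopology (pullback_cover X \<phi> Y p) C') h"
    "\<And>w. w \<in> C \<Longrightarrow> fst (h w) = fst w" "h z = z'"
proof -
  let ?P = "pullback_cover X \<phi> Y p"
  have "z \<in> topspace ?P" "z' \<in> topspace ?P" using z C connected_components_of_subset by blast+
  then have "snd z \<in> topspace Y" "snd z' \<in> topspace Y" "p (snd z) = p (snd z')"
    using z by (auto simp: topspace_pullback_cover)
  then obtain T where T: "deck_transformation Y p T" "T (snd z) = snd z'"
    using p unfolding regular_covering_def by blast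
  define h where "h = (\<lambda>z :: 'a \<times> 'c. (fst z, T (snd z)))"
  have "homeomorphic_map ?P ?P h"
    using deck_transformation_pullback[OF T(1)] by (simp add: h_def deck_transformation_def)
  moreover have hz: "h z = z'" using T(2) z by (simp add: h_def prod_eq_iff)
  ultimately have "homeomorphic_map (subtopology ?P C) (subtopology ?P C') h"
    using homeomorphic_map_components[OF _ C] z by metis
  then show ?thesis using hz that[of h] by (simp add: h_def)
qed

lemma regular_covering_pullback_component:
  assumes p: "regular_covering Y B p" and \<phi>: "continuous_map X B \<phi>" and X: "connected_space X"
    and lc: "\<And>W x. openin X W \<Longrightarrow> x \<in> W \<Longrightarrow> \<exists>V. openin X V \<and> x \<in> V \<and> V \<subseteq> W \<and> connectedin X V"
    and C: "C \<in> connected_components_of (pullback_cover X \<phi> Y p)"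
  shows "regular_covering (subtopology (pullback_cover X \<phi> Y p) C) X fst"
proof -
  let ?P = "pullback_cover X \<phi> Y p"
  have CP: "C \<subseteq> topspace ?P" using connected_components_of_subset C by auto
  have "covering_map (subtopology ?P C) X fst"
    using covering_map_component[OF covering_map_pullback[OF _ \<phi>] X lc C] p by (simp add: regular_covering_def)
  moreover have "\<exists>T. deck_transformation (subtopology ?P C) fst T \<and> T z = z'"
    if z: "z \<in> C" "z' \<in> C" "fst z = fst z'" for z z'
  proof -
    obtain h where "homeomorphic_map (subtopology ?P C) (subtopology ?P C) h"
      "\<And>w. w \<in> C \<Longrightarrow> fst (h w) = fst w" "h z = z'"
      using that by (rule pullback_component_homeo[OF p C C z])
    then show ?thesis unfolding deck_transformation_def by (intro exI[of _ h]) simp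
  qed
  ultimately show ?thesis
    unfolding regular_covering_def using CP by (auto simp: Int_absorb1)
qed

section \<open>The smooth structure of a total space\<close>

text \<open>The features of a covering that allow charts of the base to be lifted: openness and
  local injectivity, in the shape in which the atlas of \<open>cover_manifold\<close> refers to
  them.\<close>

definition local_homeo :: "'c topology \<Rightarrow> 'a topology \<Rightarrow> ('c \<Rightarrow> 'a) \<Rightarrow> bool" where
  "local_homeo X Y p \<longleftrightarrow> continuous_map X Y p \<and> open_map X Y p \<and>
     (\<forall>x\<in>topspace X. \<exists>V. openin X V \<and> x \<in> V \<and> inj_on p V)"

lemma covering_map_imp_local_homeo:
  assumes p: "covering_map X Y p"
  shows "local_homeo X Y p"
proof -
  have pc: "continuous_map X Y p" using p by (simp add: covering_map_def)
  have sheet: "\<exists>U V. openin Y U \<and> openin X V \<and> x \<in> V \<and> homeomorphic_map (subtopology X V) (subtopology Y U) p"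
    if x: "x \<in> topspace X" for x
  proof -
    have px: "p x \<in> topspace Y" using pc x by (auto simp: continuous_map_def)
    obtain U \<V> where U: "p x \<in> U" "openin Y U" and \<V>: "\<Union>\<V> = {y \<in> topspace X. p y \<in> U}"
      "\<And>V. V \<in> \<V> \<Longrightarrow> openin X V" "pairwise disjnt \<V>"
      "\<And>V. V \<in> \<V> \<Longrightarrow> homeomorphic_map (subtopology X V) (subtopology Y U) p"
      using that by (rule covering_map_evenly_covered[OF p px])
    have "x \<in> \<Union>\<V>" using U x by (simp add: \<V>(1))
    then show ?thesis using U \<V>(2,4) by blast
  qed
  have "open_map X Y p"
    unfolding open_map_def
  proof (intro allI impI)
    fix W assume W: "openin X W"
    have "\<exists>T. openin Y T \<and> p x \<in> T \<and> T \<subseteq> p ` W" if x: "x \<in> W" for x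
    proof -
      have "x \<in> topspace X" using W x openin_subset by blast
      then obtain U V where UV: "openin Y U" "openin X V" "x \<in> V" "homeomorphic_map (subtopology X V) (subtopology Y U) p"
        using sheet by blast
      have "openin (subtopology X V) (W \<inter> V)" using W by (simp add: openin_subtopology_Int)
      then have "openin (subtopology Y U) (p ` (W \<inter> V))"
        using homeomorphic_imp_open_map[OF UV(4)] by (simp add: open_map_def)
      then have "openin Y (p ` (W \<inter> V))" using UV(1) openin_trans_full by blast
      then show ?thesis using x UV by blast
    qed
    then show "openin Y (p ` W)" by (subst openin_subopen) auto
  qed
  moreover have "\<exists>V. openin X V \<and> x \<in> V \<and> inj_on p V" if x: "x \<in> topspace X" for x
  proof -
    obtain U V where UV: "openin X V" "x \<in> V" "homeomorphic_map (subtopology X V) (subtopology Y U) p"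
      using sheet[OF x] by blast
    then have "inj_on p V"
      using homeomorphic_imp_injective_map[OF UV(3)] openin_subset[OF UV(1)] by (simp add: Int_absorb1)
    then show ?thesis using UV by blast
  qed
  ultimately show ?thesis using pc by (simp add: local_homeo_def)
qed

text \<open>The atlas of \<open>cover_manifold\<close> asks only that \<open>p\<close> be injective
  on the open set \<open>V\<close>; continuity and openness of \<open>p\<close> upgrade this to a
  homeomorphism onto the image.\<close>

lemma local_homeo_sheet:
  assumes p: "local_homeo X Y p" and V: "openin X V" "inj_on p V"
  shows "homeomorphic_map (subtopology X V) (subtopology Y (p ` V)) p"
proof (rule bijective_open_imp_homeomorphic_map)
  have VX: "V \<subseteq> topspace X" using V by (simp add: openin_subset)
  have pc: "continuous_map X Y p" and po: "open_map X Y p" using p by (auto simp: local_homeo_def)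
  have pV: "p ` V \<subseteq> topspace Y" using pc VX by (auto simp: continuous_map_def)
  show "continuous_map (subtopology X V) (subtopology Y (p ` V)) p"
    using pc by (auto simp: continuous_map_in_subtopology intro: continuous_map_from_subtopology)
  show "open_map (subtopology X V) (subtopology Y (p ` V)) p"
    unfolding open_map_def
  proof (intro allI impI)
    fix W assume W: "openin (subtopology X V) W"
    then have "openin X W" using V openin_trans_full by blast
    then have "openin Y (p ` W)" using po by (simp add: open_map_def)
    moreover have "W \<subseteq> V" using openin_subset[OF W] by auto
    ultimately show "openin (subtopology Y (p ` V)) (p ` W)"
      by (metis image_mono inf.absorb_iff2 openin_subtopology_Int2)
  qed
  show "p ` topspace (subtopology X V) = topspace (subtopology Y (p ` V))"
    using VX pV by (simp add: Int_absorb1)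
  show "inj_on p (topspace (subtopology X V))" using V VX by (simp add: Int_absorb1)
qed

lemma cover_manifold_chartE:
  assumes "c \<in> atlas (cover_manifold M X p)"
  obtains V d where "c = (V, snd d \<circ> p)" "openin X V" "d \<in> atlas M" "inj_on p V" "p ` V \<subseteq> fst d"
  using assms unfolding cover_manifold_def by auto

lemma mtop_cover_manifold [simp]: "mtop (cover_manifold M X p) = X"
  by (simp add: cover_manifold_def)

lemma cover_chart_inv:
  assumes M: "smooth_structure M" and d: "d \<in> atlas M" "inj_on p V" "p ` V \<subseteq> fst d" and x: "x \<in> V"
  shows "chart_inv (V, snd d \<circ> p) (snd d (p x)) = x"
proof -
  have "inj_on (snd d) (p ` V)" using chart_inj[OF M d(1)] d(3) inj_on_subset by blast
  then have "inj_on (snd d \<circ> p) V" using d(2) by (simp add: comp_inj_on)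
  from inv_into_f_f[OF this x] show ?thesis by (simp add: chart_inv_def)
qed

text \<open>A lifted chart has the same coordinates as the chart below, and its inverse followed by
  \<open>p\<close> is the inverse of that chart. Transition maps upstairs are therefore restrictions
  of transition maps of \<open>M\<close>.\<close>

lemma cover_smooth_structure:
  fixes M :: "('a, 'e::real_inner) manifold"
  assumes M: "smooth_structure M" and p: "local_homeo X (mtop M) p"
  shows "smooth_structure (cover_manifold M X p)"
proof -
  let ?A = "atlas (cover_manifold M X p)"
  have pc: "continuous_map X (mtop M) p" and po: "\<And>V. openin X V \<Longrightarrow> openin (mtop M) (p ` V)"
    using p by (auto simp: local_homeo_def open_map_def)
  have "(\<Union>c\<in>?A. fst c) = topspace X"
  proof (intro equalityI subsetI)
    fix x assume "x \<in> (\<Union>c\<in>?A. fst c)"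
    then obtain c where "c \<in> ?A" "x \<in> fst c" by blast
    then show "x \<in> topspace X" using openin_subset by (elim cover_manifold_chartE) force
  next
    fix x assume x: "x \<in> topspace X"
    obtain V where V: "openin X V" "x \<in> V" "inj_on p V" using p x by (auto simp: local_homeo_def)
    have "p x \<in> topspace (mtop M)" using pc x by (auto simp: continuous_map_def)
    then obtain d where d: "d \<in> atlas M" "p x \<in> fst d" using chart_at[OF M] by blast
    define W where "W = V \<inter> {x \<in> topspace X. p x \<in> fst d}"
    have "openin X W"
      unfolding W_def using V openin_continuous_map_preimage[OF pc chart_openin[OF M d(1)]] by blast
    moreover have "inj_on p W" using V by (auto simp: W_def inj_on_def)
    ultimately have "(W, snd d \<circ> p) \<in> ?A"
      using d by (cases d) (auto simp: cover_manifold_def W_def intro!: exI[of _ "fst d"] exI[of _ "snd d"])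
    then show "x \<in> (\<Union>c\<in>?A. fst c)" using V x d by (force simp: W_def)
  qed
  moreover have "openin X (fst c) \<and> open (snd c ` fst c) \<and>
      homeomorphic_map (subtopology X (fst c)) (top_of_set (snd c ` fst c)) (snd c)" if "c \<in> ?A" for c
  proof -
    obtain V d where c: "c = (V, snd d \<circ> p)" "openin X V" "d \<in> atlas M" "inj_on p V" "p ` V \<subseteq> fst d"
      using \<open>c \<in> ?A\<close> by (rule cover_manifold_chartE)
    have "snd d ` p ` V \<subseteq> snd d ` fst d" using c by blast
    moreover have "p ` V \<subseteq> topspace (mtop M)" using chart_subset[OF M c(3)] c by blast
    ultimately have "homeomorphic_map (subtopology (subtopology (mtop M) (fst d)) (p ` V))
      (subtopology (top_of_set (snd d ` fst d)) (snd d ` p ` V)) (snd d)"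
      using c(5) by (intro homeomorphic_map_subtopologies[OF chart_homeo[OF M c(3)]])
        (auto simp: Int_absorb1)
    then have "homeomorphic_map (subtopology (mtop M) (p ` V)) (top_of_set (snd d ` p ` V)) (snd d)"
      using c by (simp add: subtopology_subtopology Int_absorb1 image_mono)
    then have "homeomorphic_map (subtopology X V) (top_of_set (snd d ` p ` V)) (snd d \<circ> p)"
      using local_homeo_sheet[OF p c(2,4)] homeomorphic_map_compose by blast
    then show ?thesis
      using c open_chart_image[OF M c(3) po[OF c(2)] c(5)] by (simp add: image_comp)
  qed
  moreover have "smooth_on (snd c ` (fst c \<inter> fst c')) (snd c' \<circ> chart_inv c)"
    if "c \<in> ?A" "c' \<in> ?A" for c c'
  proof -
    obtain V d where c: "c = (V, snd d \<circ> p)" "openin X V" "d \<in> atlas M" "inj_on p V" "p ` V \<subseteq> fst d"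
      using \<open>c \<in> ?A\<close> by (rule cover_manifold_chartE)
    obtain V' d' where c': "c' = (V', snd d' \<circ> p)" "openin X V'" "d' \<in> atlas M" "inj_on p V'" "p ` V' \<subseteq> fst d'"
      using \<open>c' \<in> ?A\<close> by (rule cover_manifold_chartE)
    have o: "open (snd c ` (fst c \<inter> fst c'))"
    proof -
      have "open (snd d ` p ` (V \<inter> V'))"
        using c c' by (intro open_chart_image[OF M c(3)] po) auto
      then show ?thesis using c c' by (simp add: image_comp)
    qed
    have "smooth_on (snd c ` (fst c \<inter> fst c')) (snd d' \<circ> chart_inv d)"
      using transition_smooth[OF M c(3) c'(3)] by (rule smooth_on_subset) (use c c' in auto)
    then show ?thesis
    proof (rule smooth_on_cong[OF o, rotated])
      fix z assume "z \<in> snd c ` (fst c \<inter> fst c')"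
      then obtain x where x: "x \<in> V" "x \<in> V'" "z = snd d (p x)" using c c' by auto
      have "p x \<in> fst d" using x c by auto
      then show "(snd d' \<circ> chart_inv d) z = (snd c' \<circ> chart_inv c) z"
        using x c' cover_chart_inv[OF M c(3-5) x(1)] chart_inv_chart[OF M c(3)] by (simp add: c(1))
    qed
  qed
  ultimately show ?thesis
    using M unfolding smooth_structure_def smooth_atlas_def by auto
qed

lemma cover_projection_smooth:
  assumes M: "smooth_structure M" and p: "local_homeo X (mtop M) p"
  shows "smooth_map (cover_manifold M X p) M p"
proof -
  have pc: "continuous_map X (mtop M) p" and po: "\<And>V. openin X V \<Longrightarrow> openin (mtop M) (p ` V)"
    using p by (auto simp: local_homeo_def open_map_def)
  have "smooth_on (snd c ` (fst c \<inter> p -` fst d')) (snd d' \<circ> p \<circ> chart_inv c)"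
    if "c \<in> atlas (cover_manifold M X p)" and d': "d' \<in> atlas M" for c d'
  proof -
    obtain V d where c: "c = (V, snd d \<circ> p)" "openin X V" "d \<in> atlas M" "inj_on p V" "p ` V \<subseteq> fst d"
      using \<open>c \<in> _\<close> by (rule cover_manifold_chartE)
    have o: "open (snd c ` (fst c \<inter> p -` fst d'))"
    proof -
      have "fst c \<inter> p -` fst d' = V \<inter> {x \<in> topspace X. p x \<in> fst d'}"
        using c openin_subset[OF c(2)] by auto
      then have "openin X (fst c \<inter> p -` fst d')"
        using c openin_continuous_map_preimage[OF pc chart_openin[OF M d']] by auto
      then have "open (snd d ` p ` (fst c \<inter> p -` fst d'))"
        using c by (intro open_chart_image[OF M c(3)] po) auto
      then show ?thesis using c by (simp add: image_comp)
    qed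
    have "smooth_on (snd c ` (fst c \<inter> p -` fst d')) (snd d' \<circ> chart_inv d)"
      using transition_smooth[OF M c(3) d'] by (rule smooth_on_subset) (use c in auto)
    then show ?thesis
    proof (rule smooth_on_cong[OF o, rotated])
      fix z assume "z \<in> snd c ` (fst c \<inter> p -` fst d')"
      then obtain x where x: "x \<in> V" "z = snd d (p x)" using c by auto
      have "p x \<in> fst d" using x c by auto
      then show "(snd d' \<circ> chart_inv d) z = (snd d' \<circ> p \<circ> chart_inv c) z"
        using x cover_chart_inv[OF M c(3-5) x(1)] chart_inv_chart[OF M c(3)] by (simp add: c(1))
    qed
  qed
  then show ?thesis using pc by (simp add: smooth_map_def)
qed

text \<open>In lifted charts the representative of \<open>F\<close> is a restriction of the
  representative of \<open>\<phi>\<close>. This is applied to \<open>snd\<close>, which covers the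
  given map, and to homeomorphisms between components, which cover the identity.\<close>

lemma cover_lift_smooth:
  assumes M: "smooth_structure M" and N: "smooth_structure N"
    and p: "local_homeo X (mtop M) p" and q: "local_homeo Y (mtop N) q"
    and F: "continuous_map X Y F" and \<phi>: "smooth_map M N \<phi>"
    and comm: "\<And>x. x \<in> topspace X \<Longrightarrow> q (F x) = \<phi> (p x)"
  shows "smooth_map (cover_manifold M X p) (cover_manifold N Y q) F"
proof -
  have pc: "continuous_map X (mtop M) p" and po: "\<And>V. openin X V \<Longrightarrow> openin (mtop M) (p ` V)"
    using p by (auto simp: local_homeo_def open_map_def)
  have "smooth_on (snd c ` (fst c \<inter> F -` fst c')) (snd c' \<circ> F \<circ> chart_inv c)"
    if "c \<in> atlas (cover_manifold M X p)" and "c' \<in> atlas (cover_manifold N Y q)" for c c'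
  proof -
    obtain V d where c: "c = (V, snd d \<circ> p)" "openin X V" "d \<in> atlas M" "inj_on p V" "p ` V \<subseteq> fst d"
      using \<open>c \<in> _\<close> by (rule cover_manifold_chartE)
    obtain V' d' where c': "c' = (V', snd d' \<circ> q)" "openin Y V'" "d' \<in> atlas N" "inj_on q V'" "q ` V' \<subseteq> fst d'"
      using \<open>c' \<in> _\<close> by (rule cover_manifold_chartE)
    have VX: "V \<subseteq> topspace X" using c by (simp add: openin_subset)
    have o: "open (snd c ` (fst c \<inter> F -` fst c'))"
    proof -
      have "fst c \<inter> F -` fst c' = V \<inter> {x \<in> topspace X. F x \<in> V'}"
        using c c' VX by auto
      then have "openin X (fst c \<inter> F -` fst c')"
        using c openin_continuous_map_preimage[OF F c'(2)] by auto
      then have "open (snd d ` p ` (fst c \<inter> F -` fst c'))"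
        using c by (intro open_chart_image[OF M c(3)] po) auto
      then show ?thesis using c by (simp add: image_comp)
    qed
    have "\<phi> (p x) \<in> fst d'" if "x \<in> V" "F x \<in> V'" for x
    proof -
      have "q (F x) = \<phi> (p x)" using that VX comm by blast
      moreover have "q (F x) \<in> fst d'" using that c'(5) by blast
      ultimately show ?thesis by simp
    qed
    then have "snd c ` (fst c \<inter> F -` fst c') \<subseteq> snd d ` (fst d \<inter> \<phi> -` fst d')"
      using c c' by auto
    then have "smooth_on (snd c ` (fst c \<inter> F -` fst c')) (snd d' \<circ> \<phi> \<circ> chart_inv d)"
      using smooth_map_rep(2)[OF M \<phi> c(3) c'(3) N] smooth_on_subset by blast
    then show ?thesis
    proof (rule smooth_on_cong[OF o, rotated])
      fix z assume "z \<in> snd c ` (fst c \<inter> F -` fst c')"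
      then obtain x where x: "x \<in> V" "z = snd d (p x)" using c by auto
      have "p x \<in> fst d" using x c by auto
      then show "(snd d' \<circ> \<phi> \<circ> chart_inv d) z = (snd c' \<circ> F \<circ> chart_inv c) z"
        using x VX cover_chart_inv[OF M c(3-5) x(1)] chart_inv_chart[OF M c(3)] comm[of x]
        by (simp add: c(1) c'(1) subset_iff)
    qed
  qed
  then show ?thesis using F by (simp add: smooth_map_def)
qed

text \<open>Balls inside a chart image are convex, hence connected; their preimages supply the
  neighbourhoods required by the lemmas on components.\<close>

lemma manifold_locally_connected:
  assumes M: "smooth_structure M" and W: "openin (mtop M) W" "x \<in> W"
  shows "\<exists>V. openin (mtop M) V \<and> x \<in> V \<and> V \<subseteq> W \<and> connectedin (mtop M) V"
proof -
  have "x \<in> topspace (mtop M)" using W openin_subset by blast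
  then obtain c where c: "c \<in> atlas M" "x \<in> fst c" using chart_at[OF M] by blast
  have "openin (mtop M) (W \<inter> fst c)" using W chart_openin[OF M c(1)] by blast
  then have "open (snd c ` (W \<inter> fst c))" by (rule open_chart_image[OF M c(1)]) auto
  then obtain r where r: "r > 0" "ball (snd c x) r \<subseteq> snd c ` (W \<inter> fst c)"
    using W c open_contains_ball by blast
  let ?B = "ball (snd c x) r"
  define V where "V = {y \<in> fst c. snd c y \<in> ?B}"
  have hom: "homeomorphic_map (subtopology (mtop M) (fst c)) (top_of_set (snd c ` fst c)) (snd c)"
    by (rule chart_homeo[OF M c(1)])
  have VW: "V \<subseteq> W"
  proof
    fix y assume y: "y \<in> V"
    then obtain y' where "y' \<in> W" "y' \<in> fst c" "snd c y = snd c y'" using r by (auto simp: V_def)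
    then show "y \<in> W" using y chart_inj[OF M c(1)] by (auto simp: V_def inj_on_def)
  qed
  have im: "snd c ` V = ?B" using r by (auto simp: V_def)
  have Vsub: "V \<subseteq> topspace (subtopology (mtop M) (fst c))"
    using chart_subset[OF M c(1)] by (auto simp: V_def)
  have Bsub: "?B \<subseteq> snd c ` fst c" using r by auto
  have "openin (top_of_set (snd c ` fst c)) ?B"
    using Bsub by (auto simp: openin_open_eq chart_open_image[OF M c(1)])
  then have "openin (subtopology (mtop M) (fst c)) V"
    using homeomorphic_map_openness[OF hom Vsub] im by simp
  then have "openin (mtop M) V" using chart_openin[OF M c(1)] openin_trans_full by blast
  moreover have "connectedin (subtopology (mtop M) (fst c)) V"
    using homeomorphic_map_connectedness[OF hom Vsub] im Bsub
    by (simp add: connectedin_subtopology convex_connected connectedin_iff_connected)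
  then have "connectedin (mtop M) V" by (simp add: connectedin_subtopology)
  ultimately show ?thesis using VW c r by (auto simp: V_def)
qed

section \<open>Fundamental groups and the Novikov group\<close>

lemma loop_rel_iff:
  "(g, g') \<in> loop_homotopy_rel X a \<longleftrightarrow>
    homotopic_with (\<lambda>r. r 0 = a \<and> r 1 = a) (top_of_set {0..1}) X g g'"
  by (simp add: loop_homotopy_rel_def)

text \<open>Since based loops are exactly the functions related to themselves, closure of
  \<open>based_loops\<close> under an operation follows from compatibility of that operation with
  homotopy.\<close>

lemma loop_rel_refl_iff: "(g, g) \<in> loop_homotopy_rel X a \<longleftrightarrow> g \<in> based_loops X a"
  by (simp add: loop_rel_iff based_loops_def pathin_def)

lemma equiv_loop_rel: "equiv (based_loops X a) (loop_homotopy_rel X a)"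
proof (rule equivI)
  show "loop_homotopy_rel X a \<subseteq> based_loops X a \<times> based_loops X a"
    by (auto simp: loop_rel_iff based_loops_def pathin_def
        dest: homotopic_with_imp_continuous_maps homotopic_with_imp_property)
  show "refl_on (based_loops X a) (loop_homotopy_rel X a)"
    by (simp add: refl_on_def loop_rel_refl_iff)
  show "sym (loop_homotopy_rel X a)"
    by (auto simp: sym_def loop_rel_iff intro: homotopic_with_symD)
  show "trans (loop_homotopy_rel X a)"
    by (auto simp: trans_def loop_rel_iff intro: homotopic_with_trans)
qed

text \<open>Loops are functions on all real numbers of which only the values on
  \<open>{0..1}\<close> count.\<close>

lemma loop_rel_cong:
  assumes "g \<in> based_loops X a" "\<And>t. t \<in> {0..1} \<Longrightarrow> g t = g' t"
  shows "(g, g') \<in> loop_homotopy_rel X a"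
  using assms unfolding loop_rel_iff based_loops_def pathin_def
  by (intro homotopic_with_equal) auto

lemma loop_rel_image:
  assumes "(g, g') \<in> loop_homotopy_rel X a" "continuous_map X Y F" "F a = b"
  shows "(F \<circ> g, F \<circ> g') \<in> loop_homotopy_rel Y b"
  using assms unfolding loop_rel_iff
  by (elim homotopic_with_compose_continuous_map_left) auto

lemma based_loops_image:
  "g \<in> based_loops X a \<Longrightarrow> continuous_map X Y F \<Longrightarrow> F a = b \<Longrightarrow> F \<circ> g \<in> based_loops Y b"
  using loop_rel_image[of g g] by (simp add: loop_rel_refl_iff)

text \<open>The two homotopies are pasted along loop parameter 1/2, where both take the value
  \<open>a\<close>. In \<open>J\<close> the first coordinate is the homotopy parameter, the second
  the loop parameter.\<close>

lemma loop_rel_join: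
  assumes "(f, f') \<in> loop_homotopy_rel X a" "(g, g') \<in> loop_homotopy_rel X a"
  shows "(loop_join f g, loop_join f' g') \<in> loop_homotopy_rel X a"
proof -
  let ?I = "{0..1::real}"
  obtain H where H: "continuous_map (prod_topology (top_of_set ?I) (top_of_set ?I)) X H"
      "\<And>x. H (0, x) = f x" "\<And>x. H (1, x) = f' x" "\<And>t. t \<in> ?I \<Longrightarrow> H (t, 0) = a \<and> H (t, 1) = a"
    using assms(1) unfolding loop_rel_iff homotopic_with_def by blast
  obtain K where K: "continuous_map (prod_topology (top_of_set ?I) (top_of_set ?I)) X K"
      "\<And>x. K (0, x) = g x" "\<And>x. K (1, x) = g' x" "\<And>t. t \<in> ?I \<Longrightarrow> K (t, 0) = a \<and> K (t, 1) = a"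
    using assms(2) unfolding loop_rel_iff homotopic_with_def by blast
  define J where "J = (\<lambda>z. if snd z \<le> 1/2 then H (fst z, 2 * snd z) else K (fst z, 2 * snd z - 1))"
  have HK: "continuous_map (top_of_set (?I \<times> ?I)) X H" "continuous_map (top_of_set (?I \<times> ?I)) X K"
    using H K by simp_all
  have "continuous_map (top_of_set (?I \<times> ?I)) X J"
    unfolding J_def
  proof (rule continuous_map_cases_le)
    show "continuous_map (top_of_set (?I \<times> ?I)) euclideanreal (\<lambda>z. snd z)"
      "continuous_map (top_of_set (?I \<times> ?I)) euclideanreal (\<lambda>z. 1/2)"
      by (auto intro: continuous_intros)
    have "continuous_map (top_of_set (?I \<times> {0..1/2})) (top_of_set (?I \<times> ?I)) (\<lambda>z. (fst z, 2 * snd z))"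
      by (auto simp: continuous_map_in_subtopology intro!: continuous_intros)
    then have "continuous_map (top_of_set (?I \<times> {0..1/2})) X (\<lambda>z. H (fst z, 2 * snd z))"
      by (rule continuous_map_compose[OF _ HK(1), unfolded comp_def])
    moreover have "(?I \<times> ?I) \<inter> {z \<in> topspace (top_of_set (?I \<times> ?I)). snd z \<le> 1/2} = ?I \<times> {0..1/2}"
      by auto
    ultimately show "continuous_map (subtopology (top_of_set (?I \<times> ?I)) {z \<in> topspace (top_of_set (?I \<times> ?I)). snd z \<le> 1/2}) X
      (\<lambda>z. H (fst z, 2 * snd z))"
      by (simp only: subtopology_subtopology)
    have "continuous_map (top_of_set (?I \<times> {1/2..1})) (top_of_set (?I \<times> ?I)) (\<lambda>z. (fst z, 2 * snd z - 1))"
      by (auto simp: continuous_map_in_subtopology intro!: continuous_intros)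
    then have "continuous_map (top_of_set (?I \<times> {1/2..1})) X (\<lambda>z. K (fst z, 2 * snd z - 1))"
      by (rule continuous_map_compose[OF _ HK(2), unfolded comp_def])
    moreover have "(?I \<times> ?I) \<inter> {z \<in> topspace (top_of_set (?I \<times> ?I)). 1/2 \<le> snd z} = ?I \<times> {1/2..1}"
      by auto
    ultimately show "continuous_map (subtopology (top_of_set (?I \<times> ?I)) {z \<in> topspace (top_of_set (?I \<times> ?I)). 1/2 \<le> snd z}) X
      (\<lambda>z. K (fst z, 2 * snd z - 1))"
      by (simp only: subtopology_subtopology)
    show "H (fst z, 2 * snd z) = K (fst z, 2 * snd z - 1)"
      if "z \<in> topspace (top_of_set (?I \<times> ?I))" "snd z = 1/2" for z
    proof -
      have "fst z \<in> ?I" using that(1) by auto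
      from H(4)[OF this] K(4)[OF this] show ?thesis by (simp add: that(2))
    qed
  qed
  then have "continuous_map (prod_topology (top_of_set ?I) (top_of_set ?I)) X J" by simp
  moreover have "J (0, x) = loop_join f g x" "J (1, x) = loop_join f' g' x" for x
    by (simp_all add: J_def loop_join_def H K)
  moreover have "J (t, 0) = a \<and> J (t, 1) = a" if "t \<in> ?I" for t
    using H(4)[OF that] K(4)[OF that] by (simp add: J_def)
  ultimately show ?thesis
    unfolding loop_rel_iff homotopic_with_def by blast
qed

lemma based_loops_join:
  "f \<in> based_loops X a \<Longrightarrow> g \<in> based_loops X a \<Longrightarrow> loop_join f g \<in> based_loops X a"
  using loop_rel_join[of f f X a g g] by (simp add: loop_rel_refl_iff)

text \<open>The straight-line homotopy from \<open>\<sigma>\<close> to \<open>\<tau>\<close> stays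
  in the convex interval and fixes the ends. Associativity, unit and inverse all follow by writing
  the joined loops as reparametrisations of one loop.\<close>

lemma loop_rel_reparam:
  fixes \<sigma> \<tau> :: "real \<Rightarrow> real"
  assumes g: "pathin X g" and \<sigma>: "continuous_on {0..1} \<sigma>" "\<sigma> ` {0..1} \<subseteq> {0..1}"
    and \<tau>: "continuous_on {0..1} \<tau>" "\<tau> ` {0..1} \<subseteq> {0..1}"
    and ends: "\<sigma> 0 = \<tau> 0" "\<sigma> 1 = \<tau> 1" "g (\<tau> 0) = a" "g (\<tau> 1) = a"
  shows "(g \<circ> \<sigma>, g \<circ> \<tau>) \<in> loop_homotopy_rel X a"
proof -
  let ?I = "{0..1::real}"
  let ?h = "\<lambda>z. (1 - fst z) * \<sigma> (snd z) + fst z * \<tau> (snd z)"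
  have "continuous_on (?I \<times> ?I) ?h"
    by (intro continuous_intros continuous_on_compose2[OF \<sigma>(1)] continuous_on_compose2[OF \<tau>(1)]) auto
  moreover have "?h z \<in> ?I" if "z \<in> ?I \<times> ?I" for z
  proof -
    have "\<sigma> (snd z) \<in> ?I" "\<tau> (snd z) \<in> ?I" using that \<sigma> \<tau> by auto
    then show ?thesis
      using that convexD[of ?I "\<sigma> (snd z)" "\<tau> (snd z)" "1 - fst z" "fst z"] by auto
  qed
  ultimately have "continuous_map (prod_topology (top_of_set ?I) (top_of_set ?I)) (top_of_set ?I) ?h"
    by (simp add: continuous_map_in_subtopology)
  moreover have "\<forall>x. ?h (0, x) = \<sigma> x" "\<forall>x. ?h (1, x) = \<tau> x"
    "\<forall>t\<in>?I. ?h (t, 0) = \<tau> 0 \<and> ?h (t, 1) = \<tau> 1"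
    using ends by (simp_all add: algebra_simps)
  ultimately have "homotopic_with (\<lambda>j. j 0 = \<tau> 0 \<and> j 1 = \<tau> 1) (top_of_set ?I) (top_of_set ?I) \<sigma> \<tau>"
    unfolding homotopic_with_def by (intro exI[of _ ?h]) simp
  then show ?thesis
    unfolding loop_rel_iff using g ends
    by (elim homotopic_with_compose_continuous_map_left) (auto simp: pathin_def)
qed

lemma loop_join_assoc:
  assumes "f \<in> based_loops X a" "g \<in> based_loops X a" "h \<in> based_loops X a"
  shows "(loop_join (loop_join f g) h, loop_join f (loop_join g h)) \<in> loop_homotopy_rel X a"
proof -
  let ?k = "loop_join f (loop_join g h)"
  \<comment> \<open>Piecewise linear with breaks at 1/4 and 1/2, which go to 1/2 and 3/4. The slopes
    2, 1, 1/2 decrease, so the function is the minimum of its three lines.\<close>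
  define \<sigma> :: "real \<Rightarrow> real" where "\<sigma> = (\<lambda>t. min (2 * t) (min (t + 1/4) ((t + 1) / 2)))"
  have k: "?k \<in> based_loops X a" using assms by (intro based_loops_join)
  have "loop_join (loop_join f g) h t = ?k (\<sigma> t)" for t
  proof -
    consider "t \<le> 1/4" | "1/4 < t" "t \<le> 1/2" | "1/2 < t" by linarith
    then show ?thesis
    proof cases
      case 1
      then have "\<sigma> t = 2 * t" by (simp add: \<sigma>_def min_def)
      then show ?thesis using 1 by (simp add: loop_join_def)
    next
      case 2
      then have "\<sigma> t = t + 1/4" by (simp add: \<sigma>_def min_def)
      then show ?thesis using 2 by (simp add: loop_join_def algebra_simps)
    next
      case 3
      then have "\<sigma> t = (t + 1) / 2" by (simp add: \<sigma>_def min_def)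
      then show ?thesis using 3 by (simp add: loop_join_def algebra_simps)
    qed
  qed
  then have eq: "loop_join (loop_join f g) h = ?k \<circ> \<sigma>" by auto
  have "(?k \<circ> \<sigma>, ?k \<circ> id) \<in> loop_homotopy_rel X a"
  proof (rule loop_rel_reparam)
    show "continuous_on {0..1} \<sigma>" unfolding \<sigma>_def by (intro continuous_intros) auto
    show "\<sigma> ` {0..1} \<subseteq> {0..1}" by (auto simp: \<sigma>_def min_def)
    show "\<sigma> 0 = id 0" "\<sigma> 1 = id 1" by (auto simp: \<sigma>_def min_def)
  qed (use k in \<open>auto simp: based_loops_def\<close>)
  then show ?thesis by (simp add: eq)
qed

lemma loop_join_const:
  assumes "g \<in> based_loops X a"
  shows "(loop_join (\<lambda>t. a) g, g) \<in> loop_homotopy_rel X a"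
proof -
  \<comment> \<open>The reparametrisation waits at 0 during the first half of the interval.\<close>
  have "loop_join (\<lambda>t. a) g = g \<circ> (\<lambda>t. max 0 (2 * t - 1))"
  proof
    show "loop_join (\<lambda>t. a) g t = (g \<circ> (\<lambda>t. max 0 (2 * t - 1))) t" for t
      using assms by (cases "t \<le> 1/2") (simp_all add: loop_join_def based_loops_def max_absorb1 max_absorb2)
  qed
  moreover have "(g \<circ> (\<lambda>t. max 0 (2 * t - 1)), g \<circ> id) \<in> loop_homotopy_rel X a"
    using assms by (intro loop_rel_reparam) (auto simp: based_loops_def intro!: continuous_intros)
  ultimately show ?thesis by simp
qed

lemma loop_join_reverse:
  assumes "g \<in> based_loops X a"
  shows "(loop_join (\<lambda>t. g (1 - t)) g, \<lambda>t. a) \<in> loop_homotopy_rel X a"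
proof -
  \<comment> \<open>The path \<open>\<bar>2 * t - 1\<bar>\<close> runs from 1 down to 0 and back to
    1, so it can be contracted to the constant 1 with ends fixed.\<close>
  have "loop_join (\<lambda>t. g (1 - t)) g = g \<circ> (\<lambda>t. \<bar>2 * t - 1\<bar>)"
  proof
    show "loop_join (\<lambda>t. g (1 - t)) g t = (g \<circ> (\<lambda>t. \<bar>2 * t - 1\<bar>)) t" for t
      by (cases "t \<le> 1/2") (simp_all add: loop_join_def abs_of_nonneg abs_of_nonpos)
  qed
  moreover have "(g \<circ> (\<lambda>t. \<bar>2 * t - 1\<bar>), g \<circ> (\<lambda>t. 1)) \<in> loop_homotopy_rel X a"
    using assms by (intro loop_rel_reparam) (auto simp: based_loops_def intro!: continuous_intros)
  moreover have "g \<circ> (\<lambda>t::real. 1) = (\<lambda>t. a)" using assms by (auto simp: based_loops_def)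
  ultimately show ?thesis by (simp only:)
qed

lemma based_loops_reverse:
  assumes "g \<in> based_loops X a" shows "(\<lambda>t. g (1 - t)) \<in> based_loops X a"
proof -
  have "continuous_map (top_of_set {0..1}) (top_of_set {0..1::real}) (\<lambda>t. 1 - t)"
    by (auto simp: continuous_map_in_subtopology intro!: continuous_intros)
  moreover have "continuous_map (top_of_set {0..1}) X g" using assms by (simp add: based_loops_def pathin_def)
  ultimately have "continuous_map (top_of_set {0..1}) X (\<lambda>t. g (1 - t))"
    by (rule continuous_map_compose[unfolded comp_def])
  then show ?thesis using assms by (simp add: based_loops_def pathin_def)
qed

lemma based_loops_const: "a \<in> topspace X \<Longrightarrow> (\<lambda>t. a) \<in> based_loops X a"
  by (simp add: based_loops_def pathin_def)

section \<open>The fundamental group and its functoriality\<close>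

definition loop_class :: "'a topology \<Rightarrow> 'a \<Rightarrow> (real \<Rightarrow> 'a) \<Rightarrow> (real \<Rightarrow> 'a) set" where
  "loop_class X a g = loop_homotopy_rel X a `` {g}"

lemma loop_class_eqI: "(g, g') \<in> loop_homotopy_rel X a \<Longrightarrow> loop_class X a g = loop_class X a g'"
  unfolding loop_class_def by (rule equiv_class_eq[OF equiv_loop_rel])

lemma carrier_pi1: "carrier (pi1 X a) = loop_class X a ` based_loops X a"
  by (auto simp: pi1_def quotient_def loop_class_def)

lemma one_pi1: "\<one>\<^bsub>pi1 X a\<^esub> = loop_class X a (\<lambda>t. a)"
  by (simp add: pi1_def loop_class_def)

text \<open>Products and induced maps are defined by saturating a set of representatives. Once the
  representatives are mutually homotopic, the saturation is a single class and may be computed from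
  any one of them.\<close>

lemma Image_eq_loop_class:
  assumes "g \<in> S" "\<And>g'. g' \<in> S \<Longrightarrow> (g, g') \<in> loop_homotopy_rel X a"
  shows "loop_homotopy_rel X a `` S = loop_class X a g"
proof -
  have "loop_homotopy_rel X a `` {g'} = loop_class X a g" if "g' \<in> S" for g'
    using loop_class_eqI[OF assms(2)[OF that]] by (simp add: loop_class_def)
  then show ?thesis using assms(1) by (auto simp: Image_def)
qed

lemma mult_pi1:
  assumes "g \<in> based_loops X a" "g' \<in> based_loops X a"
  shows "loop_class X a g \<otimes>\<^bsub>pi1 X a\<^esub> loop_class X a g' = loop_class X a (loop_join g g')"
proof -
  have "loop_homotopy_rel X a `` {loop_join k k' | k k'. k \<in> loop_class X a g \<and> k' \<in> loop_class X a g'} =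
    loop_class X a (loop_join g g')"
  proof (rule Image_eq_loop_class)
    have "g \<in> loop_class X a g" "g' \<in> loop_class X a g'"
      using assms by (simp_all add: loop_class_def loop_rel_refl_iff)
    then show "loop_join g g' \<in> {loop_join k k' | k k'. k \<in> loop_class X a g \<and> k' \<in> loop_class X a g'}"
      by blast
  qed (auto simp: loop_class_def intro: loop_rel_join)
  then show ?thesis by (simp add: pi1_def)
qed

lemma group_pi1:
  assumes "a \<in> topspace X"
  shows "group (pi1 X a)"
proof (rule groupI)
  show "\<one>\<^bsub>pi1 X a\<^esub> \<in> carrier (pi1 X a)"
    using based_loops_const[OF assms] by (auto simp: carrier_pi1 one_pi1)
next
  fix x y assume "x \<in> carrier (pi1 X a)" "y \<in> carrier (pi1 X a)"
  then show "x \<otimes>\<^bsub>pi1 X a\<^esub> y \<in> carrier (pi1 X a)"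
    by (auto simp: carrier_pi1 mult_pi1 based_loops_join)
next
  fix x y z assume "x \<in> carrier (pi1 X a)" "y \<in> carrier (pi1 X a)" "z \<in> carrier (pi1 X a)"
  then obtain f g h where "x = loop_class X a f" "y = loop_class X a g" "z = loop_class X a h"
    "f \<in> based_loops X a" "g \<in> based_loops X a" "h \<in> based_loops X a" by (auto simp: carrier_pi1)
  then show "x \<otimes>\<^bsub>pi1 X a\<^esub> y \<otimes>\<^bsub>pi1 X a\<^esub> z = x \<otimes>\<^bsub>pi1 X a\<^esub> (y \<otimes>\<^bsub>pi1 X a\<^esub> z)"
    using loop_class_eqI[OF loop_join_assoc[of f X a g h]] by (simp add: mult_pi1 based_loops_join)
next
  fix x assume "x \<in> carrier (pi1 X a)"
  then obtain g where "x = loop_class X a g" "g \<in> based_loops X a" by (auto simp: carrier_pi1)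
  then show "\<one>\<^bsub>pi1 X a\<^esub> \<otimes>\<^bsub>pi1 X a\<^esub> x = x"
    using based_loops_const[OF assms] loop_class_eqI[OF loop_join_const[of g X a]]
    by (simp add: one_pi1 mult_pi1)
next
  fix x assume "x \<in> carrier (pi1 X a)"
  then obtain g where g: "x = loop_class X a g" "g \<in> based_loops X a" by (auto simp: carrier_pi1)
  then have "loop_class X a (\<lambda>t. g (1 - t)) \<otimes>\<^bsub>pi1 X a\<^esub> x = \<one>\<^bsub>pi1 X a\<^esub>"
    using loop_class_eqI[OF loop_join_reverse[of g X a]] by (simp add: one_pi1 mult_pi1 based_loops_reverse)
  then show "\<exists>y\<in>carrier (pi1 X a). y \<otimes>\<^bsub>pi1 X a\<^esub> x = \<one>\<^bsub>pi1 X a\<^esub>"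
    using based_loops_reverse[OF g(2)] by (auto simp: carrier_pi1)
qed

lemma pi1_map_class:
  assumes "continuous_map X Y F" "F a = b" "g \<in> based_loops X a"
  shows "pi1_map Y b F (loop_class X a g) = loop_class Y b (F \<circ> g)"
  unfolding pi1_map_def
proof (rule Image_eq_loop_class)
  show "F \<circ> g \<in> (\<lambda>g. F \<circ> g) ` loop_class X a g"
    using assms(3) by (simp add: loop_class_def loop_rel_refl_iff)
qed (use loop_rel_image[OF _ assms(1,2)] in \<open>auto simp: loop_class_def\<close>)

lemma pi1_map_hom:
  assumes F: "continuous_map X Y F" "F a = b"
  shows "pi1_map Y b F \<in> hom (pi1 X a) (pi1 Y b)"
proof (rule homI)
  fix x assume "x \<in> carrier (pi1 X a)"
  then show "pi1_map Y b F x \<in> carrier (pi1 Y b)"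
    unfolding carrier_pi1 using pi1_map_class[OF F] based_loops_image[OF _ F] by blast
next
  fix x y assume "x \<in> carrier (pi1 X a)" "y \<in> carrier (pi1 X a)"
  then obtain g g' where g: "x = loop_class X a g" "g \<in> based_loops X a" "y = loop_class X a g'" "g' \<in> based_loops X a"
    by (auto simp: carrier_pi1)
  have "F \<circ> loop_join g g' = loop_join (F \<circ> g) (F \<circ> g')" by (auto simp: loop_join_def)
  then show "pi1_map Y b F (x \<otimes>\<^bsub>pi1 X a\<^esub> y) = pi1_map Y b F x \<otimes>\<^bsub>pi1 Y b\<^esub> pi1_map Y b F y"
    using g F by (simp add: mult_pi1 pi1_map_class[OF F] based_loops_join based_loops_image)
qed

lemma pi1_map_compose:
  assumes F: "continuous_map X Y F" "F a = b" and G: "continuous_map Y Z G" "G b = c"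
    and x: "x \<in> carrier (pi1 X a)"
  shows "pi1_map Z c G (pi1_map Y b F x) = pi1_map Z c (G \<circ> F) x"
proof -
  obtain g where g: "x = loop_class X a g" "g \<in> based_loops X a" using x by (auto simp: carrier_pi1)
  have GF: "continuous_map X Z (G \<circ> F)" "(G \<circ> F) a = c"
    using F G by (auto intro: continuous_map_compose)
  show ?thesis
    unfolding g(1) pi1_map_class[OF F g(2)] pi1_map_class[OF GF g(2)]
      pi1_map_class[OF G based_loops_image[OF g(2) F]] by (simp only: comp_assoc)
qed

lemma pi1_map_cong:
  assumes F: "continuous_map X Y F" "F a = b" and FF': "\<And>x. x \<in> topspace X \<Longrightarrow> F x = F' x"
    and a: "a \<in> topspace X" and x: "x \<in> carrier (pi1 X a)"
  shows "pi1_map Y b F x = pi1_map Y b F' x"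
proof -
  obtain g where g: "x = loop_class X a g" "g \<in> based_loops X a" using x by (auto simp: carrier_pi1)
  have F': "continuous_map X Y F'" "F' a = b" using F FF' a by (auto intro: continuous_map_eq)
  have "(F \<circ> g, F' \<circ> g) \<in> loop_homotopy_rel Y b"
    using g FF' by (intro loop_rel_cong based_loops_image[OF _ F])
      (auto simp: based_loops_def pathin_def continuous_map_def Pi_iff)
  then show ?thesis
    using g by (simp add: pi1_map_class[OF F] pi1_map_class[OF F'] loop_class_eqI)
qed

section \<open>Quotients by collapsed sublevels\<close>

text \<open>Preimages commute with intersections and unions, so the defining predicate is a
  topology; this is what makes \<open>topology\<close> return it.\<close>

lemma openin_collapse_space:
  "openin (collapse_space X A) U \<longleftrightarrow>
    U \<subseteq> insert None (collapse A ` topspace X) \<and> openin X {x \<in> topspace X. collapse A x \<in> U}"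
proof -
  let ?P = "\<lambda>U. U \<subseteq> insert None (collapse A ` topspace X) \<and> openin X {x \<in> topspace X. collapse A x \<in> U}"
  have "istopology ?P"
    unfolding istopology_def
  proof (intro conjI allI impI)
    fix S T assume S: "?P S" and T: "?P T"
    then show "S \<inter> T \<subseteq> insert None (collapse A ` topspace X)" by blast
    have "{x \<in> topspace X. collapse A x \<in> S \<inter> T} =
      {x \<in> topspace X. collapse A x \<in> S} \<inter> {x \<in> topspace X. collapse A x \<in> T}" by blast
    then show "openin X {x \<in> topspace X. collapse A x \<in> S \<inter> T}"
      using S T by (simp add: openin_Int)
  next
    fix K assume K: "\<forall>U\<in>K. ?P U"
    then show "\<Union>K \<subseteq> insert None (collapse A ` topspace X)" by blast
    have "{x \<in> topspace X. collapse A x \<in> \<Union>K} = \<Union>((\<lambda>U. {x \<in> topspace X. collapse A x \<in> U}) ` K)" by blast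
    moreover have "openin X (\<Union>((\<lambda>U. {x \<in> topspace X. collapse A x \<in> U}) ` K))"
      using K by (intro openin_Union) blast
    ultimately show "openin X {x \<in> topspace X. collapse A x \<in> \<Union>K}" by simp
  qed
  then show ?thesis by (simp add: collapse_space_def topology_inverse')
qed

lemma topspace_collapse_space: "topspace (collapse_space X A) = insert None (collapse A ` topspace X)"
proof
  show "topspace (collapse_space X A) \<subseteq> insert None (collapse A ` topspace X)"
    using openin_topspace[of "collapse_space X A"] by (simp only: openin_collapse_space)
  have "{x \<in> topspace X. collapse A x \<in> insert None (collapse A ` topspace X)} = topspace X" by blast
  then have "openin (collapse_space X A) (insert None (collapse A ` topspace X))"
    unfolding openin_collapse_space by simp
  then show "insert None (collapse A ` topspace X) \<subseteq> topspace (collapse_space X A)"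
    by (rule openin_subset)
qed

lemma None_in_collapse_space: "None \<in> topspace (collapse_space X A)"
  by (simp add: topspace_collapse_space)

lemma collapse_map_None [simp]: "collapse_map B F None = None"
  by (simp add: collapse_map_def)

lemma collapse_map_collapse: "F ` A \<subseteq> B \<Longrightarrow> collapse_map B F (collapse A x) = collapse B (F x)"
  by (auto simp: collapse_map_def collapse_def)

lemma collapse_map_compose: "G ` B \<subseteq> C \<Longrightarrow> collapse_map C G (collapse_map B F z) = collapse_map C (G \<circ> F) z"
  by (auto simp: collapse_map_def collapse_def split: option.splits)

text \<open>The quotient topology tests openness upstairs: on \<open>X\<close>, the preimage of an
  open set under the induced map is the preimage under \<open>F\<close> of an open subset of
  \<open>Y\<close>.\<close>

lemma continuous_collapse_map:
  assumes F: "continuous_map X Y F" and AB: "F ` A \<subseteq> B"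
  shows "continuous_map (collapse_space X A) (collapse_space Y B) (collapse_map B F)"
proof -
  have FY: "F x \<in> topspace Y" if "x \<in> topspace X" for x
    using F that by (auto simp: continuous_map_def)
  have in_top: "collapse_map B F z \<in> topspace (collapse_space Y B)" if "z \<in> topspace (collapse_space X A)" for z
    using that FY by (auto simp: topspace_collapse_space collapse_map_collapse[OF AB])
  have "openin (collapse_space X A) {z \<in> topspace (collapse_space X A). collapse_map B F z \<in> U}"
    if U: "openin (collapse_space Y B) U" for U
  proof -
    have "openin X {x \<in> topspace X. F x \<in> {y \<in> topspace Y. collapse B y \<in> U}}"
      using U by (intro openin_continuous_map_preimage[OF F]) (simp add: openin_collapse_space)
    moreover have "{x \<in> topspace X. F x \<in> {y \<in> topspace Y. collapse B y \<in> U}} =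
      {x \<in> topspace X. collapse A x \<in> {z \<in> topspace (collapse_space X A). collapse_map B F z \<in> U}}"
      using FY by (auto simp: topspace_collapse_space collapse_map_collapse[OF AB])
    ultimately show ?thesis
      by (auto simp: openin_collapse_space topspace_collapse_space)
  qed
  then show ?thesis using in_top by (auto simp: continuous_map_def)
qed

lemma sublevel_id_subset:
  "(\<And>x. x \<in> topspace X \<Longrightarrow> f x \<le> h \<Longrightarrow> g x \<le> k) \<Longrightarrow> id ` sublevel X f h \<subseteq> sublevel X g k"
  by (auto simp: sublevel_def)

lemma sublevel_comp_subset:
  "continuous_map X Y F \<Longrightarrow> F ` sublevel X (f \<circ> F) h \<subseteq> sublevel Y f h"
  by (auto simp: sublevel_def continuous_map_def)

lemma group_level_pi1: "group (level_pi1 X f h)"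
  by (rule group_pi1) (rule None_in_collapse_space)

lemma level_map_hom:
  "continuous_map X Y F \<Longrightarrow> F ` sublevel X f h \<subseteq> sublevel Y g k \<Longrightarrow>
    level_map Y g k F \<in> hom (level_pi1 X f h) (level_pi1 Y g k)"
  by (intro pi1_map_hom continuous_collapse_map) auto

lemma level_map_compose:
  assumes F: "continuous_map X Y F" "F ` sublevel X f h \<subseteq> sublevel Y g k"
    and G: "continuous_map Y Z G" "G ` sublevel Y g k \<subseteq> sublevel Z e l"
    and x: "x \<in> carrier (level_pi1 X f h)"
  shows "level_map Z e l G (level_map Y g k F x) = level_map Z e l (G \<circ> F) x"
proof -
  have "collapse_map (sublevel Z e l) G \<circ> collapse_map (sublevel Y g k) F = collapse_map (sublevel Z e l) (G \<circ> F)"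
    by (rule ext) (simp add: collapse_map_compose[OF G(2), of F])
  then show ?thesis
    using pi1_map_compose[OF continuous_collapse_map[OF F] _ continuous_collapse_map[OF G] _ x] by simp
qed

lemma level_map_cong:
  assumes F: "continuous_map X Y F" "F ` sublevel X f h \<subseteq> sublevel Y g k"
    and FF': "\<And>x. x \<in> topspace X \<Longrightarrow> F x = F' x"
    and x: "x \<in> carrier (level_pi1 X f h)"
  shows "level_map Y g k F x = level_map Y g k F' x"
  using FF'
  by (intro pi1_map_cong[OF continuous_collapse_map[OF F] _ _ None_in_collapse_space x])
    (auto simp: topspace_collapse_space collapse_def collapse_map_def)

section \<open>Groups defined as limits\<close>

text \<open>The limit over levels and the limit over primitives are both cut out of a product by
  equations between homomorphisms. Listing the equations as triples admits several homomorphisms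
  between the same two factors, as happens for different bounds \<open>K\<close>.\<close>

lemma equalizer_subgroup:
  assumes G: "\<And>i. i \<in> I \<Longrightarrow> group (G i)"
    and S: "\<And>i j \<phi>. (i, j, \<phi>) \<in> S \<Longrightarrow> i \<in> I \<and> j \<in> I \<and> \<phi> \<in> hom (G i) (G j)"
  shows "subgroup {x \<in> (\<Pi>\<^sub>E i\<in>I. carrier (G i)). \<forall>(i, j, \<phi>)\<in>S. \<phi> (x i) = x j} (product_group I G)"
proof -
  interpret P: group "product_group I G" using G by simp
  have gh: "group_hom (G i) (G j) \<phi>" if "(i, j, \<phi>) \<in> S" for i j \<phi>
    using S[OF that] G by (simp add: group_hom_def group_hom_axioms_def)
  show ?thesis
  proof (rule P.subgroupI)
    have "\<phi> (\<one>\<^bsub>product_group I G\<^esub> i) = \<one>\<^bsub>product_group I G\<^esub> j" if s: "(i, j, \<phi>) \<in> S" for i j \<phi>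
      using S[OF s] group_hom.hom_one[OF gh[OF s]] by simp
    moreover have "\<one>\<^bsub>product_group I G\<^esub> \<in> carrier (product_group I G)" by (rule P.one_closed)
    ultimately have "\<one>\<^bsub>product_group I G\<^esub> \<in> {x \<in> (\<Pi>\<^sub>E i\<in>I. carrier (G i)). \<forall>(i, j, \<phi>)\<in>S. \<phi> (x i) = x j}"
      by auto
    then show "{x \<in> (\<Pi>\<^sub>E i\<in>I. carrier (G i)). \<forall>(i, j, \<phi>)\<in>S. \<phi> (x i) = x j} \<noteq> {}" by blast
  next
    fix x assume x: "x \<in> {x \<in> (\<Pi>\<^sub>E i\<in>I. carrier (G i)). \<forall>(i, j, \<phi>)\<in>S. \<phi> (x i) = x j}"
    have "\<phi> ((inv\<^bsub>product_group I G\<^esub> x) i) = (inv\<^bsub>product_group I G\<^esub> x) j" if s: "(i, j, \<phi>) \<in> S" for i j \<phi>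
    proof -
      have "\<phi> (x i) = x j" "i \<in> I" "j \<in> I" "x i \<in> carrier (G i)" using x s S[OF s] by auto
      then show ?thesis
        using x G group_hom.hom_inv[OF gh[OF s], of "x i"] by simp
    qed
    moreover have "inv\<^bsub>product_group I G\<^esub> x \<in> carrier (product_group I G)"
      using x by (intro P.inv_closed) simp
    ultimately show "inv\<^bsub>product_group I G\<^esub> x \<in> {x \<in> (\<Pi>\<^sub>E i\<in>I. carrier (G i)). \<forall>(i, j, \<phi>)\<in>S. \<phi> (x i) = x j}"
      by auto
  next
    fix x y
    assume x: "x \<in> {x \<in> (\<Pi>\<^sub>E i\<in>I. carrier (G i)). \<forall>(i, j, \<phi>)\<in>S. \<phi> (x i) = x j}"
      and y: "y \<in> {x \<in> (\<Pi>\<^sub>E i\<in>I. carrier (G i)). \<forall>(i, j, \<phi>)\<in>S. \<phi> (x i) = x j}"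
    have "\<phi> ((x \<otimes>\<^bsub>product_group I G\<^esub> y) i) = (x \<otimes>\<^bsub>product_group I G\<^esub> y) j" if s: "(i, j, \<phi>) \<in> S" for i j \<phi>
    proof -
      have "\<phi> (x i) = x j" "\<phi> (y i) = y j" "i \<in> I" "j \<in> I" "x i \<in> carrier (G i)" "y i \<in> carrier (G i)"
        using x y s S[OF s] by auto
      then show ?thesis
        using group_hom.hom_mult[OF gh[OF s], of "x i" "y i"] by simp
    qed
    moreover have "x \<otimes>\<^bsub>product_group I G\<^esub> y \<in> carrier (product_group I G)"
      using x y by (intro P.m_closed) simp_all
    ultimately show "x \<otimes>\<^bsub>product_group I G\<^esub> y \<in> {x \<in> (\<Pi>\<^sub>E i\<in>I. carrier (G i)). \<forall>(i, j, \<phi>)\<in>S. \<phi> (x i) = x j}"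
      by auto
  qed auto
qed

lemma carrier_pi1_limit:
  "x \<in> carrier (pi1_limit X f) \<longleftrightarrow> (\<forall>h. x h \<in> carrier (level_pi1 X f h)) \<and>
    (\<forall>h h'. h < h' \<longrightarrow> level_map X f h' id (x h) = x h')"
  by (auto simp: pi1_limit_def)

lemma mult_pi1_limit: "(x \<otimes>\<^bsub>pi1_limit X f\<^esub> y) h = x h \<otimes>\<^bsub>level_pi1 X f h\<^esub> y h"
  by (simp add: pi1_limit_def)

lemma level_map_id_hom:
  assumes "\<And>x. x \<in> topspace X \<Longrightarrow> f x \<le> h \<Longrightarrow> g x \<le> k"
  shows "level_map X g k id \<in> hom (level_pi1 X f h) (level_pi1 X g k)"
  using assms by (intro level_map_hom sublevel_id_subset continuous_map_id)

lemma group_pi1_limit: "group (pi1_limit X f)"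
proof -
  define S where "S = {(h, h', level_map X f h' id) | h h'. h < h'}"
  let ?H = "{x \<in> (\<Pi>\<^sub>E h\<in>UNIV. carrier (level_pi1 X f h)). \<forall>(h, h', \<phi>)\<in>S. \<phi> (x h) = x h'}"
  have "subgroup ?H (product_group UNIV (level_pi1 X f))"
    by (rule equalizer_subgroup) (auto simp: group_level_pi1 S_def intro!: level_map_id_hom)
  then have "group (product_group UNIV (level_pi1 X f) \<lparr>carrier := ?H\<rparr>)"
    by (intro subgroup.subgroup_is_group product_group group_level_pi1)
  moreover have "?H = {x \<in> (\<Pi>\<^sub>E h\<in>UNIV. carrier (level_pi1 X f h)).
      \<forall>h h'. h < h' \<longrightarrow> level_map X f h' id (x h) = x h'}"
    by (auto simp: S_def)
  ultimately show ?thesis by (simp add: pi1_limit_def)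
qed

text \<open>A structure map, induced by \<open>id\<close> and an inclusion of sublevels, is absorbed
  after a level map; \<open>level_map_compose_id\<close> absorbs it before. Together they reduce
  compatibility checks to a single map induced by \<open>F\<close>.\<close>

lemma level_map_id_compose:
  assumes F: "continuous_map X Y F" "F ` sublevel X f h \<subseteq> sublevel Y g k"
    and gk: "\<And>y. y \<in> topspace Y \<Longrightarrow> g y \<le> k \<Longrightarrow> e y \<le> l"
    and x: "x \<in> carrier (level_pi1 X f h)"
  shows "level_map Y e l id (level_map Y g k F x) = level_map Y e l F x"
  using level_map_compose[OF F continuous_map_id sublevel_id_subset[OF gk] x] by simp

lemma level_map_compose_id:
  assumes F: "continuous_map X Y F" "F ` sublevel X e l \<subseteq> sublevel Y g k"
    and fh: "\<And>x. x \<in> topspace X \<Longrightarrow> f x \<le> h \<Longrightarrow> e x \<le> l"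
    and x: "x \<in> carrier (level_pi1 X f h)"
  shows "level_map Y g k F (level_map X e l id x) = level_map Y g k F x"
  using level_map_compose[OF continuous_map_id sublevel_id_subset[OF fh] F x] by simp

text \<open>The bound puts the set where \<open>f\<close> is at most \<open>h - K\<close> inside the
  set where \<open>g\<close> is at most \<open>h\<close>. For \<open>h < h'\<close>, both routes
  from level \<open>h - K\<close> of \<open>f\<close> to level \<open>h'\<close> of \<open>g\<close>
  are induced by \<open>id\<close>, so the shifted family is again compatible.\<close>

lemma shift_map_hom:
  assumes K: "\<And>x. x \<in> topspace X \<Longrightarrow> \<bar>f x - g x\<bar> \<le> K"
  shows "shift_map X g K \<in> hom (pi1_limit X f) (pi1_limit X g)"
proof (rule homI)
  have le: "g x \<le> h" if "x \<in> topspace X" "f x \<le> h - K" for x h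
    using K[OF that(1)] that(2) by linarith
  fix x assume x: "x \<in> carrier (pi1_limit X f)"
  then have xh: "x h \<in> carrier (level_pi1 X f h)" for h by (simp add: carrier_pi1_limit)
  have "level_map X g h id (x (h - K)) \<in> carrier (level_pi1 X g h)" for h
    using level_map_id_hom[of X f "h - K" g h] le xh by (simp add: hom_in_carrier)
  moreover have "level_map X g h' id (level_map X g h id (x (h - K))) = level_map X g h' id (x (h' - K))"
    if "h < h'" for h h'
  proof -
    have "level_map X g h' id (level_map X g h id (x (h - K))) = level_map X g h' id (x (h - K))"
      using that le by (intro level_map_id_compose[OF continuous_map_id _ _ xh] sublevel_id_subset) auto
    also have "\<dots> = level_map X g h' id (level_map X f (h' - K) id (x (h - K)))"
      using that le by (intro level_map_id_compose[OF continuous_map_id _ _ xh, symmetric] sublevel_id_subset) auto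
    also have "level_map X f (h' - K) id (x (h - K)) = x (h' - K)"
      using x that by (simp add: carrier_pi1_limit)
    finally show ?thesis .
  qed
  ultimately show "shift_map X g K x \<in> carrier (pi1_limit X g)"
    by (simp add: carrier_pi1_limit shift_map_def)
  fix y assume y: "y \<in> carrier (pi1_limit X f)"
  then have yh: "y h \<in> carrier (level_pi1 X f h)" for h by (simp add: carrier_pi1_limit)
  show "shift_map X g K (x \<otimes>\<^bsub>pi1_limit X f\<^esub> y) = shift_map X g K x \<otimes>\<^bsub>pi1_limit X g\<^esub> shift_map X g K y"
  proof
    fix h
    show "shift_map X g K (x \<otimes>\<^bsub>pi1_limit X f\<^esub> y) h = (shift_map X g K x \<otimes>\<^bsub>pi1_limit X g\<^esub> shift_map X g K y) h"
      unfolding shift_map_def mult_pi1_limit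
      by (rule hom_mult[OF level_map_id_hom xh yh]) (rule le)
  qed
qed

lemma carrier_novikov_group:
  "x \<in> carrier (novikov_group M u X p) \<longleftrightarrow>
    x \<in> extensional (primitives M u X p) \<and>
    (\<forall>f\<in>primitives M u X p. x f \<in> carrier (pi1_limit X f)) \<and>
    (\<forall>f\<in>primitives M u X p. \<forall>g\<in>primitives M u X p. \<forall>K.
            (\<forall>y\<in>topspace X. \<bar>f y - g y\<bar> \<le> K) \<longrightarrow> shift_map X g K (x f) = x g)"
  by (auto simp: novikov_group_def PiE_iff)

lemma mult_novikov_group:
  "x \<otimes>\<^bsub>novikov_group M u X p\<^esub> y = (\<lambda>f\<in>primitives M u X p. x f \<otimes>\<^bsub>pi1_limit X f\<^esub> y f)"
  by (simp add: novikov_group_def)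

lemma group_novikov_group: "group (novikov_group M u X p)"
proof -
  let ?I = "primitives M u X p"
  define S where "S = {(f, g, shift_map X g K) | f g K. f \<in> ?I \<and> g \<in> ?I \<and> (\<forall>y\<in>topspace X. \<bar>f y - g y\<bar> \<le> K)}"
  let ?H = "{x \<in> (\<Pi>\<^sub>E f\<in>?I. carrier (pi1_limit X f)). \<forall>(f, g, \<phi>)\<in>S. \<phi> (x f) = x g}"
  have "subgroup ?H (product_group ?I (pi1_limit X))"
    by (rule equalizer_subgroup) (auto simp: group_pi1_limit S_def intro!: shift_map_hom)
  then have "group (product_group ?I (pi1_limit X) \<lparr>carrier := ?H\<rparr>)"
    by (intro subgroup.subgroup_is_group product_group group_pi1_limit)
  moreover have "?H = {x \<in> (\<Pi>\<^sub>E f\<in>?I. carrier (pi1_limit X f)). \<forall>f\<in>?I. \<forall>g\<in>?I. \<forall>K.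
      (\<forall>y\<in>topspace X. \<bar>f y - g y\<bar> \<le> K) \<longrightarrow> shift_map X g K (x f) = x g}"
    unfolding S_def by blast
  ultimately show ?thesis by (simp add: novikov_group_def)
qed

section \<open>Functoriality of the Novikov group\<close>

text \<open>The component at \<open>f\<close> is read from the component of \<open>x\<close> at
  \<open>f \<circ> F\<close>, which \<open>prim\<close> makes meaningful. Changing the level, or
  passing from \<open>f\<close> to \<open>g\<close>, commutes with the level maps of
  \<open>F\<close>, because either way the map is induced by \<open>F\<close> on points.\<close>

lemma novikov_map_hom:
  assumes F: "continuous_map X Y F"
    and prim: "\<And>f. f \<in> primitives M u Y p \<Longrightarrow> f \<circ> F \<in> primitives N v X q"
  shows "novikov_map M u Y p F \<in> hom (novikov_group N v X q) (novikov_group M u Y p)"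
proof (rule homI)
  note sub = sublevel_comp_subset[OF F]
  have FY: "F x \<in> topspace Y" if "x \<in> topspace X" for x using F that by (auto simp: continuous_map_def)
  have sub_le: "F ` sublevel X (f \<circ> F) h \<subseteq> sublevel Y g k"
    if "\<And>y. y \<in> topspace Y \<Longrightarrow> f y \<le> h \<Longrightarrow> g y \<le> k" for f g :: "_ \<Rightarrow> real" and h k
    using that FY by (auto simp: sublevel_def)
  fix x assume x: "x \<in> carrier (novikov_group N v X q)"
  have xh: "x (f \<circ> F) h \<in> carrier (level_pi1 X (f \<circ> F) h)" if "f \<in> primitives M u Y p" for f h
    using x prim[OF that] by (auto simp: carrier_novikov_group carrier_pi1_limit)
  have "(\<lambda>h. level_map Y f h F (x (f \<circ> F) h)) \<in> carrier (pi1_limit Y f)" if f: "f \<in> primitives M u Y p" for f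
    unfolding carrier_pi1_limit
  proof (intro conjI allI impI)
    show "level_map Y f h F (x (f \<circ> F) h) \<in> carrier (level_pi1 Y f h)" for h
      using level_map_hom[OF F sub] xh[OF f] by (rule hom_in_carrier)
    fix h h' :: real assume h: "h < h'"
    have "level_map Y f h' id (level_map Y f h F (x (f \<circ> F) h)) = level_map Y f h' F (x (f \<circ> F) h)"
      using h by (intro level_map_id_compose[OF F sub _ xh[OF f]]) auto
    also have "\<dots> = level_map Y f h' F (level_map X (f \<circ> F) h' id (x (f \<circ> F) h))"
      using h by (intro level_map_compose_id[OF F sub _ xh[OF f], symmetric]) auto
    also have "level_map X (f \<circ> F) h' id (x (f \<circ> F) h) = x (f \<circ> F) h'"
      using x prim[OF f] h by (auto simp: carrier_novikov_group carrier_pi1_limit)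
    finally show "level_map Y f h' id (level_map Y f h F (x (f \<circ> F) h)) = level_map Y f h' F (x (f \<circ> F) h')" .
  qed
  moreover have "shift_map Y g K (\<lambda>h. level_map Y f h F (x (f \<circ> F) h)) = (\<lambda>h. level_map Y g h F (x (g \<circ> F) h))"
    if f: "f \<in> primitives M u Y p" and g: "g \<in> primitives M u Y p" and K: "\<And>y. y \<in> topspace Y \<Longrightarrow> \<bar>f y - g y\<bar> \<le> K"
    for f g K
  proof
    fix h
    have le: "g y \<le> h" if "y \<in> topspace Y" "f y \<le> h - K" for y
      using K[OF that(1)] that(2) by linarith
    have "shift_map Y g K (\<lambda>h. level_map Y f h F (x (f \<circ> F) h)) h =
      level_map Y g h id (level_map Y f (h - K) F (x (f \<circ> F) (h - K)))" by (simp add: shift_map_def)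
    also have "\<dots> = level_map Y g h F (x (f \<circ> F) (h - K))"
      using le by (intro level_map_id_compose[OF F sub _ xh[OF f]])
    also have "\<dots> = level_map Y g h F (level_map X (g \<circ> F) h id (x (f \<circ> F) (h - K)))"
      using le FY by (intro level_map_compose_id[OF F sub _ xh[OF f], symmetric]) auto
    also have "level_map X (g \<circ> F) h id (x (f \<circ> F) (h - K)) = shift_map X (g \<circ> F) K (x (f \<circ> F)) h"
      by (simp add: shift_map_def)
    \<comment> \<open>A bound on \<open>Y\<close> for the distance of \<open>f\<close> and
      \<open>g\<close> is also one on \<open>X\<close> for \<open>f \<circ> F\<close> and
      \<open>g \<circ> F\<close>, so the compatibility of \<open>x\<close> applies with the same
      \<open>K\<close>.\<close>
    also have "shift_map X (g \<circ> F) K (x (f \<circ> F)) = x (g \<circ> F)"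
      using x prim[OF f] prim[OF g] K FY by (auto simp: carrier_novikov_group)
    finally show "shift_map Y g K (\<lambda>h. level_map Y f h F (x (f \<circ> F) h)) h = level_map Y g h F (x (g \<circ> F) h)" .
  qed
  ultimately show "novikov_map M u Y p F x \<in> carrier (novikov_group M u Y p)"
    by (simp add: carrier_novikov_group novikov_map_def)
  fix y assume y: "y \<in> carrier (novikov_group N v X q)"
  have yh: "y (f \<circ> F) h \<in> carrier (level_pi1 X (f \<circ> F) h)" if "f \<in> primitives M u Y p" for f h
    using y prim[OF that] by (auto simp: carrier_novikov_group carrier_pi1_limit)
  show "novikov_map M u Y p F (x \<otimes>\<^bsub>novikov_group N v X q\<^esub> y) =
    novikov_map M u Y p F x \<otimes>\<^bsub>novikov_group M u Y p\<^esub> novikov_map M u Y p F y"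
    unfolding mult_novikov_group
  proof (subst novikov_map_def, intro restrict_ext ext)
    fix f h assume f: "f \<in> primitives M u Y p"
    show "level_map Y f h F ((\<lambda>f\<in>primitives N v X q. x f \<otimes>\<^bsub>pi1_limit X f\<^esub> y f) (f \<circ> F) h) =
      (novikov_map M u Y p F x f \<otimes>\<^bsub>pi1_limit Y f\<^esub> novikov_map M u Y p F y f) h"
      using f prim[OF f] hom_mult[OF level_map_hom[OF F sub] xh[OF f] yh[OF f]]
      by (simp add: novikov_map_def mult_pi1_limit)
  qed
qed

lemma novikov_map_inverse:
  assumes F: "continuous_map X Y F" and G: "continuous_map Y X G" and GF: "\<And>x. x \<in> topspace X \<Longrightarrow> G (F x) = x"
    and primF: "\<And>f. f \<in> primitives M u Y p \<Longrightarrow> f \<circ> F \<in> primitives N v X q"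
    and primG: "\<And>f. f \<in> primitives N v X q \<Longrightarrow> f \<circ> G \<in> primitives M u Y p"
    and x: "x \<in> carrier (novikov_group N v X q)"
  shows "novikov_map N v X q G (novikov_map M u Y p F x) = x"
proof
  fix f
  show "novikov_map N v X q G (novikov_map M u Y p F x) f = x f"
  proof (cases "f \<in> primitives N v X q")
    case True
    \<comment> \<open>As a function \<open>f'\<close> may differ from \<open>f\<close> off
      \<open>topspace X\<close>, so the two can be different indices of the family \<open>x\<close>.
      They agree on \<open>topspace X\<close>, and the compatibility condition with bound 0
      identifies their components.\<close>
    define f' where "f' = f \<circ> G \<circ> F"
    have f': "f' \<in> primitives N v X q" unfolding f'_def using primF[OF primG[OF True]] .
    have eq: "f' y = f y" if "y \<in> topspace X" for y using GF[OF that] by (simp add: f'_def)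
    have xh: "x f' h \<in> carrier (level_pi1 X f' h)" for h
      using x f' by (auto simp: carrier_novikov_group carrier_pi1_limit)
    have sub1: "F ` sublevel X f' h \<subseteq> sublevel Y (f \<circ> G) h" for h
      unfolding f'_def by (rule sublevel_comp_subset[OF F])
    have sub2: "(G \<circ> F) ` sublevel X f' h \<subseteq> sublevel X f h" for h
      using sub1 sublevel_comp_subset[OF G, of f h] by fastforce
    have "novikov_map N v X q G (novikov_map M u Y p F x) f h = x f h" for h
    proof -
      have "novikov_map N v X q G (novikov_map M u Y p F x) f h =
        level_map X f h G (level_map Y (f \<circ> G) h F (x f' h))"
        using True primG[OF True] by (simp add: novikov_map_def f'_def)
      also have "\<dots> = level_map X f h (G \<circ> F) (x f' h)"
        by (rule level_map_compose[OF F sub1 G sublevel_comp_subset[OF G] xh])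
      also have "\<dots> = level_map X f h id (x f' h)"
        using GF by (intro level_map_cong[OF continuous_map_compose[OF F G] sub2 _ xh]) auto
      also have "\<dots> = shift_map X f 0 (x f') h" by (simp add: shift_map_def)
      also have "shift_map X f 0 (x f') = x f"
        using x True f' eq by (auto simp: carrier_novikov_group)
      finally show ?thesis .
    qed
    then show ?thesis by auto
  next
    case False
    then show ?thesis using x by (simp add: novikov_map_def carrier_novikov_group extensional_def)
  qed
qed

lemma novikov_group_iso:
  assumes F: "continuous_map X Y F" and G: "continuous_map Y X G"
    and GF: "\<And>x. x \<in> topspace X \<Longrightarrow> G (F x) = x" and FG: "\<And>y. y \<in> topspace Y \<Longrightarrow> F (G y) = y"
    and primF: "\<And>f. f \<in> primitives M u Y p \<Longrightarrow> f \<circ> F \<in> primitives N v X q"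
    and primG: "\<And>f. f \<in> primitives N v X q \<Longrightarrow> f \<circ> G \<in> primitives M u Y p"
  shows "novikov_group N v X q \<cong> novikov_group M u Y p"
proof -
  have homF: "novikov_map M u Y p F \<in> hom (novikov_group N v X q) (novikov_group M u Y p)"
    using F primF by (rule novikov_map_hom)
  have homG: "novikov_map N v X q G \<in> hom (novikov_group M u Y p) (novikov_group N v X q)"
    using G primG by (rule novikov_map_hom)
  have "bij_betw (novikov_map M u Y p F) (carrier (novikov_group N v X q)) (carrier (novikov_group M u Y p))"
  proof (rule bij_betw_byWitness[where f' = "novikov_map N v X q G"])
    show "\<forall>x\<in>carrier (novikov_group N v X q). novikov_map N v X q G (novikov_map M u Y p F x) = x"
      using novikov_map_inverse[OF F G GF primF primG] by blast
    show "\<forall>y\<in>carrier (novikov_group M u Y p). novikov_map M u Y p F (novikov_map N v X q G y) = y"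
      using novikov_map_inverse[OF G F FG primG primF] by blast
  qed (use homF homG in \<open>auto simp: hom_def\<close>)
  then show ?thesis using homF by (auto simp: is_iso_def iso_def)
qed

section \<open>Integration covers\<close>

lemma cohomology_relD:
  assumes "(\<alpha>, \<beta>) \<in> cohomology_rel M"
  shows "closed_form M \<alpha>" "closed_form M \<beta>" "\<exists>k. primitive M (\<lambda>c x v. \<beta> c x v - \<alpha> c x v) k"
  using assms by (auto simp: cohomology_rel_def)

lemma de_Rham_H1_closed: "u \<in> de_Rham_H1 M \<Longrightarrow> \<alpha> \<in> u \<Longrightarrow> closed_form M \<alpha>"
  by (auto simp: de_Rham_H1_def quotient_def dest: cohomology_relD)

lemma de_Rham_H1_nonempty: "u \<in> de_Rham_H1 M \<Longrightarrow> u \<noteq> {}"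
  by (auto simp: de_Rham_H1_def quotient_def intro: cohomology_rel_refl)

lemma pullback_class_iff:
  "\<beta> \<in> pullback_class M N \<phi> u \<longleftrightarrow> (\<exists>\<alpha>\<in>u. (pullback_form N \<phi> \<alpha>, \<beta>) \<in> cohomology_rel M)"
  by (auto simp: pullback_class_def)

lemma zero_H1_iff: "\<omega> \<in> zero_H1 M \<longleftrightarrow> closed_form M \<omega> \<and> (\<exists>k. primitive M \<omega> k)"
  by (simp add: zero_H1_def cohomology_rel_def closed_form_zero)

lemma primitive_diff:
  assumes "smooth_structure M" "primitive M \<omega> f" "primitive M \<omega>' g"
  shows "primitive M (\<lambda>c x v. \<omega> c x v - \<omega>' c x v) (\<lambda>x. f x + - g x)"
  using primitive_add[OF assms(1,2) primitive_minus[OF assms(1,3)]] by simp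

lemma one_form_diff:
  assumes M: "smooth_structure M" and \<alpha>: "one_form M \<alpha>" and \<beta>: "one_form M \<beta>"
  shows "one_form M (\<lambda>c x v. \<alpha> c x v - \<beta> c x v)"
  unfolding one_form_def
proof (intro conjI ballI allI)
  fix c assume c: "c \<in> atlas M"
  show "linear (\<lambda>v. \<alpha> c x v - \<beta> c x v)" if "x \<in> fst c" for x
    using one_form_linear[OF \<alpha> c that] one_form_linear[OF \<beta> c that] by (rule linear_compose_sub)
  show "smooth_on (snd c ` fst c) (\<lambda>y. \<alpha> c (chart_inv c y) v - \<beta> c (chart_inv c y) v)" for v
    using smooth_on_add[OF chart_open_image[OF M c] one_form_smooth[OF \<alpha> c, of v]
      smooth_on_minus[OF chart_open_image[OF M c] one_form_smooth[OF \<beta> c, of v]]] by simp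
next
  fix c d x v assume "c \<in> atlas M" "d \<in> atlas M" "x \<in> fst c \<inter> fst d"
  then have "\<alpha> c x v = \<alpha> d x (frechet_derivative (snd d \<circ> chart_inv c) (at (snd c x)) v)"
    "\<beta> c x v = \<beta> d x (frechet_derivative (snd d \<circ> chart_inv c) (at (snd c x)) v)"
    using \<alpha> \<beta> unfolding one_form_def by blast+
  then show "\<alpha> c x v - \<beta> c x v = \<alpha> d x (frechet_derivative (snd d \<circ> chart_inv c) (at (snd c x)) v) -
    \<beta> d x (frechet_derivative (snd d \<circ> chart_inv c) (at (snd c x)) v)" by simp
qed

text \<open>The pullback of \<open>\<alpha>\<close> represents its own class because it is closed;
  being in the zero class, it is exact.\<close>

lemma primitive_of_trivial_pullback_class:
  assumes L: "smooth_structure L" and M: "smooth_structure M" and p: "smooth_map L M p"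
    and zero: "pullback_class L M p u = zero_H1 L" and \<alpha>: "\<alpha> \<in> u" "closed_form M \<alpha>"
  shows "\<exists>f. primitive L (pullback_form M p \<alpha>) f"
proof -
  have "pullback_form M p \<alpha> \<in> pullback_class L M p u"
    using cohomology_rel_refl[OF closed_form_pullback[OF L M p \<alpha>(2)]] \<alpha>(1)
    by (auto simp: pullback_class_iff)
  then show ?thesis by (simp add: zero zero_H1_iff)
qed

text \<open>A class is a set of forms, so both inclusions are needed. Adding primitives gives the
  first and subtracting them the second, for which one form of \<open>u\<close> must be at
  hand.\<close>

lemma pullback_class_eq_zero:
  assumes L: "smooth_structure L" and M: "smooth_structure M" and p: "smooth_map L M p"
    and u: "u \<noteq> {}" "\<And>\<alpha>. \<alpha> \<in> u \<Longrightarrow> closed_form M \<alpha>"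
    and prim: "\<And>\<alpha>. \<alpha> \<in> u \<Longrightarrow> \<exists>f. primitive L (pullback_form M p \<alpha>) f"
  shows "pullback_class L M p u = zero_H1 L"
proof (intro equalityI subsetI)
  fix \<omega> assume "\<omega> \<in> pullback_class L M p u"
  then obtain \<alpha> where \<alpha>: "\<alpha> \<in> u" "(pullback_form M p \<alpha>, \<omega>) \<in> cohomology_rel L"
    by (auto simp: pullback_class_iff)
  obtain f where f: "primitive L (pullback_form M p \<alpha>) f" using prim[OF \<alpha>(1)] by blast
  obtain k where k: "primitive L (\<lambda>c x v. \<omega> c x v - pullback_form M p \<alpha> c x v) k"
    using cohomology_relD(3)[OF \<alpha>(2)] by blast
  have "primitive L \<omega> (\<lambda>x. k x + f x)"
    using primitive_add[OF L k f] by simp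
  then show "\<omega> \<in> zero_H1 L" using cohomology_relD(2)[OF \<alpha>(2)] by (auto simp: zero_H1_iff)
next
  fix \<omega> assume "\<omega> \<in> zero_H1 L"
  then obtain k where \<omega>: "closed_form L \<omega>" and k: "primitive L \<omega> k" by (auto simp: zero_H1_iff)
  obtain \<alpha> where \<alpha>: "\<alpha> \<in> u" using u by blast
  obtain f where f: "primitive L (pullback_form M p \<alpha>) f" using prim[OF \<alpha>(1)] by blast
  have "(pullback_form M p \<alpha>, \<omega>) \<in> cohomology_rel L"
    using primitive_diff[OF L k f] \<omega> closed_form_pullback[OF L M p u(2)[OF \<alpha>]]
    by (auto simp: cohomology_rel_def)
  then show "\<omega> \<in> pullback_class L M p u" using \<alpha> by (auto simp: pullback_class_iff)
qed

text \<open>Functoriality of the pullback along the factorisation of \<open>\<psi>\<close> as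
  \<open>q \<circ> F\<close>, which holds on \<open>topspace\<close> only. It is used with
  \<open>F\<close> the natural map \<open>snd\<close> and with \<open>F\<close> a homeomorphism
  between components.\<close>

lemma primitive_lift:
  assumes L: "smooth_structure L" and N: "smooth_structure N" and q: "local_homeo Y (mtop N) q"
    and F: "smooth_map L (cover_manifold N Y q) F" and \<alpha>: "one_form N \<alpha>"
    and comm: "\<And>x. x \<in> topspace (mtop L) \<Longrightarrow> q (F x) = \<psi> x"
    and f: "primitive (cover_manifold N Y q) (pullback_form N q \<alpha>) f"
  shows "primitive L (pullback_form N \<psi> \<alpha>) (f \<circ> F)"
proof (rule primitive_cong[rotated])
  let ?Y = "cover_manifold N Y q"
  have Y: "smooth_structure ?Y" using N q by (rule cover_smooth_structure)
  have qs: "smooth_map ?Y N q" using N q by (rule cover_projection_smooth)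
  show "primitive L (pullback_form ?Y F (pullback_form N q \<alpha>)) (f \<circ> F)"
    using one_form_pullback[OF Y N qs \<alpha>] f by (rule primitive_pullback[OF L Y F])
  fix c x v assume c: "c \<in> atlas L" "x \<in> fst c"
  have "pullback_form ?Y F (pullback_form N q \<alpha>) c x v = pullback_form N (q \<circ> F) \<alpha> c x v"
    by (rule pullback_form_compose[OF L Y N F qs \<alpha> c])
  also have "\<dots> = pullback_form N \<psi> \<alpha> c x v"
    using comm by (intro pullback_form_cong[OF L _ c]) simp
  finally show "pullback_form ?Y F (pullback_form N q \<alpha>) c x v = pullback_form N \<psi> \<alpha> c x v" .
qed

section \<open>Pulled-back integration covers and the induced morphism\<close>

theorem proposition1p3:
  fixes M1 :: "('a, 'd::real_inner) manifold"
    and M2 :: "('b, 'e::real_inner) manifold"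
    and u2 :: "('b, 'e) form1 set"
    and X2 :: "'c topology" and p2 :: "'c \<Rightarrow> 'b"
    and \<phi> :: "'a \<Rightarrow> 'b"
  assumes M1: "closed_connected_manifold M1"
    and M2: "closed_connected_manifold M2"
    and u2: "u2 \<in> de_Rham_H1 M2" "u2 \<noteq> zero_H1 M2"
    and X2: "integration_cover M2 u2 X2 p2"
    and \<phi>: "smooth_map M1 M2 \<phi>"
  shows
    "let P = pullback_cover (mtop M1) \<phi> X2 p2;
         u1 = pullback_class M1 M2 \<phi> u2
     in (\<forall>C\<in>connected_components_of P. integration_cover M1 u1 (subtopology P C) fst) \<and>
        (u1 \<noteq> zero_H1 M1 \<longrightarrow>
          (\<forall>C\<in>connected_components_of P. \<forall>C'\<in>connected_components_of P.
             novikov_group M1 u1 (subtopology P C) fst \<cong>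
             novikov_group M1 u1 (subtopology P C') fst) \<and>
          (\<forall>C\<in>connected_components_of P.
             (\<forall>f\<in>primitives M2 u2 X2 p2.
                f \<circ> snd \<in> primitives M1 u1 (subtopology P C) fst \<and>
                (\<forall>h. snd ` sublevel (subtopology P C) (f \<circ> snd) h \<subseteq> sublevel X2 f h \<and>
                   continuous_map (level_space (subtopology P C) (f \<circ> snd) h) (level_space X2 f h)
                     (collapse_map (sublevel X2 f h) snd) \<and>
                   group_hom (level_pi1 (subtopology P C) (f \<circ> snd) h) (level_pi1 X2 f h)
                     (level_map X2 f h snd))) \<and>
             group_hom (novikov_group M1 u1 (subtopology P C) fst) (novikov_group M2 u2 X2 p2)
               (novikov_map M2 u2 X2 p2 snd)))"
proof -
  define P where "P = pullback_cover (mtop M1) \<phi> X2 p2"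
  define u1 where "u1 = pullback_class M1 M2 \<phi> u2"
  have S1: "smooth_structure M1" and S2: "smooth_structure M2" and con1: "connected_space (mtop M1)"
    using M1 M2 by (simp_all add: closed_connected_manifold_def smooth_manifold_imp_smooth_structure)
  have \<phi>c: "continuous_map (mtop M1) (mtop M2) \<phi>" using \<phi> by (simp add: smooth_map_def)
  have reg2: "regular_covering X2 (mtop M2) p2" and zero2: "pullback_class (cover_manifold M2 X2 p2) M2 p2 u2 = zero_H1 (cover_manifold M2 X2 p2)"
    using X2 by (simp_all add: integration_cover_def)
  have lh2: "local_homeo X2 (mtop M2) p2"
    using reg2 by (intro covering_map_imp_local_homeo) (simp add: regular_covering_def)
  have cl2: "closed_form M2 \<alpha>" if "\<alpha> \<in> u2" for \<alpha> using u2(1) that by (rule de_Rham_H1_closed)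
  have of2: "one_form M2 \<alpha>" if "\<alpha> \<in> u2" for \<alpha> using cl2[OF that] by (simp add: closed_form_def)
  have cl1: "closed_form M1 \<beta>" if "\<beta> \<in> u1" for \<beta>
    using that by (auto simp: u1_def pullback_class_iff dest: cohomology_relD)
  have of1: "one_form M1 \<beta>" if "\<beta> \<in> u1" for \<beta> using cl1[OF that] by (simp add: closed_form_def)
  have \<phi>u1: "pullback_form M2 \<phi> \<alpha> \<in> u1" if "\<alpha> \<in> u2" for \<alpha>
    using that cohomology_rel_refl[OF closed_form_pullback[OF S1 S2 \<phi> cl2[OF that]]]
    by (auto simp: u1_def pullback_class_iff)
  have prim2: "\<exists>f. primitive (cover_manifold M2 X2 p2) (pullback_form M2 p2 \<alpha>) f" if "\<alpha> \<in> u2" for \<alpha>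
    using cover_smooth_structure[OF S2 lh2] S2 cover_projection_smooth[OF S2 lh2] zero2 that cl2[OF that]
    by (rule primitive_of_trivial_pullback_class)

  have reg: "regular_covering (subtopology P C) (mtop M1) fst" if C: "C \<in> connected_components_of P" for C
    unfolding P_def
    using C manifold_locally_connected[OF S1]
    by (intro regular_covering_pullback_component[OF reg2 \<phi>c con1]) (simp_all add: P_def)
  have lh: "local_homeo (subtopology P C) (mtop M1) fst" if C: "C \<in> connected_components_of P" for C
    using reg[OF C] by (intro covering_map_imp_local_homeo) (simp add: regular_covering_def)
  have CP: "topspace (subtopology P C) = C" if "C \<in> connected_components_of P" for C
    using connected_components_of_subset[OF that] by (simp add: Int_absorb1)
  have comm: "p2 (snd x) = \<phi> (fst x)" if "C \<in> connected_components_of P" "x \<in> C" for C x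
    using connected_components_of_subset[OF that(1)] that(2) by (auto simp: P_def topspace_pullback_cover)
  have sndc: "continuous_map (subtopology P C) X2 snd" for C
    unfolding P_def by (intro continuous_map_from_subtopology continuous_map_pullback_cover_snd)
  have SC: "smooth_structure (cover_manifold M1 (subtopology P C) fst)"
    and fsts: "smooth_map (cover_manifold M1 (subtopology P C) fst) M1 fst"
    if "C \<in> connected_components_of P" for C
    using cover_smooth_structure[OF S1 lh[OF that]] cover_projection_smooth[OF S1 lh[OF that]] .

  \<comment> \<open>The map \<open>\<phi> \<circ> fst\<close> factors as
    \<open>p2 \<circ> snd\<close> on \<open>C\<close>; the first factorisation matches the lift of
    the form from \<open>M1\<close>, the second produces the primitive.\<close>
  have lift: "primitive (cover_manifold M1 (subtopology P C) fst) (pullback_form M1 fst (pullback_form M2 \<phi> \<alpha>)) (f \<circ> snd)"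
    if C: "C \<in> connected_components_of P" and \<alpha>: "\<alpha> \<in> u2"
      and f: "primitive (cover_manifold M2 X2 p2) (pullback_form M2 p2 \<alpha>) f" for C \<alpha> f
  proof (rule primitive_cong[rotated])
    have "smooth_map (cover_manifold M1 (subtopology P C) fst) (cover_manifold M2 X2 p2) snd"
      using comm[OF C] CP[OF C] by (intro cover_lift_smooth[OF S1 S2 lh[OF C] lh2 sndc \<phi>]) auto
    then show "primitive (cover_manifold M1 (subtopology P C) fst) (pullback_form M2 (\<phi> \<circ> fst) \<alpha>) (f \<circ> snd)"
      using comm[OF C] CP[OF C] by (intro primitive_lift[OF SC[OF C] S2 lh2 _ of2[OF \<alpha>] _ f]) auto
    show "pullback_form M2 (\<phi> \<circ> fst) \<alpha> c x v = pullback_form M1 fst (pullback_form M2 \<phi> \<alpha>) c x v"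
      if "c \<in> atlas (cover_manifold M1 (subtopology P C) fst)" "x \<in> fst c" for c x v
      using pullback_form_compose[OF SC[OF C] S1 S2 fsts[OF C] \<phi> of2[OF \<alpha>] that] by simp
  qed

  have int: "integration_cover M1 u1 (subtopology P C) fst" if C: "C \<in> connected_components_of P" for C
    unfolding integration_cover_def
  proof (intro conjI reg[OF C])
    show "connected_space (subtopology P C)"
      using connectedin_connected_components_of[OF C] by (simp add: connectedin_def)
    let ?L = "cover_manifold M1 (subtopology P C) fst"
    show "pullback_class ?L M1 fst u1 = zero_H1 ?L"
    proof (rule pullback_class_eq_zero[OF SC[OF C] S1 fsts[OF C]])
      show "u1 \<noteq> {}" using \<phi>u1 de_Rham_H1_nonempty[OF u2(1)] by blast
      fix \<beta> assume \<beta>: "\<beta> \<in> u1"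
      then show "closed_form M1 \<beta>" by (rule cl1)
      obtain \<alpha> where \<alpha>: "\<alpha> \<in> u2" "(pullback_form M2 \<phi> \<alpha>, \<beta>) \<in> cohomology_rel M1"
        using \<beta> by (auto simp: u1_def pullback_class_iff)
      obtain k where k: "primitive M1 (\<lambda>c x v. \<beta> c x v - pullback_form M2 \<phi> \<alpha> c x v) k"
        using cohomology_relD(3)[OF \<alpha>(2)] by blast
      obtain f where f: "primitive (cover_manifold M2 X2 p2) (pullback_form M2 p2 \<alpha>) f"
        using prim2[OF \<alpha>(1)] by blast
      \<comment> \<open>A form \<open>\<beta>\<close> of the class is the pullback of
        \<open>\<alpha>\<close> only up to an exact form with primitive \<open>k\<close>. Hence its
        primitive on the component is \<open>k \<circ> fst\<close> plus the lifted
        \<open>f \<circ> snd\<close>.\<close>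
      have "primitive ?L (pullback_form M1 fst (\<lambda>c x v. \<beta> c x v - pullback_form M2 \<phi> \<alpha> c x v)) (k \<circ> fst)"
        by (rule primitive_pullback[OF SC[OF C] S1 fsts[OF C] one_form_diff[OF S1 of1[OF \<beta>] of1[OF \<phi>u1[OF \<alpha>(1)]]] k])
      \<comment> \<open>\<open>pullback_form\<close> picks its chart independently of the form, so
        it is additive in the form by definition.\<close>
      from primitive_add[OF SC[OF C] this lift[OF C \<alpha>(1) f]]
      have "primitive ?L (pullback_form M1 fst \<beta>) (\<lambda>x. (k \<circ> fst) x + (f \<circ> snd) x)"
        by (rule primitive_cong[rotated]) (simp add: pullback_form_def[of M1 fst] Let_def)
      then show "\<exists>f. primitive ?L (pullback_form M1 fst \<beta>) f" by blast
    qed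
  qed

  \<comment> \<open>A map over the identity of \<open>M1\<close> carries a primitive of the lift of
    \<open>\<beta>\<close> to a primitive of the lift of the same \<open>\<beta>\<close>.\<close>
  have transport: "f \<circ> h \<in> primitives M1 u1 (subtopology P C) fst"
    if C: "C \<in> connected_components_of P" "C' \<in> connected_components_of P"
      and h: "continuous_map (subtopology P C) (subtopology P C') h" "\<And>w. w \<in> C \<Longrightarrow> fst (h w) = fst w"
      and f: "f \<in> primitives M1 u1 (subtopology P C') fst" for C C' h f
  proof -
    obtain \<beta> where \<beta>: "\<beta> \<in> u1" "primitive (cover_manifold M1 (subtopology P C') fst) (pullback_form M1 fst \<beta>) f"
      using f by (auto simp: primitives_def)
    have "smooth_map (cover_manifold M1 (subtopology P C) fst) (cover_manifold M1 (subtopology P C') fst) h"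
      using h(2) CP[OF C(1)]
      by (intro cover_lift_smooth[OF S1 S1 lh[OF C(1)] lh[OF C(2)] h(1) smooth_map_id[OF S1]]) auto
    then have "primitive (cover_manifold M1 (subtopology P C) fst) (pullback_form M1 fst \<beta>) (f \<circ> h)"
      using h(2) CP[OF C(1)]
      by (intro primitive_lift[OF SC[OF C(1)] S1 lh[OF C(2)] _ of1[OF \<beta>(1)] _ \<beta>(2)]) auto
    then show ?thesis using \<beta>(1) by (auto simp: primitives_def)
  qed

  have iso: "novikov_group M1 u1 (subtopology P C) fst \<cong> novikov_group M1 u1 (subtopology P C') fst"
    if C: "C \<in> connected_components_of P" "C' \<in> connected_components_of P" for C C'
  proof -
    \<comment> \<open>Both components lie over all of \<open>M1\<close>, so a point of
      \<open>C\<close> has a partner in \<open>C'\<close> over the same base point, and a deck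
      transformation can join them.\<close>
    have surj: "fst ` D = topspace (mtop M1)" if "D \<in> connected_components_of P" for D
      using reg[OF that] CP[OF that] by (simp add: regular_covering_def covering_map_def)
    obtain z where z: "z \<in> C" using nonempty_connected_components_of[OF C(1)] by blast
    then have "fst z \<in> fst ` C'" using surj[OF C(1)] surj[OF C(2)] by blast
    then obtain z' where z': "z' \<in> C'" "fst z = fst z'" by auto
    obtain h where h: "homeomorphic_map (subtopology P C) (subtopology P C') h" "\<And>w. w \<in> C \<Longrightarrow> fst (h w) = fst w"
      using pullback_component_homeo[OF reg2 C[unfolded P_def] z z'] unfolding P_def by metis
    obtain g where "homeomorphic_maps (subtopology P C) (subtopology P C') h g"
      using h(1) by (auto simp: homeomorphic_map_maps)
    then have g: "continuous_map (subtopology P C) (subtopology P C') h" "continuous_map (subtopology P C') (subtopology P C) g"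
      "\<And>x. x \<in> C \<Longrightarrow> g (h x) = x" "\<And>y. y \<in> C' \<Longrightarrow> h (g y) = y"
      using CP[OF C(1)] CP[OF C(2)] unfolding homeomorphic_maps_def by auto
    have "g w \<in> C" if "w \<in> C'" for w
      using g(2) that CP[OF C(1)] CP[OF C(2)] by (auto simp: continuous_map_def)
    \<comment> \<open>The inverse also covers the identity, by evaluating \<open>h\<close> at
      \<open>g w\<close>; this makes primitives transportable in both directions.\<close>
    then have fg: "fst (g w) = fst w" if "w \<in> C'" for w
      using h(2)[of "g w"] g(4)[OF that] that by auto
    show ?thesis
      using g(3,4) CP[OF C(1)] CP[OF C(2)] transport[OF C g(1) h(2)] transport[OF C(2,1) g(2) fg]
      by (intro novikov_group_iso[OF g(1,2)]) auto
  qed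

  have prim_snd: "f \<circ> snd \<in> primitives M1 u1 (subtopology P C) fst"
    if C: "C \<in> connected_components_of P" and f: "f \<in> primitives M2 u2 X2 p2" for C f
    using f lift[OF C] \<phi>u1 by (auto simp: primitives_def)
  have level: "snd ` sublevel (subtopology P C) (f \<circ> snd) h \<subseteq> sublevel X2 f h \<and>
      continuous_map (level_space (subtopology P C) (f \<circ> snd) h) (level_space X2 f h)
        (collapse_map (sublevel X2 f h) snd) \<and>
      group_hom (level_pi1 (subtopology P C) (f \<circ> snd) h) (level_pi1 X2 f h) (level_map X2 f h snd)" for C f h
    using sublevel_comp_subset[OF sndc] continuous_collapse_map[OF sndc sublevel_comp_subset[OF sndc]]
      level_map_hom[OF sndc sublevel_comp_subset[OF sndc]]
    by (simp add: group_hom_def group_hom_axioms_def group_level_pi1)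
  have nov: "group_hom (novikov_group M1 u1 (subtopology P C) fst) (novikov_group M2 u2 X2 p2)
      (novikov_map M2 u2 X2 p2 snd)" if C: "C \<in> connected_components_of P" for C
    using novikov_map_hom[OF sndc prim_snd[OF C]]
    by (simp add: group_hom_def group_hom_axioms_def group_novikov_group)
  show ?thesis
    unfolding Let_def P_def[symmetric] u1_def[symmetric]
    using int iso prim_snd level nov by (intro conjI impI ballI allI) auto
qed

end
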